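(* Let $\mathfrak{m}$ be an ideal of $\mathcal{O}$ and let $P_d\in\mathcal{O}$ be a monic irreducible polynomial of degree $d$ such that $(P_d)$ does not divide $\mathfrak{m}$. Let $k\geqslant 0$ and $m$ be integers and let $\varphi\in S^1_{k,m}(\Gamma_0(\mathfrak{m}))$. Then $\varphi\in Ker(\mathbf{T}_{P_d})$ if and only if $\delta_1(\varphi)\in Ker(\mathbf{U}_{P_d}^2)$.
   Context: Let $q$ be a power of a prime $p$, $K=\mathbb{F}_q(t)$, $\mathcal{O}=\mathbb{F}_q[t]$, $K_\infty=\mathbb{F}_q((1/t))$ the completion of $K$ at the place $1/t$, and $\mathbb{C}_\infty$ the completion of an algebraic closure of $K_\infty$. Let $\Omega=\mathbb{P}^1(\mathbb{C}_\infty)-\mathbb{P}^1(K_\infty)$ be the Drinfeld upper half-plane with its rigid analytic structure; $GL_2(K_\infty)$ acts on it by Möbius transformations. For $\gamma=\begin{pmatrix}a&b\\c&d\end{pmatrix}\in GL_2(K_\infty)$, integers $k,m$, and $\varphi:\Omega\to\mathbb{C}_\infty$, put $$(\varphi|_{k,m}\gamma)(z)=\varphi(\gamma z)(\det\gamma)^m(cz+d)^{-k}.$$ For an ideal $\mathfrak{n}$ of $\mathcal{O}$ let $\Gamma_0(\mathfrak{n})=\{\begin{pmatrix}a&b\\c&d\end{pmatrix}\in GL_2(\mathcal{O}): c\equiv 0 \pmod{\mathfrak{n}}\}$. The $\mathbb{C}_\infty$-vector space $S^1_{k,m}(\Gamma_0(\mathfrak{n}))$ of cusp forms of weight $k\geqslant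 0$ and type $m$ (which matters only modulo $q-1$) for $\Gamma_0(\mathfrak{n})$ consists of the rigid analytic functions $\varphi:\Omega\to\mathbb{C}_\infty$ with $\varphi|_{k,m}\gamma=\varphi$ for all $\gamma\in\Gamma_0(\mathfrak{n})$ that are holomorphic at all cusps and vanish at all cusps (in the usual sense for Drinfeld modular forms; the cusps are the $\Gamma_0(\mathfrak{n})$-equivalence classes in $\mathbb{P}^1(K)$). An integer representative $m$ of the type is fixed in the formulas below (note that the integer $m$ is unrelated to the ideal $\mathfrak{m}$). For $(P_d)\nmid\mathfrak{m}$, the following Hecke operators act respectively on $S^1_{k,m}(\Gamma_0(\mathfrak{m}))$ and on $S^1_{k,m}(\Gamma_0(\mathfrak{m}P_d))$: $$\mathbf{T}_{P_d}(\varphi)=P_d^{k-m}\,\varphi|_{k,m}\begin{pmatrix}P_d&0\\0&1\end{pmatrix}+P_d^{k-m}\sum_{Q\in\mathcal{O},\ \deg Q<d}\varphi|_{k,m}\begin{pmatrix}1&Q\\0&P_d\end{pmatrix},$$ $$\mathbf{U}_{P_d}(\varphi)=P_d^{k-m}\sum_{Q\in\mathcal{O},\ \deg Q<d}\varphi|_{k,m}\begin{pmatrix}1&Q\\0&P_d\end{pmatrix}$$ (the sums include $Q=0$). The degeneracy map $\delta_1:S^1_{k,m}(\Gamma_0(\mathfrak{m}))\to S^1_{k,m}(\Gamma_0(\mathfrak{m}P_d))$ is the inclusion $\delta_1\varphi=\varphi$. *)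

theory Defs
  imports
    "HOL-Analysis.Analysis"
    "HOL-Computational_Algebra.Computational_Algebra"
    "HOL-Algebra.Ideal_Product"
    "HOL-Algebra.Algebraic_Closure_Type"
begin

text \<open>
  The finite field \<open>F\<^sub>q\<close> is a type \<open>'a\<close> of class \<open>finite\<close> and \<open>field\<close>, with \<open>q = CARD('a)\<close>;
  \<open>'a poly\<close> is \<open>F\<^sub>q[t]\<close>, and \<open>'a fls\<close> is \<open>F\<^sub>q((1/t))\<close>, whose Laurent variable \<open>fls_X\<close> stands
  for \<open>1/t\<close>. Thus \<open>t\<close> is \<open>fls_X_inv\<close>.
\<close>

definition emb_poly :: "'a::field poly \<Rightarrow> 'a fls" where
  "emb_poly f = poly (map_poly fls_const f) fls_X_inv"

definition ratfun_field :: "'a::field fls set" where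
  "ratfun_field = {emb_poly f / emb_poly g | f g. g \<noteq> 0}"

definition abs_infinity :: "'a::{finite,field} fls \<Rightarrow> real" where
  "abs_infinity x = (if x = 0 then 0 else real CARD('a) powi (- fls_subdegree x))"

text \<open>
  The field \<open>C\<^sub>\<infinity>\<close> is determined only up to isometric isomorphism. It is represented by a complete
  metric field \<open>'c\<close>, with absolute value \<open>\<lambda>x. dist x 0\<close>, and an embedding \<open>\<iota>\<close> of \<open>K\<^sub>\<infinity>\<close>. The
  predicate says that \<open>\<iota>\<close> extends to an embedding of the algebraic closure of \<open>K\<^sub>\<infinity>\<close> with dense
  image, and that the metric comes from a non-archimedean absolute value extending the one of
  \<open>K\<^sub>\<infinity>\<close> (with \<open>\<bar>t\<bar> = q\<close>). Completeness is provided by the class \<open>complete_space\<close>.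
\<close>

definition completed_alg_closure ::
    "('a::{finite,field} fls \<Rightarrow> 'c::{field,complete_space}) \<Rightarrow> bool" where
  "completed_alg_closure \<iota> \<longleftrightarrow>
     (\<forall>x y z :: 'c. dist (x + z) (y + z) = dist x y) \<and>
     (\<forall>x y :: 'c. dist (x * y) 0 = dist x 0 * dist y 0) \<and>
     (\<forall>x y z :: 'c. dist x z \<le> max (dist x y) (dist y z)) \<and>
     (\<forall>x. dist (\<iota> x) 0 = abs_infinity x) \<and>
     (\<exists>j :: 'a fls alg_closure \<Rightarrow> 'c.
        j 1 = 1 \<and> (\<forall>x y. j (x + y) = j x + j y) \<and> (\<forall>x y. j (x * y) = j x * j y) \<and>
        (\<forall>x. j (to_ac x) = \<iota> x) \<and> closure (range j) = UNIV)"

text \<open>As \<open>\<infinity>\<close> is a \<open>K\<^sub>\<infinity>\<close>-rational point, \<open>P\<^sup>1(C\<^sub>\<infinity>) - P\<^sup>1(K\<^sub>\<infinity>)\<close> is \<open>C\<^sub>\<infinity> - K\<^sub>\<infinity>\<close>.\<close>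

definition upper_half_plane :: "('a::{finite,field} fls \<Rightarrow> 'c::{field,complete_space}) \<Rightarrow> 'c set" where
  "upper_half_plane \<iota> = - range \<iota>"

text \<open>
  The affinoid subsets of the standard admissible covering of \<open>\<Omega>\<close>. The functions on such a set
  are the uniform limits of rational functions without poles in it.
\<close>

definition affinoid :: "('a::{finite,field} fls \<Rightarrow> 'c::{field,complete_space}) \<Rightarrow> nat \<Rightarrow> 'c set" where
  "affinoid \<iota> n = {z. dist z 0 \<le> real CARD('a) ^ n \<and>
     (\<forall>x \<in> range \<iota>. dist z x \<ge> 1 / real CARD('a) ^ n)}"

definition rigid_analytic ::
    "('a::{finite,field} fls \<Rightarrow> 'c::{field,complete_space}) \<Rightarrow> ('c \<Rightarrow> 'c) \<Rightarrow> bool" where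
  "rigid_analytic \<iota> \<phi> \<longleftrightarrow> (\<forall>n. \<exists>f g :: nat \<Rightarrow> 'c poly.
     (\<forall>i. \<forall>z \<in> affinoid \<iota> n. poly (g i) z \<noteq> 0) \<and>
     uniform_limit (affinoid \<iota> n) (\<lambda>i z. poly (f i) z / poly (g i) z) \<phi> sequentially)"

definition mat2 :: "'r::zero \<Rightarrow> 'r \<Rightarrow> 'r \<Rightarrow> 'r \<Rightarrow> 'r ^ 2 ^ 2" where
  "mat2 a b c d = vector [vector [a, b], vector [c, d]]"

definition moebius ::
    "('a::{finite,field} fls \<Rightarrow> 'c::{field,complete_space}) \<Rightarrow> 'a fls ^ 2 ^ 2 \<Rightarrow> 'c \<Rightarrow> 'c" where
  "moebius \<iota> \<gamma> z = (\<iota> (\<gamma> $ 1 $ 1) * z + \<iota> (\<gamma> $ 1 $ 2)) / (\<iota> (\<gamma> $ 2 $ 1) * z + \<iota> (\<gamma> $ 2 $ 2))"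

text \<open>
  A function on \<open>\<Omega>\<close> is represented by its extension by \<open>0\<close> to \<open>'c\<close>. The slash operators preserve
  this convention: \<open>\<gamma>z\<close> stays in \<open>range \<iota>\<close> for \<open>z\<close> in \<open>range \<iota>\<close> (also when the denominator is \<open>0\<close>).
\<close>

definition slash ::
    "('a::{finite,field} fls \<Rightarrow> 'c::{field,complete_space}) \<Rightarrow> int \<Rightarrow> int \<Rightarrow>
     ('c \<Rightarrow> 'c) \<Rightarrow> 'a fls ^ 2 ^ 2 \<Rightarrow> 'c \<Rightarrow> 'c" where
  "slash \<iota> k m \<phi> \<gamma> z =
     \<phi> (moebius \<iota> \<gamma> z) * \<iota> (det \<gamma>) powi m * (\<iota> (\<gamma> $ 2 $ 1) * z + \<iota> (\<gamma> $ 2 $ 2)) powi (- k)"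

definition GL2_K :: "('a::field fls ^ 2 ^ 2) set" where
  "GL2_K = {\<nu>. (\<forall>i j. \<nu> $ i $ j \<in> ratfun_field) \<and> invertible \<nu>}"

definition Gamma0 :: "'a::field poly set \<Rightarrow> ('a fls ^ 2 ^ 2) set" where
  "Gamma0 I = {mat2 (emb_poly a) (emb_poly b) (emb_poly c) (emb_poly d) | a b c d.
     is_unit (a * d - b * c) \<and> c \<in> I}"

text \<open>
  For a cusp \<open>\<nu>\<infinity>\<close>, the group of translations in \<open>\<nu>\<^sup>-\<^sup>1 \<Gamma>\<^sub>0(I) \<nu>\<close>. The function \<open>\<phi>|\<nu>\<close> is invariant
  under it, and \<open>1 / e\<^sub>b(z)\<close> is the corresponding parameter at \<open>\<infinity>\<close>, where \<open>e\<^sub>b\<close> is the exponential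
  function of the lattice \<open>b\<close>. The customary scaling by a period of the Carlitz module only rescales
  the coefficients of an expansion.
\<close>

definition cusp_lattice :: "'a::field poly set \<Rightarrow> 'a fls ^ 2 ^ 2 \<Rightarrow> 'a fls set" where
  "cusp_lattice I \<nu> = {x. \<nu> ** mat2 1 x 0 1 ** matrix_inv \<nu> \<in> Gamma0 I}"

definition lattice_exp ::
    "('a::{finite,field} fls \<Rightarrow> 'c::{field,complete_space}) \<Rightarrow> 'a fls set \<Rightarrow> 'c \<Rightarrow> 'c" where
  "lattice_exp \<iota> b z =
     z * Lim (finite_subsets_at_top (b - {0})) (\<lambda>F. \<Prod>\<beta>\<in>F. 1 - z / \<iota> \<beta>)"

definition cusp_param ::
    "('a::{finite,field} fls \<Rightarrow> 'c::{field,complete_space}) \<Rightarrow> 'a fls set \<Rightarrow> 'c \<Rightarrow> 'c" where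
  "cusp_param \<iota> b z = 1 / lattice_exp \<iota> b z"

text \<open>
  \<open>\<phi>\<close> has the expansion \<open>\<Sum> a\<^sub>i (1 / e\<^sub>b(z))\<^sup>i\<close> near \<open>\<infinity>\<close>, that is, on the points \<open>z\<close> of \<open>\<Omega>\<close> whose
  imaginary absolute value (distance to \<open>K\<^sub>\<infinity>\<close>) is large.
\<close>

definition has_expansion ::
    "('a::{finite,field} fls \<Rightarrow> 'c::{field,complete_space}) \<Rightarrow> 'a fls set \<Rightarrow>
     ('c \<Rightarrow> 'c) \<Rightarrow> (nat \<Rightarrow> 'c) \<Rightarrow> bool" where
  "has_expansion \<iota> b \<phi> a \<longleftrightarrow> (\<exists>R. \<forall>z \<in> upper_half_plane \<iota>. infdist z (range \<iota>) > R \<longrightarrow>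
     (\<lambda>i. a i * cusp_param \<iota> b z ^ i) sums \<phi> z)"

text \<open>Since every element of \<open>P\<^sup>1(K)\<close> is \<open>\<nu>\<infinity>\<close> for some \<open>\<nu>\<close> in \<open>GL\<^sub>2(K)\<close>, all cusps are covered.\<close>

definition cusp_forms ::
    "('a::{finite,field} fls \<Rightarrow> 'c::{field,complete_space}) \<Rightarrow> int \<Rightarrow> int \<Rightarrow>
     'a poly set \<Rightarrow> ('c \<Rightarrow> 'c) set" where
  "cusp_forms \<iota> k m I = {\<phi>.
     (\<forall>z. z \<notin> upper_half_plane \<iota> \<longrightarrow> \<phi> z = 0) \<and>
     rigid_analytic \<iota> \<phi> \<and>
     (\<forall>\<gamma> \<in> Gamma0 I. slash \<iota> k m \<phi> \<gamma> = \<phi>) \<and>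
     (\<forall>\<nu> \<in> GL2_K. \<exists>a. has_expansion \<iota> (cusp_lattice I \<nu>) (slash \<iota> k m \<phi> \<nu>) a \<and> a 0 = 0)}"

definition hecke_U ::
    "('a::{finite,field} fls \<Rightarrow> 'c::{field,complete_space}) \<Rightarrow> int \<Rightarrow> int \<Rightarrow>
     'a poly \<Rightarrow> ('c \<Rightarrow> 'c) \<Rightarrow> 'c \<Rightarrow> 'c" where
  "hecke_U \<iota> k m P \<phi> = (\<lambda>z. \<iota> (emb_poly P) powi (k - m) *
     (\<Sum>Q | Polynomial.degree Q < Polynomial.degree P. slash \<iota> k m \<phi> (mat2 1 (emb_poly Q) 0 (emb_poly P)) z))"

definition hecke_T ::
    "('a::{finite,field} fls \<Rightarrow> 'c::{field,complete_space}) \<Rightarrow> int \<Rightarrow> int \<Rightarrow>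
     'a poly \<Rightarrow> ('c \<Rightarrow> 'c) \<Rightarrow> 'c \<Rightarrow> 'c" where
  "hecke_T \<iota> k m P \<phi> = (\<lambda>z.
     \<iota> (emb_poly P) powi (k - m) * slash \<iota> k m \<phi> (mat2 (emb_poly P) 0 0 1) z +
     \<iota> (emb_poly P) powi (k - m) *
       (\<Sum>Q | Polynomial.degree Q < Polynomial.degree P. slash \<iota> k m \<phi> (mat2 1 (emb_poly Q) 0 (emb_poly P)) z))"

definition degeneracy_1 :: "('c \<Rightarrow> 'c) \<Rightarrow> 'c \<Rightarrow> 'c" where
  "degeneracy_1 \<phi> = \<phi>"

definition op_kernel :: "('c \<Rightarrow> 'c::zero) set \<Rightarrow> (('c \<Rightarrow> 'c) \<Rightarrow> 'c \<Rightarrow> 'c) \<Rightarrow> ('c \<Rightarrow> 'c) set" where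
  "op_kernel S F = {\<phi> \<in> S. F \<phi> = (\<lambda>_. 0)}"

text \<open>Ideals of \<open>F\<^sub>q[t]\<close> are taken in the ring structure on the type \<open>'a poly\<close>.\<close>

abbreviation fq_poly_ring :: "'a::field poly ring" where
  "fq_poly_ring \<equiv> ring_of_type_algebra"

definition ideal_dvd :: "'a::field poly set \<Rightarrow> 'a poly set \<Rightarrow> bool" where
  "ideal_dvd I J \<longleftrightarrow> (\<exists>L. ideal L fq_poly_ring \<and> J = ideal_prod fq_poly_ring I L)"

end

theory Submission
  imports Defs
begin

text \<open>
  Write \<open>V \<phi>\<close> for \<open>\<phi>\<close> slashed with \<open>diag (P, 1)\<close>; then \<open>T = c V + U\<close> for a nonzero constant \<open>c\<close>. If \<open>\<phi>\<close> is
  invariant under translations by polynomials, then all \<open>q\<^sup>d\<close> summands of \<open>U (V \<phi>)\<close> are the same multiple of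
  \<open>\<phi>\<close>, so \<open>U V \<phi> = 0\<close> in characteristic \<open>p\<close> (\<open>hecke_U_hecke_V\<close>) and \<open>U T \<phi> = U U \<phi>\<close>. Hence \<open>T \<phi> = 0\<close> implies
  \<open>U U \<phi> = 0\<close>. Conversely, if \<open>U U \<phi> = 0\<close>, then \<open>\<psi> = T \<phi>\<close> is a function of the lower level with \<open>U \<psi> = 0\<close>, and it
  remains to show that \<open>\<psi> = 0\<close> (\<open>zero_if_hecke_U_zero\<close>).

  Choose \<open>N\<close> in the level that is not divisible by \<open>P\<close>. The operator \<open>T\<close> preserves invariance under the
  matrices of determinant \<open>1\<close> whose lower left entry is divisible by \<open>N\<close>, because these permute the points of
  the projective line over \<open>O / P\<close> that index the summands of \<open>T\<close> (\<open>invariant_hecke_T\<close>). As \<open>U \<psi> = 0\<close>, the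
  function \<open>V \<psi>\<close> is a multiple of \<open>T \<psi>\<close>, hence invariant, and \<open>U (V \<psi>) = 0\<close>. So this can be iterated: all
  \<open>V\<^sup>n \<psi>\<close> are invariant. Conjugating back, \<open>\<psi>\<close> is invariant under the lower triangular matrices with entry
  \<open>N / P\<^sup>n\<close>, that is, under a group that is no longer discrete. It contains matrices whose lower row
  \<open>(N, P\<^sup>n mod N) / P\<^sup>n\<close> is arbitrarily small. Such a matrix moves a given point \<open>z\<close> arbitrarily far up: the
  distance to \<open>K\<^sub>\<infinity>\<close> is multiplied by \<open>\<bar>c z + d\<bar>\<^sup>-\<^sup>2\<close> at least (\<open>im_moebius_ge\<close>). But cusp forms decay at \<open>\<infinity>\<close> faster
  than any power of that distance (\<open>expansion_decay\<close>), since the exponential of a lattice grows faster than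
  any power. This passes on to \<open>\<psi> = T \<phi>\<close>, and so \<open>\<bar>\<psi> z\<bar>\<close> is less than any positive number.

  The other half of the work is that a cusp form of level \<open>I\<close> is a cusp form of level \<open>I (P)\<close>
  (\<open>cusp_forms_antimono\<close>). At a cusp the smaller level has a smaller lattice of translations, and expansions
  in \<open>1 / e(z)\<close> have to be turned into expansions in \<open>1 / e'(z)\<close>. The exponential \<open>e'\<close> of the sublattice is
  additive, being a limit of additive polynomials, so the part of the product \<open>e\<close> that belongs to one coset of the
  sublattice is a linear polynomial in \<open>e'\<close> (\<open>lattice_exp_sublattice\<close>). The index is finite, so \<open>1 / e\<close> is a
  convergent power series in \<open>1 / e'\<close> without constant term, and it can be substituted (\<open>fps_sums_compose\<close>).
\<close>

section \<open>The absolute value\<close>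

abbreviation av :: "'c::{zero,metric_space} \<Rightarrow> real" where
  "av x \<equiv> dist x 0"

locale drinfeld_field =
  fixes \<iota> :: "'a::{finite,field} fls \<Rightarrow> 'c::{field,complete_space}"
  assumes completed: "completed_alg_closure \<iota>"
begin

lemma dist_translate: "dist (x + z) (y + z) = dist x (y :: 'c)"
  using completed unfolding completed_alg_closure_def by blast

lemma dist_av: "dist x y = av (x - y :: 'c)"
  using dist_translate[of x "- y" y] by simp

lemma av_mult: "av (x * y :: 'c) = av x * av y"
  using completed unfolding completed_alg_closure_def by blast

lemma dist_ultra: "dist x z \<le> max (dist x y) (dist y (z :: 'c))"
  using completed unfolding completed_alg_closure_def by blast

lemma av_iota: "av (\<iota> x) = abs_infinity x"
  using completed unfolding completed_alg_closure_def by blast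

lemma av_minus [simp]: "av (- x :: 'c) = av x"
  using dist_translate[of "- x" x 0] by (simp add: dist_commute)

lemma av_minus_commute: "av (x - y :: 'c) = av (y - x)"
  using av_minus[of "x - y"] by simp

lemma av_add_le_max: "av (x + y :: 'c) \<le> max (av x) (av y)"
  using dist_ultra[of "x + y" 0 y] dist_av[of "x + y" y] by simp

lemma av_diff_le_max: "av (x - y :: 'c) \<le> max (av x) (av y)"
  using av_add_le_max[of x "- y"] by simp

lemma av_add_eq: "av y < av x \<Longrightarrow> av (x + y :: 'c) = av x"
  using av_add_le_max[of x y] av_diff_le_max[of "x + y" y] by auto

lemma av_diff_eq: "av y < av x \<Longrightarrow> av (x - y :: 'c) = av x"
  using av_add_eq[of "- y" x] by simp

lemma av_one [simp]: "av (1 :: 'c) = 1"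
  using av_mult[of 1 1] by simp

lemma av_power: "av (x ^ n :: 'c) = av x ^ n"
  by (induction n) (simp_all add: av_mult)

lemma av_inverse: "av (inverse x :: 'c) = inverse (av x)"
proof (cases "x = 0")
  case False
  then have "av x * av (inverse x) = 1"
    by (metis av_mult av_one right_inverse)
  then show ?thesis
    by (metis inverse_unique)
qed auto

lemma av_divide: "av (x / y :: 'c) = av x / av y"
  by (simp add: divide_inverse av_mult av_inverse)

lemma av_powi: "av (x powi n :: 'c) = av x powi n"
  by (simp add: power_int_def av_power av_inverse)

lemma av_prod: "av (\<Prod>i\<in>A. f i :: 'c) = (\<Prod>i\<in>A. av (f i))"
  by (induction A rule: infinite_finite_induct) (simp_all add: av_mult)

lemma av_sum_le:
  assumes "\<And>i. i \<in> A \<Longrightarrow> av (f i :: 'c) \<le> B" "0 \<le> B"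
  shows "av (\<Sum>i\<in>A. f i) \<le> B"
  using assms(1)
proof (induction A rule: infinite_finite_induct)
  case (insert x A)
  then show ?case
    using av_add_le_max[of "f x" "sum f A"] by fastforce
qed (use assms(2) in auto)

text \<open>
  The type \<open>'c\<close> only carries a metric and, separately, field operations; that they are continuous is a
  consequence of the ultrametric inequality.
\<close>

lemma tendsto_iff_av:
  fixes f :: "'b \<Rightarrow> 'c"
  shows "(f \<longlongrightarrow> l) F \<longleftrightarrow> ((\<lambda>x. av (f x - l)) \<longlongrightarrow> 0) F"
  by (subst tendsto_dist_iff) (simp add: dist_av[of _ l])

lemma tendsto_av:
  fixes f :: "'b \<Rightarrow> 'c"
  shows "(f \<longlongrightarrow> l) F \<Longrightarrow> ((\<lambda>x. av (f x)) \<longlongrightarrow> av l) F"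
  by (intro tendsto_intros)

lemma tendsto_plus:
  fixes f g :: "'b \<Rightarrow> 'c"
  assumes "(f \<longlongrightarrow> l) F" "(g \<longlongrightarrow> m) F"
  shows "((\<lambda>x. f x + g x) \<longlongrightarrow> l + m) F"
proof -
  have "((\<lambda>x. av (f x - l) + av (g x - m)) \<longlongrightarrow> 0 + 0) F"
    using assms by (intro tendsto_add) (simp_all add: tendsto_iff_av)
  moreover have "av (f x + g x - (l + m)) \<le> av (f x - l) + av (g x - m)" for x
  proof -
    have "f x + g x - (l + m) = (f x - l) + (g x - m)"
      by simp
    then have "av (f x + g x - (l + m)) \<le> max (av (f x - l)) (av (g x - m))"
      using av_add_le_max[of "f x - l" "g x - m"] by (simp only:)
    also have "\<dots> \<le> av (f x - l) + av (g x - m)"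
      by (simp add: max_def)
    finally show ?thesis .
  qed
  ultimately show ?thesis
    unfolding tendsto_iff_av
    by (intro tendsto_sandwich[of "\<lambda>_. 0" "\<lambda>x. av (f x + g x - (l + m))" F
          "\<lambda>x. av (f x - l) + av (g x - m)"]) auto
qed

lemma tendsto_times:
  fixes f g :: "'b \<Rightarrow> 'c"
  assumes "(f \<longlongrightarrow> l) F" "(g \<longlongrightarrow> m) F"
  shows "((\<lambda>x. f x * g x) \<longlongrightarrow> l * m) F"
proof -
  have "((\<lambda>x. av (f x - l) * av (g x) + av l * av (g x - m)) \<longlongrightarrow> 0 * av m + av l * 0) F"
    using assms by (intro tendsto_add tendsto_mult tendsto_const tendsto_av)
      (simp_all add: tendsto_iff_av)
  moreover have "av (f x * g x - l * m) \<le> av (f x - l) * av (g x) + av l * av (g x - m)" for x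
  proof -
    have "f x * g x - l * m = (f x - l) * g x + l * (g x - m)"
      by (simp add: algebra_simps)
    then have "av (f x * g x - l * m) \<le> max (av (f x - l) * av (g x)) (av l * av (g x - m))"
      using av_add_le_max[of "(f x - l) * g x" "l * (g x - m)"] by (simp add: av_mult)
    also have "\<dots> \<le> av (f x - l) * av (g x) + av l * av (g x - m)"
      by (simp add: max_def)
    finally show ?thesis .
  qed
  ultimately show ?thesis
    unfolding tendsto_iff_av
    by (intro tendsto_sandwich[of "\<lambda>_. 0" "\<lambda>x. av (f x * g x - l * m)" F
          "\<lambda>x. av (f x - l) * av (g x) + av l * av (g x - m)"]) auto
qed

lemma tendsto_finite_prod:
  fixes f :: "'i \<Rightarrow> 'b \<Rightarrow> 'c"
  assumes "\<And>i. i \<in> A \<Longrightarrow> (f i \<longlongrightarrow> l i) F"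
  shows "((\<lambda>x. \<Prod>i\<in>A. f i x) \<longlongrightarrow> (\<Prod>i\<in>A. l i)) F"
  using assms
  by (induction A rule: infinite_finite_induct) (auto intro: tendsto_times)

lemma tendsto_cmult: 
  fixes f :: "'b \<Rightarrow> 'c"
  shows "(f \<longlongrightarrow> l) F \<Longrightarrow> ((\<lambda>x. c * f x) \<longlongrightarrow> c * l) F"
  by (rule tendsto_times[OF tendsto_const])

text \<open>Unlike in the real case, the error does not grow with the number of factors.\<close>

lemma av_prod_diff_one_le:
  assumes "finite A" "\<And>i. i \<in> A \<Longrightarrow> av (f i - 1 :: 'c) \<le> e" "0 \<le> e" "e < 1"
  shows "av ((\<Prod>i\<in>A. f i) - 1) \<le> e"
  using assms(1,2)
proof (induction A rule: finite_induct)
  case (insert x A)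
  have "av (f x) \<le> 1"
    using insert.prems[of x] av_add_le_max[of "f x - 1" 1] assms(4) by simp
  then have "av (f x * (prod f A - 1)) \<le> e"
    using insert mult_mono[of "av (f x)" 1 "av (prod f A - 1)" e] by (simp add: av_mult)
  moreover have "prod f (insert x A) - 1 = f x * (prod f A - 1) + (f x - 1)"
    using insert.hyps by (simp add: algebra_simps)
  ultimately show ?case
    using insert.prems[of x] av_add_le_max[of "f x * (prod f A - 1)" "f x - 1"]
    by (metis insertI1 max.bounded_iff order_trans)
qed (use assms(3) in auto)

section \<open>The embedding of the completed rational function field\<close>

lemma iota_hom: "\<iota> 1 = 1" "\<iota> (x + y) = \<iota> x + \<iota> y" "\<iota> (x * y) = \<iota> x * \<iota> y"
proof -
  obtain j where "j 1 = 1" "\<And>x y. j (x + y) = j x + j y" "\<And>x y. j (x * y) = j x * j y"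
    "\<And>x. j (to_ac x) = \<iota> x"
    using completed unfolding completed_alg_closure_def by blast
  then show "\<iota> 1 = 1" "\<iota> (x + y) = \<iota> x + \<iota> y" "\<iota> (x * y) = \<iota> x * \<iota> y"
    by (metis to_ac_1, metis to_ac_add, metis to_ac_mult)
qed

lemma iota_eq_0_iff [simp]: "\<iota> x = 0 \<longleftrightarrow> x = 0"
proof -
  have "\<iota> x = 0 \<longleftrightarrow> abs_infinity x = 0"
    by (simp flip: av_iota)
  also have "\<dots> \<longleftrightarrow> x = 0"
    by (simp add: abs_infinity_def)
  finally show ?thesis .
qed

lemma iota_0 [simp]: "\<iota> 0 = 0"
  by simp

lemma iota_minus: "\<iota> (- x) = - \<iota> x"
  using iota_hom(2)[of x "- x"] by (metis add.commute add.right_inverse eq_neg_iff_add_eq_0 iota_0)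

lemma iota_diff: "\<iota> (x - y) = \<iota> x - \<iota> y"
  using iota_hom(2)[of x "- y"] by (simp add: iota_minus)

lemma iota_inverse: "\<iota> (inverse x) = inverse (\<iota> x)"
proof (cases "x = 0")
  case False
  then have "\<iota> x * \<iota> (inverse x) = 1"
    by (simp flip: iota_hom)
  then show ?thesis
    by (metis inverse_unique)
qed auto

lemma iota_divide: "\<iota> (x / y) = \<iota> x / \<iota> y"
  by (simp add: divide_inverse iota_hom iota_inverse)

lemma iota_power: "\<iota> (x ^ n) = \<iota> x ^ n"
  by (induction n) (simp_all add: iota_hom)

lemmas iota_simps = iota_hom iota_0 iota_minus iota_diff iota_inverse iota_divide iota_power

lemma inj_iota: "inj \<iota>"
proof (rule injI)
  fix x y assume "\<iota> x = \<iota> y"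
  then have "\<iota> (x - y) = 0"
    by (simp add: iota_simps del: iota_eq_0_iff)
  then show "x = y"
    by simp
qed

lemma iota_eq_iff [simp]: "\<iota> x = \<iota> y \<longleftrightarrow> x = y"
  using inj_iota by (auto dest: injD)

lemma card_ge_2: "real CARD('a) \<ge> 2"
proof -
  have "card {0, 1 :: 'a} \<le> CARD('a)"
    by (intro card_mono) auto
  then show ?thesis
    by simp
qed

lemma abs_infinity_le_powi:
  assumes "\<And>i. i < n \<Longrightarrow> fls_nth x i = 0"
  shows "abs_infinity (x :: 'a fls) \<le> real CARD('a) powi (- n)"
proof (cases "x = 0")
  case False
  then have "n \<le> fls_subdegree x"
    using assms by (intro fls_subdegree_geI)
  with False card_ge_2 show ?thesis
    by (auto simp: abs_infinity_def intro!: power_int_increasing)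
qed (auto simp: abs_infinity_def)

lemma nth_eq_0_if_abs_infinity:
  assumes "abs_infinity (x :: 'a fls) < real CARD('a) powi (- i)"
  shows "fls_nth x i = 0"
proof (rule ccontr)
  assume "fls_nth x i \<noteq> 0"
  then have "fls_subdegree x \<le> i" "x \<noteq> 0"
    by (auto intro: fls_subdegree_leI)
  then have "real CARD('a) powi (- i) \<le> abs_infinity x"
    using card_ge_2 by (auto simp: abs_infinity_def intro!: power_int_increasing)
  with assms show False
    by simp
qed

text \<open>
  \<open>K\<^sub>\<infinity>\<close> is complete, by convergence of coefficients, and hence closed in \<open>C\<^sub>\<infinity>\<close>. So points of \<open>\<Omega>\<close>
  have a positive distance to \<open>K\<^sub>\<infinity>\<close>.
\<close>

lemma closed_range_iota: "closed (range \<iota>)"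
proof -
  define q where "q = real CARD('a)"
  have q: "q > 1"
    using card_ge_2 by (simp add: q_def)
  have "z \<in> range \<iota>" if "z \<in> closure (range \<iota>)" for z
  proof -
    have "\<exists>x. dist (\<iota> x) z < q powi (- int n)" for n
      using that q unfolding closure_approachable by fastforce
    then obtain x where x: "\<And>n. dist (\<iota> (x n)) z < q powi (- int n)"
      by metis
    have coeff_eq: "fls_nth (x n) i = fls_nth (x m) i" if "i \<le> int n" "n \<le> m" for n m i
    proof -
      have "abs_infinity (x n - x m) = dist (\<iota> (x n)) (\<iota> (x m))"
        by (simp add: dist_av[of "\<iota> (x n)"] iota_simps flip: av_iota)
      also have "\<dots> < q powi (- int n)"
        using dist_ultra[of "\<iota> (x n)" "\<iota> (x m)" z] x[of n] x[of m] \<open>n \<le> m\<close> q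
          power_int_increasing[of "- int m" "- int n" q]
        by (auto simp: dist_commute)
      also have "\<dots> \<le> q powi (- i)"
        using that q by (intro power_int_increasing) auto
      finally show ?thesis
        using nth_eq_0_if_abs_infinity[of "x n - x m" i] by (simp add: q_def)
    qed
    define y where "y = Abs_fls (\<lambda>i. fls_nth (x (nat i)) i)"
    have "\<forall>i < min 0 (fls_subdegree (x 0)). fls_nth (x (nat i)) i = 0"
      by auto
    then have y_nth: "fls_nth y i = fls_nth (x (nat i)) i" for i
      unfolding y_def by (rule nth_Abs_fls_lower_bound)
    have "dist (\<iota> y) z \<le> q powi (- int n)" for n
    proof -
      have "fls_nth (y - x n) i = 0" if "i < int n" for i
        using coeff_eq[of i "nat i" n] that by (auto simp: y_nth)
      then have "dist (\<iota> y) (\<iota> (x n)) \<le> q powi (- int n)"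
        using abs_infinity_le_powi[of "int n" "y - x n"]
        by (simp add: dist_av[of "\<iota> y"] iota_simps q_def flip: av_iota)
      then show ?thesis
        using dist_ultra[of "\<iota> y" z "\<iota> (x n)"] x[of n] by simp
    qed
    moreover have "(\<lambda>n. q powi (- int n)) \<longlonglongrightarrow> 0"
      using q LIMSEQ_inverse_realpow_zero[of q] by (simp add: power_int_minus)
    ultimately have "dist (\<iota> y) z \<le> 0"
      by (intro LIMSEQ_le_const[of "\<lambda>n. q powi (- int n)"]) auto
    then show ?thesis
      by (metis dist_le_zero_iff rangeI)
  qed
  then show ?thesis
    by (metis closure_subset closure_eq subsetI subset_antisym)
qed

subsection \<open>The imaginary absolute value\<close>

abbreviation im :: "'c \<Rightarrow> real" where
  "im z \<equiv> infdist z (range \<iota>)"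

abbreviation \<Omega> :: "'c set" where
  "\<Omega> \<equiv> upper_half_plane \<iota>"

lemma im_pos_iff: "im z > 0 \<longleftrightarrow> z \<in> \<Omega>"
proof -
  have "z \<in> range \<iota> \<longleftrightarrow> im z = 0"
    by (rule in_closed_iff_infdist_zero) (auto simp: closed_range_iota)
  then show ?thesis
    using infdist_nonneg[of z "range \<iota>"] by (auto simp: upper_half_plane_def)
qed

lemma im_le: "im z \<le> av (z - \<iota> x)"
  using infdist_le[of "\<iota> x" "range \<iota>" z] by (simp add: dist_av[of z])

lemma im_geI:
  assumes "\<And>x. r \<le> av (z - \<iota> x)"
  shows "r \<le> im z"
  unfolding infdist_def using assms by (auto intro!: cINF_greatest simp: dist_av[of z])

text \<open>An affine map over \<open>K\<^sub>\<infinity>\<close> permutes \<open>K\<^sub>\<infinity>\<close> and scales distances.\<close>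

lemma im_affine:
  assumes "a \<noteq> 0"
  shows "im (\<iota> a * z + \<iota> b) \<ge> av (\<iota> a) * im z"
proof (rule im_geI)
  fix x
  have "\<iota> a * z + \<iota> b - \<iota> x = \<iota> a * (z - \<iota> ((x - b) / a))"
    using assms by (simp add: iota_simps field_simps)
  then show "av (\<iota> a) * im z \<le> av (\<iota> a * z + \<iota> b - \<iota> x)"
    by (simp add: av_mult im_le mult_left_mono)
qed

end

section \<open>Polynomials inside the completed rational function field\<close>

lemma emb_poly_0 [simp]: "emb_poly 0 = 0"
  by (simp add: emb_poly_def)

lemma emb_poly_pCons: "emb_poly (pCons a p) = fls_const a + fls_X_inv * emb_poly p"
  by (cases "a = 0 \<and> p = 0") (auto simp: emb_poly_def map_poly_pCons)

lemma emb_poly_nth: "fls_nth (emb_poly p) i = (if i \<le> 0 then Polynomial.coeff p (nat (- i)) else 0)"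
proof (induction p arbitrary: i)
  case (pCons a p)
  show ?case
  proof (cases "i < 0")
    case True
    then have "nat (- i) = Suc (nat (- (i + 1)))"
      by auto
    with True show ?thesis
      by (auto simp: emb_poly_pCons fls_X_inv_times_conv_shift pCons.IH)
  qed (auto simp: emb_poly_pCons fls_X_inv_times_conv_shift pCons.IH)
qed auto

lemma emb_poly_add: "emb_poly (p + r) = emb_poly p + emb_poly r"
  by (rule fls_eqI) (simp add: emb_poly_nth)

lemma emb_poly_minus: "emb_poly (- p) = - emb_poly p"
  by (rule fls_eqI) (simp add: emb_poly_nth)

lemma emb_poly_diff: "emb_poly (p - r) = emb_poly p - emb_poly r"
  by (rule fls_eqI) (simp add: emb_poly_nth)

lemma emb_poly_const: "emb_poly [:a:] = fls_const a"
  by (simp add: emb_poly_pCons)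

lemma emb_poly_1 [simp]: "emb_poly 1 = 1"
  using emb_poly_const[of 1] by (simp add: one_pCons)

lemma emb_poly_smult: "emb_poly (Polynomial.smult a p) = fls_const a * emb_poly p"
  by (rule fls_eqI) (simp add: emb_poly_nth)

lemma emb_poly_mult: "emb_poly (p * r) = emb_poly p * emb_poly r"
proof (induction p)
  case (pCons a p)
  have "emb_poly (pCons a p * r) = emb_poly (Polynomial.smult a r) + emb_poly (pCons 0 (p * r))"
    by (simp add: emb_poly_add)
  also have "\<dots> = emb_poly (pCons a p) * emb_poly r"
    by (simp add: emb_poly_pCons emb_poly_smult pCons.IH algebra_simps)
  finally show ?case .
qed auto

lemma emb_poly_power: "emb_poly (p ^ n) = emb_poly p ^ n"
  by (induction n) (simp_all add: emb_poly_mult)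

lemmas emb_poly_simps = emb_poly_add emb_poly_minus emb_poly_diff emb_poly_mult emb_poly_power

lemma emb_poly_eq_iff [simp]: "emb_poly p = emb_poly r \<longleftrightarrow> p = r"
proof
  assume eq: "emb_poly p = emb_poly r"
  show "p = r"
  proof (rule poly_eqI)
    fix n
    show "Polynomial.coeff p n = Polynomial.coeff r n"
      using arg_cong[OF eq, of "\<lambda>f. fls_nth f (- int n)"] by (simp add: emb_poly_nth)
  qed
qed auto

lemma emb_poly_eq_0_iff [simp]: "emb_poly p = 0 \<longleftrightarrow> p = 0"
  using emb_poly_eq_iff[of p 0] by (simp del: emb_poly_eq_iff)

lemma abs_infinity_emb_poly:
  fixes p :: "'a::{finite,field} poly"
  assumes "p \<noteq> 0"
  shows "abs_infinity (emb_poly p) = real CARD('a) ^ Polynomial.degree p"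
proof -
  have "fls_subdegree (emb_poly p) = - int (Polynomial.degree p)"
    using assms by (intro fls_subdegree_eqI) (auto simp: emb_poly_nth intro!: coeff_eq_0)
  with assms show ?thesis
    by (simp add: abs_infinity_def)
qed

lemma finite_degree_less: "finite {p :: 'a::{finite,field} poly. Polynomial.degree p < d}"
proof (induction d)
  case (Suc d)
  have "{p :: 'a poly. Polynomial.degree p < Suc d} \<subseteq>
    insert 0 ((\<lambda>(a, p). pCons a p) ` (UNIV \<times> insert 0 {p. Polynomial.degree p < d}))"
  proof
    fix p :: "'a poly"
    assume p: "p \<in> {p. Polynomial.degree p < Suc d}"
    obtain a r where r: "p = pCons a r"
      by (rule pCons_cases)
    then have "r \<in> insert 0 {p. Polynomial.degree p < d}"
      using p by (auto split: if_splits)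
    with r show "p \<in> insert 0 ((\<lambda>(a, p). pCons a p) ` (UNIV \<times> insert 0 {p. Polynomial.degree p < d}))"
      by auto
  qed
  then show ?case
    by (rule finite_subset) (use Suc.IH in auto)
qed auto

context drinfeld_field
begin

abbreviation emb :: "'a poly \<Rightarrow> 'c" where
  "emb p \<equiv> \<iota> (emb_poly p)"

lemma av_emb: "p \<noteq> 0 \<Longrightarrow> av (emb p) = real CARD('a) ^ Polynomial.degree p"
  by (simp add: av_iota abs_infinity_emb_poly)

lemma finite_av_emb_le: "finite {p :: 'a poly. av (emb p) \<le> r}"
proof -
  obtain n where n: "r < real CARD('a) ^ n"
    using card_ge_2 real_arch_pow[of "real CARD('a)" r] by auto
  have "{p :: 'a poly. av (emb p) \<le> r} \<subseteq> insert 0 {p. Polynomial.degree p < n}"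
  proof
    fix p :: "'a poly"
    assume p: "p \<in> {p. av (emb p) \<le> r}"
    have "Polynomial.degree p < n" if "p \<noteq> 0"
    proof (rule ccontr)
      assume "\<not> Polynomial.degree p < n"
      then have "real CARD('a) ^ n \<le> av (emb p)"
        using card_ge_2 that by (auto simp: av_emb intro!: power_increasing)
      with p n show False
        by simp
    qed
    then show "p \<in> insert 0 {p. Polynomial.degree p < n}"
      by auto
  qed
  then show ?thesis
    by (rule finite_subset) (simp add: finite_degree_less)
qed

text \<open>The terms with nonnegative powers of \<open>t\<close> form a polynomial; what remains is less than \<open>1\<close>.\<close>

lemma polynomial_part: "\<exists>p. av (\<iota> x - emb p) < 1"
proof -
  define n where "n = nat (- fls_subdegree x)"
  define p where "p = Poly (map (\<lambda>i. fls_nth x (- int i)) [0..<Suc n])"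
  have "fls_nth (x - emb_poly p) i = 0" if "i < 1" for i
  proof -
    have "Polynomial.coeff p (nat (- i)) = fls_nth x i"
    proof (cases "nat (- i) < Suc n")
      case True
      with that show ?thesis
        by (simp add: p_def coeff_Poly_eq nth_default_nth del: upt_Suc)
    next
      case False
      then have "i < fls_subdegree x"
        using that by (simp add: n_def)
      with False show ?thesis
        by (simp add: p_def coeff_Poly_eq nth_default_beyond del: upt_Suc)
    qed
    with that show ?thesis
      by (simp add: emb_poly_nth)
  qed
  then have "av (\<iota> (x - emb_poly p)) \<le> real CARD('a) powi (- 1)"
    unfolding av_iota by (rule abs_infinity_le_powi)
  also have "\<dots> < 1"
    using card_ge_2 by (simp add: power_int_minus field_simps)
  finally show ?thesis
    by (auto simp: iota_simps)
qed

section \<open>Lattices and their exponential functions\<close>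

text \<open>Discrete subgroups of \<open>K\<^sub>\<infinity>\<close>.\<close>

definition is_lattice :: "'a fls set \<Rightarrow> bool" where
  "is_lattice \<Lambda> \<longleftrightarrow> 0 \<in> \<Lambda> \<and> (\<forall>x\<in>\<Lambda>. \<forall>y\<in>\<Lambda>. x - y \<in> \<Lambda>) \<and> (\<forall>r. finite {x \<in> \<Lambda>. av (\<iota> x) \<le> r})"

lemma lattice_0: "is_lattice \<Lambda> \<Longrightarrow> 0 \<in> \<Lambda>"
  and lattice_diff: "is_lattice \<Lambda> \<Longrightarrow> x \<in> \<Lambda> \<Longrightarrow> y \<in> \<Lambda> \<Longrightarrow> x - y \<in> \<Lambda>"
  and lattice_finite: "is_lattice \<Lambda> \<Longrightarrow> finite {x \<in> \<Lambda>. av (\<iota> x) \<le> r}"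
  by (auto simp: is_lattice_def)

lemma lattice_minus: "is_lattice \<Lambda> \<Longrightarrow> x \<in> \<Lambda> \<Longrightarrow> - x \<in> \<Lambda>"
  using lattice_diff[of \<Lambda> 0 x] lattice_0 by simp

lemma lattice_add: "is_lattice \<Lambda> \<Longrightarrow> x \<in> \<Lambda> \<Longrightarrow> y \<in> \<Lambda> \<Longrightarrow> x + y \<in> \<Lambda>"
  using lattice_diff[of \<Lambda> x "- y"] lattice_minus by simp

definition lball :: "'a fls set \<Rightarrow> nat \<Rightarrow> 'a fls set" where
  "lball \<Lambda> n = {x \<in> \<Lambda>. av (\<iota> x) \<le> real n}"

definition partial_exp :: "'a fls set \<Rightarrow> nat \<Rightarrow> 'c \<Rightarrow> 'c" where
  "partial_exp \<Lambda> n z = z * (\<Prod>\<beta>\<in>lball \<Lambda> n - {0}. 1 - z / \<iota> \<beta>)"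

lemma finite_lball: "is_lattice \<Lambda> \<Longrightarrow> finite (lball \<Lambda> n)"
  by (simp add: lball_def lattice_finite)

lemma eventually_subset_lball:
  assumes "finite B" "B \<subseteq> \<Lambda>"
  shows "\<forall>\<^sub>F n in sequentially. B \<subseteq> lball \<Lambda> n"
proof -
  have "\<forall>\<^sub>F n in sequentially. \<forall>x\<in>B. av (\<iota> x) \<le> real n"
    using assms(1) by (intro eventually_ball_finite)
      (auto intro!: eventually_sequentiallyI[of "nat \<lceil>av (\<iota> _)\<rceil>"] simp: nat_le_iff ceiling_le_iff)
  then show ?thesis
    by (rule eventually_mono) (use assms(2) in \<open>auto simp: lball_def\<close>)
qed

text \<open>
  Only finitely many factors \<open>1 - z / \<beta>\<close> have \<open>\<bar>\<beta>\<bar> \<le> \<bar>z\<bar>\<close>; all the others have absolute value \<open>1\<close>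
  and tend to \<open>1\<close>. In an ultrametric field this makes the product converge unconditionally, and it
  may be computed along the balls of the lattice, which are finite groups.
\<close>

lemma partial_exp_tendsto:
  assumes "is_lattice \<Lambda>"
  shows "(\<lambda>n. partial_exp \<Lambda> n z) \<longlonglongrightarrow> lattice_exp \<iota> \<Lambda> z"
proof -
  define f where "f F = (\<Prod>\<beta>\<in>F. 1 - z / \<iota> \<beta>)" for F
  define p where "p n = f (lball \<Lambda> n - {0})" for n
  obtain n0 :: nat where n0: "av z < real n0"
    using reals_Archimedean2 by blast
  define C where "C = av (p n0)"
  have fin: "finite (lball \<Lambda> n - {0})" for n
    using finite_lball[OF assms] by simp
  have small: "av ((1 - z / \<iota> \<beta>) - 1) \<le> av z / real n"
    if "n0 \<le> n" "\<beta> \<in> \<Lambda> - lball \<Lambda> n" for \<beta> n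
  proof -
    have "real n < av (\<iota> \<beta>)"
      using that by (auto simp: lball_def)
    moreover have "0 < real n"
      using that n0 zero_le_dist[of z 0] by linarith
    ultimately have "av z / av (\<iota> \<beta>) \<le> av z / real n"
      by (intro divide_left_mono mult_pos_pos) auto
    then show ?thesis
      by (simp add: av_divide)
  qed
  have av_p: "av (p n) = C" if "n0 \<le> n" for n
  proof -
    have sub: "lball \<Lambda> n0 - {0} \<subseteq> lball \<Lambda> n - {0}"
      using that by (auto simp: lball_def)
    have "av (1 - z / \<iota> \<beta>) = 1" if "\<beta> \<in> lball \<Lambda> n - {0} - (lball \<Lambda> n0 - {0})" for \<beta>
    proof -
      have "av z < av (\<iota> \<beta>)"
        using that n0 by (auto simp: lball_def)
      then have "av (z / \<iota> \<beta>) < av (1 :: 'c)"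
        using that by (simp add: av_divide)
      then show ?thesis
        by (simp add: av_diff_eq)
    qed
    then have "(\<Prod>\<beta>\<in>lball \<Lambda> n - {0} - (lball \<Lambda> n0 - {0}). av (1 - z / \<iota> \<beta>)) = 1"
      by (intro prod.neutral) auto
    with prod.subset_diff[OF sub fin, of "\<lambda>\<beta>. av (1 - z / \<iota> \<beta>)"] show ?thesis
      by (simp add: p_def f_def C_def av_prod)
  qed
  have close: "av (f F - p n) \<le> C * (av z / real n)"
    if n: "n0 \<le> n" and F: "finite F" "lball \<Lambda> n - {0} \<subseteq> F" "F \<subseteq> \<Lambda> - {0}" for F n
  proof -
    have "f F = f (F - (lball \<Lambda> n - {0})) * p n"
      unfolding f_def p_def using F by (intro prod.subset_diff) auto
    then have "f F - p n = (f (F - (lball \<Lambda> n - {0})) - 1) * p n"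
      by (simp add: algebra_simps)
    moreover have "av (f (F - (lball \<Lambda> n - {0})) - 1) \<le> av z / real n"
      unfolding f_def
    proof (rule av_prod_diff_one_le)
      show "av z / real n < 1"
        using n n0 by (simp add: divide_less_eq)
    next
      fix \<beta> assume "\<beta> \<in> F - (lball \<Lambda> n - {0})"
      then have "\<beta> \<in> \<Lambda> - lball \<Lambda> n"
        using F by auto
      then show "av (1 - z / \<iota> \<beta> - 1) \<le> av z / real n"
        by (rule small[OF n])
    qed (use F in auto)
    then have "C * av (f (F - (lball \<Lambda> n - {0})) - 1) \<le> C * (av z / real n)"
      by (rule mult_left_mono) (simp add: C_def)
    ultimately show ?thesis
      using av_p[OF n] by (simp add: av_mult mult.commute)
  qed
  have lim0: "(\<lambda>n. C * (av z / real n)) \<longlonglongrightarrow> 0"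
    by (intro tendsto_mult_right_zero lim_const_over_n)
  have "Cauchy p"
  proof (rule metric_CauchyI)
    fix e :: real assume "0 < e"
    then have "\<forall>\<^sub>F n in sequentially. C * (av z / real n) < e"
      using order_tendstoD(2)[OF lim0] by blast
    then obtain N where N: "\<And>n. N \<le> n \<Longrightarrow> C * (av z / real n) < e"
      by (auto simp: eventually_sequentially)
    define M where "M = max N n0"
    have *: "dist (p n) (p M) < e" if "M \<le> n" for n
    proof -
      have "av (p n - p M) \<le> C * (av z / real M)"
        unfolding p_def[of n] using that by (intro close fin) (auto simp: M_def lball_def)
      also have "\<dots> < e"
        by (rule N) (simp add: M_def)
      finally show ?thesis
        by (simp add: dist_av[of "p n"])
    qed
    have "dist (p n) (p m) < e" if "M \<le> n" "M \<le> m" for n m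
      using *[OF that(1)] *[OF that(2)] dist_ultra[of "p n" "p m" "p M"]
      by (simp add: dist_commute)
    then show "\<exists>M. \<forall>m\<ge>M. \<forall>n\<ge>M. dist (p m) (p n) < e"
      by blast
  qed
  then obtain l where l: "p \<longlonglongrightarrow> l"
    using Cauchy_convergent convergent_def by blast
  have "(f \<longlongrightarrow> l) (finite_subsets_at_top (\<Lambda> - {0}))"
  proof (rule tendstoI)
    fix e :: real assume e: "0 < e"
    have "\<forall>\<^sub>F n in sequentially. C * (av z / real n) < e \<and> dist (p n) l < e \<and> n0 \<le> n"
      using order_tendstoD(2)[OF lim0 e] tendstoD[OF l e] eventually_ge_at_top[of n0]
      by eventually_elim auto
    then obtain n where n: "C * (av z / real n) < e" "dist (p n) l < e" "n0 \<le> n"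
      using eventually_happens'[OF sequentially_bot] by blast
    have "dist (f F) l < e" if "finite F" "lball \<Lambda> n - {0} \<subseteq> F" "F \<subseteq> \<Lambda> - {0}" for F
      using close[OF n(3) that] n dist_ultra[of "f F" l "p n"] by (simp add: dist_av[of "f F" "p n"])
    then show "\<forall>\<^sub>F F in finite_subsets_at_top (\<Lambda> - {0}). dist (f F) l < e"
      unfolding eventually_finite_subsets_at_top
      by (intro exI[of _ "lball \<Lambda> n - {0}"]) (use fin in \<open>auto simp: lball_def\<close>)
  qed
  then have "lattice_exp \<iota> \<Lambda> z = z * l"
    unfolding lattice_exp_def f_def by (simp add: tendsto_Lim)
  then show ?thesis
    using tendsto_cmult[OF l, of z] by (simp add: partial_exp_def p_def f_def)
qed

lemma finite_group_prod_shift: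
  fixes V :: "'c set"
  assumes "0 \<in> V" "\<And>x y. x \<in> V \<Longrightarrow> y \<in> V \<Longrightarrow> x - y \<in> V" "u \<in> V"
  shows "(\<Prod>v\<in>V. z + u - v) = (\<Prod>v\<in>V. z - v)"
proof -
  have "v + u \<in> V" if "v \<in> V" for v
    using assms(2)[OF that assms(2)[OF assms(1,3)]] by simp
  then show ?thesis
    using assms(2,3) by (intro prod.reindex_bij_witness[of _ "\<lambda>v. v + u" "\<lambda>v. v - u"]) auto
qed

text \<open>
  The polynomial \<open>F\<close> with simple zeros at the points of a finite group \<open>V\<close> is additive: for fixed \<open>w\<close>
  the polynomial \<open>F (z + w) - F z - F w\<close> vanishes on \<open>V\<close>, as \<open>F\<close> is \<open>V\<close>-periodic, but its degree is less than \<open>card V\<close>.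
\<close>

lemma finite_group_prod_additive:
  fixes V :: "'c set"
  assumes V: "finite V" "0 \<in> V" "\<And>x y. x \<in> V \<Longrightarrow> y \<in> V \<Longrightarrow> x - y \<in> V"
  shows "(\<Prod>v\<in>V. z + w - v) = (\<Prod>v\<in>V. z - v) + (\<Prod>v\<in>V. w - v)"
proof -
  define F where "F = (\<Prod>v\<in>V. [:- v, 1:])"
  define D where "D = F \<circ>\<^sub>p [:w, 1:] - F - [:poly F w:]"
  have poly_F: "poly F x = (\<Prod>v\<in>V. x - v)" for x
    by (simp add: F_def poly_prod)
  have deg: "Polynomial.degree F = card V"
    by (simp add: F_def degree_prod_eq_sum_degree)
  have "Polynomial.lead_coeff F = 1"
    unfolding F_def lead_coeff_prod by simp
  then have lead: "Polynomial.coeff F (card V) = 1"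
    by (simp add: deg)
  have deg': "Polynomial.degree (F \<circ>\<^sub>p [:w, 1:]) = card V"
    by (simp add: degree_pcompose deg)
  have card: "card V > 0"
    using V by (auto simp: card_gt_0_iff)
  have "D = 0"
  proof (rule ccontr)
    assume "D \<noteq> 0"
    have "Polynomial.coeff (F \<circ>\<^sub>p [:w, 1:]) (card V) = 1"
      using lead_coeff_comp[of "[:w, 1:]" F] by (simp add: lead deg deg')
    moreover have "Polynomial.coeff [:poly F w:] (card V) = 0"
      using card by (intro coeff_eq_0) simp
    ultimately have "Polynomial.coeff D (card V) = 0"
      by (simp add: D_def lead)
    moreover have "Polynomial.degree D \<le> card V"
      unfolding D_def by (intro degree_diff_le) (simp_all add: deg deg')
    ultimately have "Polynomial.degree D < card V"
      using \<open>D \<noteq> 0\<close> by (metis le_neq_implies_less leading_coeff_0_iff)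
    moreover have "V \<subseteq> {x. poly D x = 0}"
    proof
      fix u assume u: "u \<in> V"
      have "poly F u = 0"
        using u V by (auto simp: poly_F)
      moreover have "poly F (w + u) = poly F w"
        using finite_group_prod_shift[OF V(2,3) u, of w] by (simp add: poly_F)
      ultimately show "u \<in> {x. poly D x = 0}"
        by (simp add: D_def poly_pcompose)
    qed
    then have "card V \<le> card {x. poly D x = 0}"
      using poly_roots_finite[OF \<open>D \<noteq> 0\<close>] by (intro card_mono) auto
    ultimately show False
      using card_poly_roots_bound[OF \<open>D \<noteq> 0\<close>] by simp
  qed
  then have "poly D z = 0"
    by simp
  then show ?thesis
    by (simp add: D_def poly_pcompose poly_F algebra_simps)
qed

lemma partial_exp_eq:
  assumes "is_lattice \<Lambda>"
  shows "partial_exp \<Lambda> n z = (\<Prod>\<beta>\<in>lball \<Lambda> n - {0}. - 1 / \<iota> \<beta>) * (\<Prod>v\<in>\<iota> ` lball \<Lambda> n. z - v)"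
proof -
  have "(\<Prod>v\<in>\<iota> ` lball \<Lambda> n. z - v) = (\<Prod>\<beta>\<in>lball \<Lambda> n. z - \<iota> \<beta>)"
    by (subst prod.reindex) (auto simp: inj_on_def)
  also have "\<dots> = z * (\<Prod>\<beta>\<in>lball \<Lambda> n - {0}. z - \<iota> \<beta>)"
    using finite_lball[OF assms] lattice_0[OF assms] by (subst prod.remove[of _ 0]) (auto simp: lball_def)
  finally have "(\<Prod>\<beta>\<in>lball \<Lambda> n - {0}. - 1 / \<iota> \<beta>) * (\<Prod>v\<in>\<iota> ` lball \<Lambda> n. z - v) =
    z * (\<Prod>\<beta>\<in>lball \<Lambda> n - {0}. - 1 / \<iota> \<beta> * (z - \<iota> \<beta>))"
    by (simp only: prod.distrib mult.left_commute)
  also have "(\<Prod>\<beta>\<in>lball \<Lambda> n - {0}. - 1 / \<iota> \<beta> * (z - \<iota> \<beta>)) = (\<Prod>\<beta>\<in>lball \<Lambda> n - {0}. 1 - z / \<iota> \<beta>)"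
    by (intro prod.cong) (auto simp: field_simps)
  finally show ?thesis
    by (simp add: partial_exp_def)
qed

lemma partial_exp_add:
  assumes "is_lattice \<Lambda>"
  shows "partial_exp \<Lambda> n (z + w) = partial_exp \<Lambda> n z + partial_exp \<Lambda> n w"
proof -
  have "x - y \<in> \<iota> ` lball \<Lambda> n" if xy: "x \<in> \<iota> ` lball \<Lambda> n" "y \<in> \<iota> ` lball \<Lambda> n" for x y
  proof -
    obtain a b where "x = \<iota> a" "y = \<iota> b" "a \<in> lball \<Lambda> n" "b \<in> lball \<Lambda> n"
      using xy by blast
    then show ?thesis
      using av_diff_le_max[of "\<iota> a" "\<iota> b"] lattice_diff[OF assms]
      by (intro image_eqI[of _ _ "a - b"]) (auto simp: lball_def iota_simps)
  qed
  moreover have "0 \<in> \<iota> ` lball \<Lambda> n"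
    using lattice_0[OF assms] by (intro image_eqI[of _ _ 0]) (auto simp: lball_def)
  ultimately show ?thesis
    using finite_lball[OF assms]
    by (simp add: partial_exp_eq[OF assms] finite_group_prod_additive distrib_left)
qed

lemma lattice_exp_add:
  assumes "is_lattice \<Lambda>"
  shows "lattice_exp \<iota> \<Lambda> (z + w) = lattice_exp \<iota> \<Lambda> z + lattice_exp \<iota> \<Lambda> w"
  using partial_exp_tendsto[OF assms, of "z + w"]
    tendsto_plus[OF partial_exp_tendsto[OF assms, of z] partial_exp_tendsto[OF assms, of w]]
  by (simp add: partial_exp_add[OF assms] LIMSEQ_unique)

lemma lattice_exp_0: "lattice_exp \<iota> \<Lambda> 0 = 0"
  by (simp add: lattice_exp_def)

lemma lattice_exp_minus: "is_lattice \<Lambda> \<Longrightarrow> lattice_exp \<iota> \<Lambda> (- z) = - lattice_exp \<iota> \<Lambda> z"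
  using lattice_exp_add[of \<Lambda> z "- z"] by (simp add: lattice_exp_0 add_eq_0_iff)

lemma lattice_exp_diff:
  "is_lattice \<Lambda> \<Longrightarrow> lattice_exp \<iota> \<Lambda> (z - w) = lattice_exp \<iota> \<Lambda> z - lattice_exp \<iota> \<Lambda> w"
  using lattice_exp_add[of \<Lambda> z "- w"] by (simp add: lattice_exp_minus)

lemma lattice_exp_lattice:
  assumes "is_lattice \<Lambda>" "\<beta> \<in> \<Lambda>"
  shows "lattice_exp \<iota> \<Lambda> (\<iota> \<beta>) = 0"
proof -
  have "\<forall>\<^sub>F n in sequentially. partial_exp \<Lambda> n (\<iota> \<beta>) = 0"
  proof (rule eventually_mono)
    show "\<forall>\<^sub>F n in sequentially. {\<beta>} \<subseteq> lball \<Lambda> n"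
      using assms(2) by (intro eventually_subset_lball) auto
  next
    fix n assume "{\<beta>} \<subseteq> lball \<Lambda> n"
    then show "partial_exp \<Lambda> n (\<iota> \<beta>) = 0"
      using finite_lball[OF assms(1)] by (auto simp: partial_exp_def)
  qed
  then show ?thesis
    by (rule LIMSEQ_unique[OF partial_exp_tendsto[OF assms(1)] tendsto_eventually])
qed

lemma lattice_exp_periodic:
  "is_lattice \<Lambda> \<Longrightarrow> \<beta> \<in> \<Lambda> \<Longrightarrow> lattice_exp \<iota> \<Lambda> (z - \<iota> \<beta>) = lattice_exp \<iota> \<Lambda> z"
  by (simp add: lattice_exp_diff lattice_exp_lattice)

subsection \<open>Growth of the exponential\<close>

text \<open>Lattice points of absolute value greater than \<open>\<bar>z\<bar>\<close> are not closer to \<open>z\<close> than \<open>0\<close> is.\<close>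

lemma nearest_lattice_point:
  assumes "is_lattice \<Lambda>"
  shows "\<exists>\<beta>\<in>\<Lambda>. \<forall>\<mu>\<in>\<Lambda>. av (z - \<iota> \<beta>) \<le> av (z - \<iota> \<mu>)"
proof -
  let ?S = "{x \<in> \<Lambda>. av (\<iota> x) \<le> av z}"
  have S: "finite ?S" "0 \<in> ?S"
    using assms by (auto intro: lattice_finite lattice_0)
  then obtain \<beta> where \<beta>: "\<beta> \<in> ?S" "\<And>\<mu>. \<mu> \<in> ?S \<Longrightarrow> av (z - \<iota> \<beta>) \<le> av (z - \<iota> \<mu>)"
    using arg_min_if_finite(1)[of ?S "\<lambda>\<mu>. av (z - \<iota> \<mu>)"] arg_min_least[of ?S _ "\<lambda>\<mu>. av (z - \<iota> \<mu>)"]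
    by blast
  have "av (z - \<iota> \<beta>) \<le> av (z - \<iota> \<mu>)" if "\<mu> \<in> \<Lambda>" for \<mu>
  proof (cases "\<mu> \<in> ?S")
    case False
    then have "av z \<le> av (z - \<iota> \<mu>)"
      using that av_diff_eq[of z "\<iota> \<mu>"] av_minus_commute[of z "\<iota> \<mu>"] by auto
    then show ?thesis
      using \<beta>(2)[OF S(2)] by simp
  qed (use \<beta> in auto)
  with \<beta>(1) show ?thesis
    by blast
qed

text \<open>
  If \<open>0\<close> is a lattice point nearest to \<open>z\<close>, then every factor of the product has absolute value at
  least \<open>1\<close>, and at least \<open>\<bar>z\<bar> / \<bar>\<beta>\<bar>\<close>. So any finite part of the product gives a lower bound.
\<close>

lemma av_lattice_exp_ge_reduced:
  assumes \<Lambda>: "is_lattice \<Lambda>" and z: "\<And>\<mu>. \<mu> \<in> \<Lambda> \<Longrightarrow> av z \<le> av (z - \<iota> \<mu>)"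
    and B: "finite B" "B \<subseteq> \<Lambda> - {0}"
  shows "av z * (\<Prod>\<beta>\<in>B. av z / av (\<iota> \<beta>)) \<le> av (lattice_exp \<iota> \<Lambda> z)"
proof (rule tendsto_lowerbound[OF tendsto_av[OF partial_exp_tendsto[OF \<Lambda>]]])
  have B': "B \<subseteq> \<Lambda>"
    using B by auto
  show "\<forall>\<^sub>F n in sequentially. av z * (\<Prod>\<beta>\<in>B. av z / av (\<iota> \<beta>)) \<le> av (partial_exp \<Lambda> n z)"
    using eventually_subset_lball[OF B(1) B']
  proof eventually_elim
    case (elim n)
    have eq: "av (1 - z / \<iota> \<beta>) = av (z - \<iota> \<beta>) / av (\<iota> \<beta>)" if "\<beta> \<noteq> 0" for \<beta>
    proof -
      have "1 - z / \<iota> \<beta> = (\<iota> \<beta> - z) / \<iota> \<beta>"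
        using that by (simp add: field_simps)
      then show ?thesis
        by (simp only: av_divide av_minus_commute)
    qed
    have ge: "1 \<le> av (1 - z / \<iota> \<beta>)" if "\<beta> \<in> \<Lambda> - {0}" for \<beta>
    proof -
      have "av (\<iota> \<beta>) \<le> max (av z) (av (z - \<iota> \<beta>))"
        using av_diff_le_max[of z "z - \<iota> \<beta>"] by simp
      then have "av (\<iota> \<beta>) \<le> av (z - \<iota> \<beta>)"
        using z[of \<beta>] that by auto
      then show ?thesis
        using that by (simp add: eq le_divide_eq)
    qed
    have sub: "B \<subseteq> lball \<Lambda> n - {0}"
      using elim B by auto
    have "(\<Prod>\<beta>\<in>B. av z / av (\<iota> \<beta>)) \<le> (\<Prod>\<beta>\<in>B. av (1 - z / \<iota> \<beta>))"
    proof (intro prod_mono conjI)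
      fix \<beta> assume "\<beta> \<in> B"
      then have "\<beta> \<in> \<Lambda>" "\<beta> \<noteq> 0"
        using B by auto
      then show "av z / av (\<iota> \<beta>) \<le> av (1 - z / \<iota> \<beta>)"
        unfolding eq[OF \<open>\<beta> \<noteq> 0\<close>] by (intro divide_right_mono z) auto
    qed auto
    also have "\<dots> = 1 * (\<Prod>\<beta>\<in>B. av (1 - z / \<iota> \<beta>))"
      by simp
    also have "\<dots> \<le> (\<Prod>\<beta>\<in>lball \<Lambda> n - {0} - B. av (1 - z / \<iota> \<beta>)) * (\<Prod>\<beta>\<in>B. av (1 - z / \<iota> \<beta>))"
      using ge by (intro mult_right_mono prod_ge_1 prod_nonneg) (auto simp: lball_def)
    also have "\<dots> = (\<Prod>\<beta>\<in>lball \<Lambda> n - {0}. av (1 - z / \<iota> \<beta>))"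
      using sub finite_lball[OF \<Lambda>] by (intro prod.subset_diff[symmetric]) auto
    finally show ?case
      by (auto simp: partial_exp_def av_mult av_prod intro: mult_left_mono)
  qed
qed simp

lemma av_lattice_exp_ge:
  assumes "is_lattice \<Lambda>" "finite B" "B \<subseteq> \<Lambda> - {0}"
  shows "im z * (\<Prod>\<beta>\<in>B. im z / av (\<iota> \<beta>)) \<le> av (lattice_exp \<iota> \<Lambda> z)"
proof -
  obtain \<beta> where \<beta>: "\<beta> \<in> \<Lambda>" "\<And>\<mu>. \<mu> \<in> \<Lambda> \<Longrightarrow> av (z - \<iota> \<beta>) \<le> av (z - \<iota> \<mu>)"
    using nearest_lattice_point[OF assms(1)] by blast
  define w where "w = z - \<iota> \<beta>"
  have "av w \<le> av (w - \<iota> \<mu>)" if "\<mu> \<in> \<Lambda>" for \<mu>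
    using \<beta>(2)[OF lattice_add[OF assms(1) \<beta>(1) that]] by (simp add: w_def iota_simps algebra_simps)
  then have "av w * (\<Prod>\<beta>\<in>B. av w / av (\<iota> \<beta>)) \<le> av (lattice_exp \<iota> \<Lambda> w)"
    using assms by (intro av_lattice_exp_ge_reduced)
  moreover have "im z \<le> av w"
    by (simp add: w_def im_le)
  then have "im z * (\<Prod>\<beta>\<in>B. im z / av (\<iota> \<beta>)) \<le> av w * (\<Prod>\<beta>\<in>B. av w / av (\<iota> \<beta>))"
    by (intro mult_mono prod_mono prod_nonneg) (auto intro!: divide_right_mono simp: infdist_nonneg)
  moreover have "lattice_exp \<iota> \<Lambda> w = lattice_exp \<iota> \<Lambda> z"
    unfolding w_def by (rule lattice_exp_periodic[OF assms(1) \<beta>(1)])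
  ultimately show ?thesis
    by simp
qed

lemma im_le_av_lattice_exp: "is_lattice \<Lambda> \<Longrightarrow> im z \<le> av (lattice_exp \<iota> \<Lambda> z)"
  using av_lattice_exp_ge[of \<Lambda> "{}" z] by simp

lemma lattice_exp_eq_0D:
  assumes "is_lattice \<Lambda>" "lattice_exp \<iota> \<Lambda> z = 0"
  shows "z \<in> \<iota> ` \<Lambda>"
proof -
  obtain \<beta> where \<beta>: "\<beta> \<in> \<Lambda>" "\<And>\<mu>. \<mu> \<in> \<Lambda> \<Longrightarrow> av (z - \<iota> \<beta>) \<le> av (z - \<iota> \<mu>)"
    using nearest_lattice_point[OF assms(1)] by blast
  have "av (z - \<iota> \<beta>) \<le> av (z - \<iota> \<beta> - \<iota> \<mu>)" if "\<mu> \<in> \<Lambda>" for \<mu>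
    using \<beta>(2)[OF lattice_add[OF assms(1) \<beta>(1) that]] by (simp add: iota_simps algebra_simps)
  then have "av (z - \<iota> \<beta>) \<le> av (lattice_exp \<iota> \<Lambda> (z - \<iota> \<beta>))"
    using av_lattice_exp_ge_reduced[OF assms(1), of "z - \<iota> \<beta>" "{}"] by simp
  then have "z = \<iota> \<beta>"
    using assms \<beta>(1) by (simp add: lattice_exp_periodic)
  with \<beta>(1) show ?thesis
    by blast
qed

subsection \<open>The exponential of a sublattice of finite index\<close>

text \<open>
  \<open>J\<close> represents the cosets of \<open>\<Lambda>'\<close>. The product over the coset \<open>j + \<Lambda>'\<close> is a quotient of two
  values of the exponential of \<open>\<Lambda>'\<close>, so that the exponential of \<open>\<Lambda>\<close> is a polynomial in that of \<open>\<Lambda>'\<close>.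
\<close>

lemma lattice_exp_sublattice:
  assumes \<Lambda>: "is_lattice \<Lambda>" and \<Lambda>': "is_lattice \<Lambda>'" "\<Lambda>' \<subseteq> \<Lambda>"
    and J: "finite J" "J \<subseteq> \<Lambda>" "0 \<in> J" "\<And>x. x \<in> \<Lambda> \<Longrightarrow> \<exists>!j. j \<in> J \<and> x - j \<in> \<Lambda>'"
  shows "lattice_exp \<iota> \<Lambda> z * (\<Prod>j\<in>J - {0}. lattice_exp \<iota> \<Lambda>' (- \<iota> j)) =
    lattice_exp \<iota> \<Lambda>' z * (\<Prod>j\<in>J - {0}. lattice_exp \<iota> \<Lambda>' (z - \<iota> j))"
proof -
  have finite_level: "partial_exp \<Lambda> n z * (\<Prod>j\<in>J - {0}. partial_exp \<Lambda>' n (- \<iota> j)) =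
      partial_exp \<Lambda>' n z * (\<Prod>j\<in>J - {0}. partial_exp \<Lambda>' n (z - \<iota> j))"
    if n: "J \<subseteq> lball \<Lambda> n" for n
  proof -
    let ?V = "lball \<Lambda> n" and ?W = "lball \<Lambda>' n"
    define c where "c = (\<Prod>\<beta>\<in>?W - {0}. - 1 / \<iota> \<beta>)"
    define g where "g x = (\<Prod>\<beta>\<in>?W. x - \<iota> \<beta>)" for x
    have fin: "finite ?V" "finite ?W"
      using \<Lambda> \<Lambda>'(1) by (auto intro: finite_lball)
    have exp_g: "partial_exp \<Lambda>' n x = c * g x" for x
    proof -
      have "(\<Prod>v\<in>\<iota> ` ?W. x - v) = g x"
        unfolding g_def by (subst prod.reindex) (auto simp: inj_on_def)
      then show ?thesis
        by (simp add: partial_exp_eq[OF \<Lambda>'(1)] c_def)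
    qed
    have notin: "j \<notin> \<Lambda>'" if "j \<in> J - {0}" for j
    proof
      assume "j \<in> \<Lambda>'"
      then have "j - 0 \<in> \<Lambda>'" "j - j \<in> \<Lambda>'" "j \<in> J" "j \<noteq> 0"
        using that lattice_0[OF \<Lambda>'(1)] by auto
      then show False
        using J(4)[of j] J(2,3) by blast
    qed
    have decomp: "?V - {0} = (?W - {0}) \<union> (\<Union>j\<in>J - {0}. (+) j ` ?W)"
    proof (intro equalityI subsetI)
      fix x assume x: "x \<in> ?V - {0}"
      then obtain j where j: "j \<in> J" "x - j \<in> \<Lambda>'"
        using J(4)[of x] by (auto simp: lball_def)
      have "av (\<iota> (x - j)) \<le> real n"
        using x j n av_diff_le_max[of "\<iota> x" "\<iota> j"] by (force simp: lball_def iota_simps)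
      then have xj: "x - j \<in> ?W"
        using j by (simp add: lball_def)
      show "x \<in> (?W - {0}) \<union> (\<Union>j\<in>J - {0}. (+) j ` ?W)"
      proof (cases "j = 0")
        case False
        have "x \<in> (+) j ` ?W"
          using xj by (intro image_eqI[of _ _ "x - j"]) auto
        with False j(1) show ?thesis
          by blast
      qed (use x xj in auto)
    next
      fix x assume x: "x \<in> (?W - {0}) \<union> (\<Union>j\<in>J - {0}. (+) j ` ?W)"
      show "x \<in> ?V - {0}"
      proof (cases "x \<in> ?W - {0}")
        case True
        then show ?thesis
          using \<Lambda>'(2) by (auto simp: lball_def)
      next
        case False
        then obtain j y where j: "j \<in> J - {0}" "y \<in> ?W" "x = j + y"
          using x by auto
        have "x \<noteq> 0"
        proof
          assume "x = 0"
          then have "j = - y"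
            using j by (simp add: eq_neg_iff_add_eq_0)
          then show False
            using notin[OF j(1)] j(2) lattice_minus[OF \<Lambda>'(1)] by (auto simp: lball_def)
        qed
        moreover have "x \<in> \<Lambda>"
          using j J(2) \<Lambda>'(2) lattice_add[OF \<Lambda>] by (auto simp: lball_def)
        moreover have "av (\<iota> x) \<le> real n"
          using j n av_add_le_max[of "\<iota> j" "\<iota> y"] by (force simp: lball_def iota_simps)
        ultimately show ?thesis
          by (simp add: lball_def)
      qed
    qed
    have disj: "(+) i ` ?W \<inter> (+) j ` ?W = {}" if "i \<in> J" "j \<in> J" "i \<noteq> j" for i j
    proof (rule ccontr)
      assume "(+) i ` ?W \<inter> (+) j ` ?W \<noteq> {}"
      then obtain v w where vw: "v \<in> \<Lambda>'" "w \<in> \<Lambda>'" "i + v = j + w"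
        by (auto simp: lball_def)
      then have "i + v \<in> \<Lambda>"
        using that J(2) \<Lambda>'(2) lattice_add[OF \<Lambda>] by auto
      moreover have "i + v - j = w"
        using vw by simp
      moreover have "i + v - i = v"
        by simp
      ultimately show False
        using J(4)[of "i + v"] that vw by metis
    qed
    have disj0: "(?W - {0}) \<inter> (\<Union>j\<in>J - {0}. (+) j ` ?W) = {}"
    proof -
      have "?W = (+) 0 ` ?W"
        by simp
      then show ?thesis
        using disj[OF J(3)] by blast
    qed
    have coset: "(\<Prod>\<beta>\<in>(+) j ` ?W. 1 - z / \<iota> \<beta>) = g (z - \<iota> j) / g (- \<iota> j)"
      if j: "j \<in> J - {0}" for j
    proof -
      have "1 - z / \<iota> (j + \<beta>) = (z - \<iota> j - \<iota> \<beta>) / (- \<iota> j - \<iota> \<beta>)" if "\<beta> \<in> ?W" for \<beta>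
      proof -
        have "j + \<beta> \<noteq> 0"
        proof
          assume "j + \<beta> = 0"
          then have "j = - \<beta>"
            by (simp add: eq_neg_iff_add_eq_0)
          then show False
            using notin[OF j] that lattice_minus[OF \<Lambda>'(1)] by (auto simp: lball_def)
        qed
        then have "\<iota> (j + \<beta>) \<noteq> 0"
          by simp
        then have "1 - z / \<iota> (j + \<beta>) = (z - \<iota> (j + \<beta>)) / (- \<iota> (j + \<beta>))"
          by (simp add: field_simps del: iota_eq_0_iff)
        moreover have "- \<iota> (j + \<beta>) = - \<iota> j - \<iota> \<beta>" "z - \<iota> (j + \<beta>) = z - \<iota> j - \<iota> \<beta>"
          by (simp_all add: iota_simps)
        ultimately show ?thesis
          by (simp only:)
      qed
      then show ?thesis
        by (subst prod.reindex) (auto simp: g_def simp flip: prod_dividef intro!: prod.cong)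
    qed
    have g_nz: "g (- \<iota> j) \<noteq> 0" if "j \<in> J - {0}" for j
    proof
      assume "g (- \<iota> j) = 0"
      then obtain \<beta> where "\<beta> \<in> ?W" "- \<iota> j = \<iota> \<beta>"
        using fin(2) by (auto simp: g_def)
      then have "\<iota> j = \<iota> (- \<beta>)"
        by (metis iota_minus minus_minus)
      then show False
        using notin[OF that] \<open>\<beta> \<in> ?W\<close> lattice_minus[OF \<Lambda>'(1)] by (auto simp: lball_def)
    qed
    have "partial_exp \<Lambda> n z = partial_exp \<Lambda>' n z * (\<Prod>j\<in>J - {0}. g (z - \<iota> j) / g (- \<iota> j))"
    proof -
      have "(\<Prod>\<beta>\<in>?V - {0}. 1 - z / \<iota> \<beta>) =
        (\<Prod>\<beta>\<in>?W - {0}. 1 - z / \<iota> \<beta>) * (\<Prod>\<beta>\<in>(\<Union>j\<in>J - {0}. (+) j ` ?W). 1 - z / \<iota> \<beta>)"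
        unfolding decomp using fin J(1) disj0 by (intro prod.union_disjoint) auto
      also have "(\<Prod>\<beta>\<in>(\<Union>j\<in>J - {0}. (+) j ` ?W). 1 - z / \<iota> \<beta>) =
        (\<Prod>j\<in>J - {0}. \<Prod>\<beta>\<in>(+) j ` ?W. 1 - z / \<iota> \<beta>)"
        using fin J(1) disj by (intro prod.UNION_disjoint) auto
      finally show ?thesis
        by (simp add: partial_exp_def coset)
    qed
    also have "(\<Prod>j\<in>J - {0}. g (z - \<iota> j) / g (- \<iota> j)) * (\<Prod>j\<in>J - {0}. partial_exp \<Lambda>' n (- \<iota> j)) =
      (\<Prod>j\<in>J - {0}. partial_exp \<Lambda>' n (z - \<iota> j))"
      using g_nz by (auto simp: exp_g simp flip: prod.distrib intro!: prod.cong)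
    ultimately show ?thesis
      by (simp add: mult.assoc)
  qed
  have L1: "(\<lambda>n. partial_exp \<Lambda> n z * (\<Prod>j\<in>J - {0}. partial_exp \<Lambda>' n (- \<iota> j))) \<longlonglongrightarrow>
      lattice_exp \<iota> \<Lambda> z * (\<Prod>j\<in>J - {0}. lattice_exp \<iota> \<Lambda>' (- \<iota> j))"
    by (intro tendsto_times tendsto_finite_prod partial_exp_tendsto \<Lambda> \<Lambda>')
  have L2: "(\<lambda>n. partial_exp \<Lambda>' n z * (\<Prod>j\<in>J - {0}. partial_exp \<Lambda>' n (z - \<iota> j))) \<longlonglongrightarrow>
      lattice_exp \<iota> \<Lambda>' z * (\<Prod>j\<in>J - {0}. lattice_exp \<iota> \<Lambda>' (z - \<iota> j))"
    by (intro tendsto_times tendsto_finite_prod partial_exp_tendsto \<Lambda>')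
  have "\<forall>\<^sub>F n in sequentially. partial_exp \<Lambda> n z * (\<Prod>j\<in>J - {0}. partial_exp \<Lambda>' n (- \<iota> j)) =
      partial_exp \<Lambda>' n z * (\<Prod>j\<in>J - {0}. partial_exp \<Lambda>' n (z - \<iota> j))"
    using eventually_subset_lball[OF J(1,2)] by (rule eventually_mono) (rule finite_level)
  from tendsto_cong[OF this, THEN iffD2, OF L2] show ?thesis
    by (rule LIMSEQ_unique[OF L1])
qed

section \<open>Power series\<close>

lemma tendsto_av_close:
  fixes S T :: "nat \<Rightarrow> 'c"
  assumes "S \<longlonglongrightarrow> l" "\<And>n. av (S n - T n) \<le> g n" "g \<longlonglongrightarrow> 0"
  shows "T \<longlonglongrightarrow> l"
proof -
  have "(\<lambda>n. S n - T n) \<longlonglongrightarrow> 0"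
    unfolding tendsto_iff_av
    by (rule tendsto_sandwich[of "\<lambda>_. 0" _ _ g]) (use assms in auto)
  from tendsto_plus[OF assms(1) tendsto_cmult[OF this, of "- 1"]] show ?thesis
    by simp
qed

lemma sums_terms_bounded:
  fixes a :: "nat \<Rightarrow> 'c"
  assumes "(\<lambda>i. a i * u ^ i) sums v"
  shows "\<exists>M. \<forall>i. av (a i) * av u ^ i \<le> M"
proof -
  let ?S = "\<lambda>n. \<Sum>i<n. a i * u ^ i"
  have "bounded (range ?S)"
    using assms unfolding sums_def by (rule convergent_imp_bounded)
  then obtain M where M: "\<And>n. av (?S n) \<le> M"
    by (auto simp: bounded_any_center[of _ 0] dist_commute)
  have "av (a i) * av u ^ i \<le> M" for i
  proof -
    have "a i * u ^ i = ?S (Suc i) - ?S i"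
      by simp
    then have "av (a i * u ^ i) \<le> max (av (?S (Suc i))) (av (?S i))"
      using av_diff_le_max by metis
    then show ?thesis
      using M[of "Suc i"] M[of i] by (simp add: av_mult av_power)
  qed
  then show ?thesis
    by blast
qed

text \<open>\<open>M\<close> bounds the Gauss norm of \<open>f\<close> on the disc of radius \<open>s\<close>, which is multiplicative in \<open>f\<close>.\<close>

definition coeff_bound :: "real \<Rightarrow> real \<Rightarrow> 'c fps \<Rightarrow> bool" where
  "coeff_bound s M f \<longleftrightarrow> (\<forall>n. av (fps_nth f n) * s ^ n \<le> M)"

lemma coeff_bound_nonneg: "coeff_bound s M f \<Longrightarrow> 0 \<le> M"
  unfolding coeff_bound_def by (metis mult.right_neutral order_trans power_0 zero_le_dist)

lemma coeff_bound_term: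
  assumes "coeff_bound s M f" "0 < s"
  shows "av (fps_nth f n * x ^ n) \<le> M * (av x / s) ^ n"
proof -
  have "av (fps_nth f n * x ^ n) = (av (fps_nth f n) * s ^ n) * (av x / s) ^ n"
    using assms(2) by (simp add: av_mult av_power power_divide)
  also have "\<dots> \<le> M * (av x / s) ^ n"
    using assms by (intro mult_right_mono) (auto simp: coeff_bound_def)
  finally show ?thesis .
qed

lemma coeff_bound_mult:
  assumes "coeff_bound s M f" "coeff_bound s N g" "0 < s"
  shows "coeff_bound s (M * N) (f * g)"
  unfolding coeff_bound_def
proof
  fix n
  have nn: "0 \<le> M" "0 \<le> N"
    using assms by (auto intro: coeff_bound_nonneg)
  have "av (fps_nth f i * fps_nth g (n - i)) \<le> M * N / s ^ n" if "i \<le> n" for i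
  proof -
    have "s ^ n = s ^ i * s ^ (n - i)"
      using that by (simp flip: power_add)
    then have "av (fps_nth f i * fps_nth g (n - i)) * s ^ n =
        (av (fps_nth f i) * s ^ i) * (av (fps_nth g (n - i)) * s ^ (n - i))"
      by (simp add: av_mult)
    also have "\<dots> \<le> M * N"
      using assms nn by (intro mult_mono) (auto simp: coeff_bound_def)
    finally show ?thesis
      using assms(3) by (simp add: pos_le_divide_eq)
  qed
  then have "av (fps_nth (f * g) n) \<le> M * N / s ^ n"
    unfolding fps_mult_nth using nn assms(3) by (intro av_sum_le) auto
  then show "av (fps_nth (f * g) n) * s ^ n \<le> M * N"
    using assms(3) by (simp add: pos_le_divide_eq)
qed

lemma coeff_bound_one: "coeff_bound s 1 1"
  by (auto simp: coeff_bound_def)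

lemma coeff_bound_power: "coeff_bound s M f \<Longrightarrow> 0 < s \<Longrightarrow> coeff_bound s (M ^ n) (f ^ n)"
  by (induction n) (auto intro: coeff_bound_one coeff_bound_mult)

lemma fps_sums_one: "(\<lambda>n. fps_nth 1 n * x ^ n) sums (1 :: 'c)"
proof -
  have "(\<Sum>n<Suc L. fps_nth 1 n * x ^ n) = (1 :: 'c)" for L
    by (induction L) auto
  then show ?thesis
    unfolding sums_def by (subst filterlim_sequentially_Suc[symmetric]) simp
qed

text \<open>
  The difference between the partial sums of a product and the product of the partial sums
  consists of terms of degree at least \<open>L\<close>; the ultrametric inequality bounds it by the largest.
\<close>

lemma fps_sums_mult:
  assumes f: "coeff_bound s M f" "(\<lambda>n. fps_nth f n * x ^ n) sums a"
    and g: "coeff_bound s N g" "(\<lambda>n. fps_nth g n * x ^ n) sums b"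
    and x: "av x < s"
  shows "(\<lambda>n. fps_nth (f * g) n * x ^ n) sums (a * b)"
proof -
  have s: "0 < s"
    using x zero_le_dist[of x 0] by linarith
  define \<theta> where "\<theta> = av x / s"
  have \<theta>: "0 \<le> \<theta>" "\<theta> < 1"
    using x s by (auto simp: \<theta>_def)
  have nn: "0 \<le> M" "0 \<le> N"
    using f g by (auto intro: coeff_bound_nonneg)
  define t where "t i j = (fps_nth f i * x ^ i) * (fps_nth g j * x ^ j)" for i j
  have close: "av ((\<Sum>i<L. fps_nth f i * x ^ i) * (\<Sum>j<L. fps_nth g j * x ^ j) -
      (\<Sum>n<L. fps_nth (f * g) n * x ^ n)) \<le> M * N * \<theta> ^ L" for L
  proof -
    let ?A = "{..<L} \<times> {..<L}" and ?B = "{(i, j). i + j < L}"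
    have "(\<Sum>n<L. fps_nth (f * g) n * x ^ n) = (\<Sum>n<L. \<Sum>i\<le>n. t i (n - i))"
    proof (intro sum.cong refl)
      fix n
      have "fps_nth (f * g) n * x ^ n = (\<Sum>i\<le>n. fps_nth f i * fps_nth g (n - i) * x ^ n)"
        by (simp add: fps_mult_nth sum_distrib_right atLeast0AtMost)
      also have "\<dots> = (\<Sum>i\<le>n. t i (n - i))"
      proof (intro sum.cong refl)
        fix i assume "i \<in> {..n}"
        then have "x ^ n = x ^ i * x ^ (n - i)"
          by (simp flip: power_add)
        then show "fps_nth f i * fps_nth g (n - i) * x ^ n = t i (n - i)"
          by (simp add: t_def)
      qed
      finally show "fps_nth (f * g) n * x ^ n = (\<Sum>i\<le>n. t i (n - i))" .
    qed
    also have "\<dots> = (\<Sum>(i, j)\<in>?B. t i j)"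
      by (rule sum.triangle_reindex[symmetric])
    finally have 1: "(\<Sum>n<L. fps_nth (f * g) n * x ^ n) = (\<Sum>(i, j)\<in>?B. t i j)" .
    have 2: "(\<Sum>i<L. fps_nth f i * x ^ i) * (\<Sum>j<L. fps_nth g j * x ^ j) = (\<Sum>(i, j)\<in>?A. t i j)"
      by (simp add: sum_product sum.cartesian_product t_def)
    have sub: "?B \<subseteq> ?A"
      by auto
    have 3: "(\<Sum>(i, j)\<in>?A. t i j) = (\<Sum>(i, j)\<in>?A - ?B. t i j) + (\<Sum>(i, j)\<in>?B. t i j)"
      by (rule sum.subset_diff[OF sub]) simp
    have "av (\<Sum>(i, j)\<in>?A - ?B. t i j) \<le> M * N * \<theta> ^ L"
    proof (rule av_sum_le)
      fix k assume "k \<in> ?A - ?B"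
      then obtain i j where k: "k = (i, j)" "L \<le> i + j"
        by auto
      have "av (t i j) \<le> (M * \<theta> ^ i) * (N * \<theta> ^ j)"
        unfolding t_def av_mult[of "fps_nth f i * x ^ i"] \<theta>_def
        using coeff_bound_term[OF f(1) s, of i x] coeff_bound_term[OF g(1) s, of j x] nn s
        by (intro mult_mono) auto
      also have "\<dots> = M * N * \<theta> ^ (i + j)"
        by (simp add: power_add)
      also have "\<dots> \<le> M * N * \<theta> ^ L"
        using k \<theta> nn by (intro mult_left_mono power_decreasing) auto
      finally show "av (case k of (i, j) \<Rightarrow> t i j) \<le> M * N * \<theta> ^ L"
        by (simp add: k)
    qed (use nn \<theta> in auto)
    then show ?thesis
      by (simp add: 1 2 3)
  qed
  have "(\<lambda>L. (\<Sum>i<L. fps_nth f i * x ^ i) * (\<Sum>j<L. fps_nth g j * x ^ j)) \<longlonglongrightarrow> a * b"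
    using f(2) g(2) unfolding sums_def by (rule tendsto_times)
  moreover have "(\<lambda>L. M * N * \<theta> ^ L) \<longlonglongrightarrow> 0"
    using \<theta> by (intro tendsto_mult_right_zero LIMSEQ_realpow_zero)
  ultimately show ?thesis
    unfolding sums_def by (rule tendsto_av_close[OF _ close])
qed

lemma fps_sums_power:
  assumes "coeff_bound s M f" "(\<lambda>n. fps_nth f n * x ^ n) sums a" "av x < s"
  shows "(\<lambda>n. fps_nth (f ^ i) n * x ^ n) sums (a ^ i)"
proof (induction i)
  case 0
  then show ?case
    using fps_sums_one by simp
next
  case (Suc i)
  have "0 < s"
    using assms(3) zero_le_dist[of x 0] by linarith
  then show ?case
    using fps_sums_mult[OF assms(1,2) coeff_bound_power[OF assms(1)] Suc assms(3)] by simp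
qed

lemma fps_sums_tail:
  assumes f: "coeff_bound s M f" "(\<lambda>n. fps_nth f n * x ^ n) sums a" and x: "av x < s"
  shows "av (a - (\<Sum>n<L. fps_nth f n * x ^ n)) \<le> M * (av x / s) ^ L"
proof -
  let ?S = "\<lambda>L. \<Sum>n<L. fps_nth f n * x ^ n"
  have s: "0 < s"
    using x zero_le_dist[of x 0] by linarith
  have "(\<lambda>N. ?S N + (- ?S L)) \<longlonglongrightarrow> a + (- ?S L)"
    using f(2) unfolding sums_def by (intro tendsto_plus tendsto_const)
  then have lim: "(\<lambda>N. av (?S N - ?S L)) \<longlonglongrightarrow> av (a - ?S L)"
    by (intro tendsto_av) simp
  have "av (?S N - ?S L) \<le> M * (av x / s) ^ L" if "L \<le> N" for N
  proof -
    have "?S N - ?S L = (\<Sum>n\<in>{L..<N}. fps_nth f n * x ^ n)"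
      using sum_diff_nat_ivl[of 0 L N "\<lambda>n. fps_nth f n * x ^ n"] that
      by (simp add: atLeast0LessThan)
    moreover have "av (\<Sum>n\<in>{L..<N}. fps_nth f n * x ^ n) \<le> M * (av x / s) ^ L"
    proof (rule av_sum_le)
      fix n assume "n \<in> {L..<N}"
      then have "M * (av x / s) ^ n \<le> M * (av x / s) ^ L"
        using coeff_bound_nonneg[OF f(1)] x s by (intro mult_left_mono power_decreasing) auto
      with coeff_bound_term[OF f(1) s, of n x] show "av (fps_nth f n * x ^ n) \<le> M * (av x / s) ^ L"
        by linarith
    qed (use coeff_bound_nonneg[OF f(1)] s in auto)
    ultimately show ?thesis
      by simp
  qed
  then show ?thesis
    by (intro tendsto_upperbound[OF lim]) (auto intro: eventually_sequentiallyI[of L])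
qed

text \<open>
  Composition with a series \<open>G\<close> without constant term. The terms \<open>a\<^sub>i G\<^sup>i\<close> start in degree \<open>i\<close> and, on a
  small disc, are bounded independently of \<open>i\<close>; hence the double series may be rearranged.
\<close>

lemma fps_sums_compose:
  assumes G: "coeff_bound s e G" "fps_nth G 0 = 0" "(\<lambda>n. fps_nth G n * x ^ n) sums y"
    and x: "av x < s"
    and a: "\<And>i. av (a i) * e ^ i \<le> M" "(\<lambda>i. a i * y ^ i) sums v"
  shows "(\<lambda>n. fps_nth (Abs_fps a oo G) n * x ^ n) sums v"
proof -
  have s: "0 < s"
    using x zero_le_dist[of x 0] by linarith
  have M: "0 \<le> M"
    using a(1)[of 0] zero_le_dist[of "a 0" 0] by (simp del: zero_le_dist)
  define \<theta> where "\<theta> = av x / s"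
  have \<theta>: "0 \<le> \<theta>" "\<theta> < 1"
    using x s by (auto simp: \<theta>_def)
  define S where "S i L = (\<Sum>n<L. fps_nth (G ^ i) n * x ^ n)" for i L
  have close: "av ((\<Sum>i<L. a i * y ^ i) - (\<Sum>n<L. fps_nth (Abs_fps a oo G) n * x ^ n)) \<le> M * \<theta> ^ L"
    for L
  proof -
    have "(\<Sum>n<L. fps_nth (Abs_fps a oo G) n * x ^ n) =
        (\<Sum>n<L. \<Sum>i<L. a i * (fps_nth (G ^ i) n * x ^ n))"
    proof (intro sum.cong refl)
      fix n assume n: "n \<in> {..<L}"
      have "fps_nth (Abs_fps a oo G) n * x ^ n = (\<Sum>i=0..n. a i * (fps_nth (G ^ i) n * x ^ n))"
        by (simp add: fps_compose_nth sum_distrib_right mult.assoc)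
      also have "\<dots> = (\<Sum>i<L. a i * (fps_nth (G ^ i) n * x ^ n))"
      proof (rule sum.mono_neutral_left)
        show "\<forall>i\<in>{..<L} - {0..n}. a i * (fps_nth (G ^ i) n * x ^ n) = 0"
          using startsby_zero_power_prefix[OF G(2)] by auto
      qed (use n in auto)
      finally show "fps_nth (Abs_fps a oo G) n * x ^ n = (\<Sum>i<L. a i * (fps_nth (G ^ i) n * x ^ n))" .
    qed
    also have "\<dots> = (\<Sum>i<L. a i * S i L)"
      unfolding S_def sum_distrib_left by (rule sum.swap)
    finally have "(\<Sum>i<L. a i * y ^ i) - (\<Sum>n<L. fps_nth (Abs_fps a oo G) n * x ^ n) =
        (\<Sum>i<L. a i * (y ^ i - S i L))"
      by (simp add: sum_subtractf right_diff_distrib)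
    moreover have "av (\<Sum>i<L. a i * (y ^ i - S i L)) \<le> M * \<theta> ^ L"
    proof (rule av_sum_le)
      fix i
      have "av (y ^ i - S i L) \<le> e ^ i * \<theta> ^ L"
        unfolding S_def \<theta>_def
        by (rule fps_sums_tail[OF coeff_bound_power[OF G(1) s] fps_sums_power[OF G(1,3) x] x])
      then have "av (a i * (y ^ i - S i L)) \<le> av (a i) * (e ^ i * \<theta> ^ L)"
        by (simp add: av_mult mult_left_mono)
      also have "\<dots> = (av (a i) * e ^ i) * \<theta> ^ L"
        by simp
      also have "\<dots> \<le> M * \<theta> ^ L"
        using \<theta> a(1) by (intro mult_right_mono) auto
      finally show "av (a i * (y ^ i - S i L)) \<le> M * \<theta> ^ L" .
    qed (use M \<theta> in auto)
    ultimately show ?thesis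
      by simp
  qed
  have "(\<lambda>L. M * \<theta> ^ L) \<longlonglongrightarrow> 0"
    using \<theta> by (intro tendsto_mult_right_zero LIMSEQ_realpow_zero)
  with a(2) close show ?thesis
    unfolding sums_def by (rule tendsto_av_close)
qed

lemma geometric_fps_sums:
  assumes "av (e * x) < 1"
  shows "(\<lambda>n. fps_nth (Abs_fps (\<lambda>n. if n = 0 then 0 else - (e ^ n))) n * x ^ n)
    sums (- (e * x) / (1 - e * x) :: 'c)"
proof -
  let ?S = "\<lambda>L. \<Sum>n<L. fps_nth (Abs_fps (\<lambda>n. if n = 0 then 0 else - (e ^ n))) n * x ^ n"
  have nz: "1 - e * x \<noteq> 0"
    using assms by auto
  have "?S (Suc L) * (1 - e * x) = - (e * x) + (e * x) ^ Suc L" for L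
  proof (induction L)
    case (Suc L)
    have "?S (Suc (Suc L)) * (1 - e * x) = ?S (Suc L) * (1 - e * x) - (e * x) ^ Suc L * (1 - e * x)"
      by (simp add: algebra_simps power_mult_distrib)
    also have "\<dots> = - (e * x) + (e * x) ^ Suc (Suc L)"
      unfolding Suc by (simp add: algebra_simps)
    finally show ?case .
  qed simp
  then have "?S (Suc L) = (- (e * x) + (e * x) ^ Suc L) / (1 - e * x)" for L
    by (simp only: nonzero_eq_divide_eq[OF nz])
  then have eq: "?S (Suc L) = - (e * x) / (1 - e * x) + (1 / (1 - e * x)) * (e * x) ^ Suc L" for L
    by (simp only: add_divide_distrib times_divide_eq_left mult_1)
  have "(\<lambda>L. (e * x) ^ L) \<longlonglongrightarrow> 0"
    unfolding tendsto_iff_av using assms by (simp add: av_power LIMSEQ_realpow_zero)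
  then have "(\<lambda>L. (e * x) ^ Suc L) \<longlonglongrightarrow> 0"
    by (rule LIMSEQ_Suc)
  from tendsto_plus[OF tendsto_const tendsto_cmult[OF this]]
  have "(\<lambda>L. - (e * x) / (1 - e * x) + (1 / (1 - e * x)) * (e * x) ^ Suc L) \<longlonglongrightarrow>
      - (e * x) / (1 - e * x) + (1 / (1 - e * x)) * 0" .
  then have "(\<lambda>L. ?S (Suc L)) \<longlonglongrightarrow> - (e * x) / (1 - e * x)"
    unfolding eq by simp
  then show ?thesis
    unfolding sums_def by (subst (asm) filterlim_sequentially_Suc)
qed

section \<open>Changing the lattice of an expansion\<close>

text \<open>
  Subtracting a polynomial multiple of \<open>y\<close> makes any element of \<open>K\<^sub>\<infinity>\<close> smaller than \<open>y\<close>, and only finitely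
  many elements of \<open>\<Lambda>\<close> are that small. So a sublattice with all these multiples has finite index.
\<close>

lemma sublattice_representatives:
  assumes \<Lambda>: "is_lattice \<Lambda>" and \<Lambda>': "is_lattice \<Lambda>'" "\<Lambda>' \<subseteq> \<Lambda>"
    and y: "y \<noteq> 0" "\<And>p. emb_poly p * y \<in> \<Lambda>'"
  obtains J where "finite J" "J \<subseteq> \<Lambda>" "0 \<in> J" "\<And>x. x \<in> \<Lambda> \<Longrightarrow> \<exists>!j. j \<in> J \<and> x - j \<in> \<Lambda>'"
proof -
  define S where "S = {x \<in> \<Lambda>. av (\<iota> x) \<le> av (\<iota> y)}"
  have ex: "\<exists>s. s \<in> S \<and> x - s \<in> \<Lambda>'" if x: "x \<in> \<Lambda>" for x
  proof -
    obtain p where p: "av (\<iota> (x / y) - emb p) < 1"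
      using polynomial_part by blast
    define s where "s = x - emb_poly p * y"
    have "\<iota> s = \<iota> y * (\<iota> (x / y) - emb p)"
      using y(1) by (simp add: s_def iota_simps field_simps)
    then have "av (\<iota> s) \<le> av (\<iota> y)"
      using p mult_left_mono[of "av (\<iota> (x / y) - emb p)" 1 "av (\<iota> y)"] by (simp add: av_mult)
    moreover have "s \<in> \<Lambda>"
      unfolding s_def using x y(2) \<Lambda>'(2) by (intro lattice_diff[OF \<Lambda>]) auto
    moreover have "x - s \<in> \<Lambda>'"
      using y(2) by (simp add: s_def)
    ultimately show ?thesis
      by (auto simp: S_def)
  qed
  define r where "r x = (if x \<in> \<Lambda>' then 0 else SOME s. s \<in> S \<and> x - s \<in> \<Lambda>')" for x
  have r: "r x \<in> insert 0 S" "x - r x \<in> \<Lambda>'" if "x \<in> \<Lambda>" for x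
    using someI_ex[OF ex[OF that]] by (auto simp: r_def)
  have r_cong: "r x = r x'" if "x - x' \<in> \<Lambda>'" for x x'
  proof -
    have iff: "x - s \<in> \<Lambda>' \<longleftrightarrow> x' - s \<in> \<Lambda>'" for s
    proof
      assume "x - s \<in> \<Lambda>'"
      from lattice_diff[OF \<Lambda>'(1) this that] show "x' - s \<in> \<Lambda>'"
        by simp
    next
      assume "x' - s \<in> \<Lambda>'"
      from lattice_add[OF \<Lambda>'(1) this that] show "x - s \<in> \<Lambda>'"
        by (simp add: algebra_simps)
    qed
    show ?thesis
      unfolding r_def using iff iff[of 0] by simp
  qed
  have S: "insert 0 S \<subseteq> \<Lambda>" "finite (insert 0 S)"
    using lattice_0[OF \<Lambda>] lattice_finite[OF \<Lambda>] by (auto simp: S_def)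
  show thesis
  proof
    have "r ` \<Lambda> \<subseteq> insert 0 S"
      using r(1) by blast
    with S show "finite (r ` \<Lambda>)" "r ` \<Lambda> \<subseteq> \<Lambda>"
      by (blast intro: finite_subset)+
    show "0 \<in> r ` \<Lambda>"
      using lattice_0[OF \<Lambda>] lattice_0[OF \<Lambda>'(1)] by (intro image_eqI[of _ _ 0]) (auto simp: r_def)
  next
    fix x assume x: "x \<in> \<Lambda>"
    show "\<exists>!j. j \<in> r ` \<Lambda> \<and> x - j \<in> \<Lambda>'"
    proof (rule ex1I[of _ "r x"])
      fix j assume j: "j \<in> r ` \<Lambda> \<and> x - j \<in> \<Lambda>'"
      then obtain x' where x': "x' \<in> \<Lambda>" "j = r x'"
        by auto
      then have "x - j - (x' - j) \<in> \<Lambda>'"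
        using j r(2)[OF x'(1)] lattice_diff[OF \<Lambda>'(1), of "x - j" "x' - j"] by blast
      then show "j = r x"
        using r_cong[of x x'] x' by simp
    qed (use x r in auto)
  qed
qed

lemma cusp_param_nonzero: "is_lattice \<Lambda> \<Longrightarrow> z \<in> \<Omega> \<Longrightarrow> cusp_param \<iota> \<Lambda> z \<noteq> 0"
  using lattice_exp_eq_0D[of \<Lambda> z] by (auto simp: cusp_param_def upper_half_plane_def)

lemma av_cusp_param_le:
  assumes "is_lattice \<Lambda>" "z \<in> \<Omega>"
  shows "av (cusp_param \<iota> \<Lambda> z) \<le> 1 / im z"
proof -
  have "0 < im z"
    using assms(2) by (simp add: im_pos_iff)
  then have "1 / av (lattice_exp \<iota> \<Lambda> z) \<le> 1 / im z"
    using im_le_av_lattice_exp[OF assms(1), of z] by (intro divide_left_mono mult_pos_pos) linarith+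
  then show ?thesis
    by (simp add: cusp_param_def av_divide)
qed

text \<open>
  Put \<open>x = 1 / e'(z)\<close>, where \<open>e'\<close> is the exponential of \<open>\<Lambda>'\<close>. By the product formula for the sublattice
  and the additivity of \<open>e'\<close>, the parameter \<open>1 / e(z)\<close> of \<open>\<Lambda>\<close> is \<open>x\<close> times the product over \<open>j \<noteq> 0\<close> of
  \<open>- e'(j) x / (1 - e'(j) x)\<close>, and these factors are geometric series in \<open>x\<close>.
\<close>

lemma cusp_param_sublattice:
  assumes \<Lambda>: "is_lattice \<Lambda>" and \<Lambda>': "is_lattice \<Lambda>'" "\<Lambda>' \<subseteq> \<Lambda>"
    and y: "y \<noteq> 0" "\<And>p. emb_poly p * y \<in> \<Lambda>'"
  obtains G s where "0 < s" "coeff_bound s 1 G" "fps_nth G 0 = 0"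
    "\<And>z. z \<in> \<Omega> \<Longrightarrow> av (cusp_param \<iota> \<Lambda>' z) < s \<Longrightarrow>
      (\<lambda>n. fps_nth G n * cusp_param \<iota> \<Lambda>' z ^ n) sums cusp_param \<iota> \<Lambda> z"
proof -
  obtain J where J: "finite J" "J \<subseteq> \<Lambda>" "0 \<in> J" "\<And>x. x \<in> \<Lambda> \<Longrightarrow> \<exists>!j. j \<in> J \<and> x - j \<in> \<Lambda>'"
    by (rule sublattice_representatives[OF \<Lambda> \<Lambda>' y]) blast
  define e where "e j = lattice_exp \<iota> \<Lambda>' (\<iota> j)" for j
  define h where "h j = Abs_fps (\<lambda>n. if n = 0 then 0 else - (e j ^ n))" for j
  define G where "G = fps_X * (\<Prod>j\<in>J - {0}. h j)"
  (* A radius at which the coefficients of every geometric series are bounded by 1. *)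
  define s where "s = 1 / (1 + (\<Sum>j\<in>J - {0}. av (e j)))"
  have sum_nn: "0 \<le> (\<Sum>j\<in>J - {0}. av (e j))"
    by (intro sum_nonneg) auto
  have s: "0 < s" "s \<le> 1"
    using sum_nn by (auto simp: s_def divide_le_eq)
  have es: "av (e j) * s \<le> 1" if "j \<in> J - {0}" for j
  proof -
    have "av (e j) \<le> (\<Sum>j\<in>J - {0}. av (e j))"
      using J(1) that by (intro member_le_sum) auto
    then show ?thesis
      using sum_nn by (simp add: s_def divide_le_eq)
  qed
  have h_bound: "coeff_bound s 1 (h j)" if "j \<in> J - {0}" for j
  proof -
    have "(av (e j) * s) ^ n \<le> 1" for n
      using es[OF that] s by (intro power_le_one) auto
    then show ?thesis
      by (auto simp: coeff_bound_def h_def av_power power_mult_distrib)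
  qed
  have X_bound: "coeff_bound s 1 fps_X"
    using s by (auto simp: coeff_bound_def fps_X_def)
  have prod_bound: "coeff_bound s 1 (\<Prod>j\<in>F. h j)" if "finite F" "F \<subseteq> J - {0}" for F
    using that
  proof (induction F rule: finite_induct)
    case (insert j F)
    then show ?case
      using coeff_bound_mult[OF h_bound[of j] insert.IH s(1)] by auto
  qed (simp add: coeff_bound_one)
  have "coeff_bound s 1 G"
    unfolding G_def using coeff_bound_mult[OF X_bound prod_bound s(1)] J(1) by auto
  moreover have "fps_nth G 0 = 0"
    by (simp add: G_def)
  moreover have "(\<lambda>n. fps_nth G n * cusp_param \<iota> \<Lambda>' z ^ n) sums cusp_param \<iota> \<Lambda> z"
    if z: "z \<in> \<Omega>" "av (cusp_param \<iota> \<Lambda>' z) < s" for z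
  proof -
    define x where "x = cusp_param \<iota> \<Lambda>' z"
    have x: "x \<noteq> 0" "av x < s"
      using z cusp_param_nonzero[OF \<Lambda>'(1)] by (auto simp: x_def)
    have ex: "av (e j * x) < 1" if "j \<in> J - {0}" for j
    proof (cases "e j = 0")
      case False
      then have "av (e j) * av x < av (e j) * s"
        using x by (intro mult_strict_left_mono) auto
      with es[OF that] show ?thesis
        by (simp add: av_mult)
    qed auto
    have h_sums: "(\<lambda>n. fps_nth (h j) n * x ^ n) sums (- (e j * x) / (1 - e j * x))"
      if "j \<in> J - {0}" for j
      unfolding h_def by (rule geometric_fps_sums[OF ex[OF that]])
    have prod_sums: "(\<lambda>n. fps_nth (\<Prod>j\<in>F. h j) n * x ^ n) sums (\<Prod>j\<in>F. - (e j * x) / (1 - e j * x))"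
      if "finite F" "F \<subseteq> J - {0}" for F
      using that
    proof (induction F rule: finite_induct)
      case empty
      then show ?case
        using fps_sums_one[of x] by simp
    next
      case (insert j F)
      then show ?case
        using fps_sums_mult[OF h_bound[of j] h_sums[of j] prod_bound[of F] insert.IH x(2)] by simp
    qed
    have X_sums: "(\<lambda>n. fps_nth fps_X n * x ^ n) sums x"
    proof -
      have "(\<Sum>n<Suc (Suc L). fps_nth fps_X n * x ^ n) = x" for L
        by (induction L) (auto simp: fps_X_def)
      then have "(\<lambda>L. \<Sum>n<Suc (Suc L). fps_nth fps_X n * x ^ n) \<longlonglongrightarrow> x"
        by simp
      then show ?thesis
        unfolding sums_def
        by (subst (asm) filterlim_sequentially_Suc, subst (asm) filterlim_sequentially_Suc)
    qed
    have "(\<lambda>n. fps_nth G n * x ^ n) sums (x * (\<Prod>j\<in>J - {0}. - (e j * x) / (1 - e j * x)))"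
      unfolding G_def using J(1) by (intro fps_sums_mult[OF X_bound X_sums prod_bound prod_sums x(2)]) auto
    moreover have "x * (\<Prod>j\<in>J - {0}. - (e j * x) / (1 - e j * x)) = cusp_param \<iota> \<Lambda> z"
    proof -
      have ez: "lattice_exp \<iota> \<Lambda>' z = 1 / x"
        by (simp add: x_def cusp_param_def)
      have fac: "lattice_exp \<iota> \<Lambda>' (z - \<iota> j) = (1 - e j * x) / x"
        "lattice_exp \<iota> \<Lambda>' (- \<iota> j) = - e j" for j
        using x(1) by (simp_all add: lattice_exp_diff[OF \<Lambda>'(1)] lattice_exp_minus[OF \<Lambda>'(1)] ez e_def field_simps)
      have "lattice_exp \<iota> \<Lambda> z * (\<Prod>j\<in>J - {0}. - e j) = 1 / x * (\<Prod>j\<in>J - {0}. (1 - e j * x) / x)"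
        using lattice_exp_sublattice[OF \<Lambda> \<Lambda>' J, of z] by (simp only: fac ez)
      moreover have "(\<Prod>j\<in>J - {0}. - (e j * x) / (1 - e j * x)) =
          (\<Prod>j\<in>J - {0}. - e j) / (\<Prod>j\<in>J - {0}. (1 - e j * x) / x)"
        unfolding prod_dividef[symmetric] using x(1) by (intro prod.cong) (auto simp: field_simps)
      moreover have "(\<Prod>j\<in>J - {0}. (1 - e j * x) / x) \<noteq> 0"
        using J(1) x(1) ex by fastforce
      moreover have "lattice_exp \<iota> \<Lambda> z \<noteq> 0"
        using cusp_param_nonzero[OF \<Lambda> z(1)] by (simp add: cusp_param_def)
      moreover have "x * (A / B) = 1 / E" if "E * A = 1 / x * B" "B \<noteq> 0" "E \<noteq> 0" for A B E :: 'c
      proof -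
        have "A = B / (x * E)"
          using that x(1) by (simp add: field_simps)
        then show ?thesis
          using that x(1) by simp
      qed
      ultimately show ?thesis
        by (simp only: cusp_param_def)
    qed
    ultimately show ?thesis
      by (simp add: x_def)
  qed
  ultimately show thesis
    using that s(1) by blast
qed

text \<open>
  Convergence at any one point bounds the coefficients of the expansion, so that the expansion of one
  parameter in terms of the other may be substituted. If there is no point to evaluate at, then the
  expansion says nothing and any coefficients will do.
\<close>

lemma has_expansion_sublattice:
  assumes \<Lambda>: "is_lattice \<Lambda>" and \<Lambda>': "is_lattice \<Lambda>'" "\<Lambda>' \<subseteq> \<Lambda>"
    and y: "y \<noteq> 0" "\<And>p. emb_poly p * y \<in> \<Lambda>'"
    and f: "has_expansion \<iota> \<Lambda> f a" "a 0 = 0"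
  shows "\<exists>b. has_expansion \<iota> \<Lambda>' f b \<and> b 0 = 0"
proof -
  obtain R where R: "\<And>z. z \<in> \<Omega> \<Longrightarrow> im z > R \<Longrightarrow> (\<lambda>i. a i * cusp_param \<iota> \<Lambda> z ^ i) sums f z"
    using f(1) unfolding has_expansion_def by blast
  show ?thesis
  proof (cases "\<exists>z\<in>\<Omega>. im z > R")
    case False
    then have "has_expansion \<iota> \<Lambda>' f (\<lambda>_. 0)"
      unfolding has_expansion_def by blast
    then show ?thesis
      by blast
  next
    case True
    then obtain z0 where z0: "z0 \<in> \<Omega>" "im z0 > R"
      by blast
    obtain M where M: "\<And>i. av (a i) * av (cusp_param \<iota> \<Lambda> z0) ^ i \<le> M"
      using sums_terms_bounded[OF R[OF z0]] by blast
    define e where "e = min 1 (av (cusp_param \<iota> \<Lambda> z0))"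
    have e: "0 < e" "e \<le> 1"
      using cusp_param_nonzero[OF \<Lambda> z0(1)] by (auto simp: e_def)
    have ae: "av (a i) * e ^ i \<le> M" for i
    proof -
      have "av (a i) * e ^ i \<le> av (a i) * av (cusp_param \<iota> \<Lambda> z0) ^ i"
        using e by (intro mult_left_mono power_mono) (auto simp: e_def)
      with M[of i] show ?thesis
        by linarith
    qed
    obtain G s where G: "0 < s" "coeff_bound s 1 G" "fps_nth G 0 = 0"
      "\<And>z. z \<in> \<Omega> \<Longrightarrow> av (cusp_param \<iota> \<Lambda>' z) < s \<Longrightarrow>
        (\<lambda>n. fps_nth G n * cusp_param \<iota> \<Lambda>' z ^ n) sums cusp_param \<iota> \<Lambda> z"
      by (rule cusp_param_sublattice[OF \<Lambda> \<Lambda>' y]) blast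
    (* As G has no constant term, shrinking the disc by e also improves the bound by e. *)
    have bound: "coeff_bound (s * e) e G"
      unfolding coeff_bound_def
    proof
      fix n
      show "av (fps_nth G n) * (s * e) ^ n \<le> e"
      proof (cases n)
        case (Suc m)
        have "(av (fps_nth G n) * s ^ n) * e ^ n \<le> 1 * e ^ n"
          using G(2) e by (intro mult_right_mono) (auto simp: coeff_bound_def)
        also have "\<dots> \<le> e"
          using e power_le_one[of e m] by (simp add: Suc mult_left_le)
        finally show ?thesis
          by (simp add: power_mult_distrib mult.assoc)
      qed (use G(3) e in auto)
    qed
    have "has_expansion \<iota> \<Lambda>' f (fps_nth (Abs_fps a oo G))"
      unfolding has_expansion_def
    proof (intro exI[of _ "max R (1 / (s * e))"] ballI impI)
      fix z assume z: "z \<in> \<Omega>" "im z > max R (1 / (s * e))"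
      have "1 / (s * e) < im z"
        using z by simp
      then have "1 / im z < s * e"
        using G(1) e im_pos_iff[of z] z(1) by (simp add: field_simps)
      then have small: "av (cusp_param \<iota> \<Lambda>' z) < s * e"
        using av_cusp_param_le[OF \<Lambda>'(1) z(1)] by linarith
      also have "\<dots> \<le> s"
        using G(1) e by (simp add: mult_left_le)
      finally have "av (cusp_param \<iota> \<Lambda>' z) < s" .
      then show "(\<lambda>i. fps_nth (Abs_fps a oo G) i * cusp_param \<iota> \<Lambda>' z ^ i) sums f z"
        using z by (intro fps_sums_compose[OF bound G(3) G(4)[OF z(1)] small ae R]) auto
    qed
    moreover have "fps_nth (Abs_fps a oo G) 0 = 0"
      using f(2) by simp
    ultimately show ?thesis
      by blast
  qed
qed

text \<open>
  The exponential of an infinite lattice grows faster than any power of the imaginary absolute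
  value, so a function that vanishes at the cusp decays faster than any power.
\<close>

lemma expansion_decay:
  assumes \<Lambda>: "is_lattice \<Lambda>" and y: "y \<noteq> 0" "\<And>p. emb_poly p * y \<in> \<Lambda>"
    and f: "has_expansion \<iota> \<Lambda> f a" "a 0 = 0"
  shows "\<exists>C R. 0 \<le> C \<and> 0 \<le> R \<and> (\<forall>z\<in>\<Omega>. im z > R \<longrightarrow> av (f z) \<le> C / im z ^ n)"
proof -
  obtain R where R: "\<And>z. z \<in> \<Omega> \<Longrightarrow> im z > R \<Longrightarrow> (\<lambda>i. a i * cusp_param \<iota> \<Lambda> z ^ i) sums f z"
    using f(1) unfolding has_expansion_def by blast
  show ?thesis
  proof (cases "\<exists>z\<in>\<Omega>. im z > R")
    case False
    then show ?thesis
      by (intro exI[of _ 0] exI[of _ "max 0 R"]) auto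
  next
    case True
    then obtain z0 where z0: "z0 \<in> \<Omega>" "im z0 > R"
      by blast
    define u where "u z = cusp_param \<iota> \<Lambda> z" for z
    obtain M where M: "\<And>i. av (a i) * av (u z0) ^ i \<le> M"
      using sums_terms_bounded[OF R[OF z0]] unfolding u_def by blast
    have M0: "0 \<le> M"
      using M[of 0] zero_le_dist[of "a 0" 0] by (simp del: zero_le_dist)
    have u0: "0 < av (u z0)"
      using cusp_param_nonzero[OF \<Lambda> z0(1)] by (simp add: u_def)
    define B where "B = (\<lambda>i. emb_poly (Polynomial.monom 1 i) * y) ` {..<n}"
    have inj: "inj_on (\<lambda>i. emb_poly (Polynomial.monom 1 i) * y) {..<n}"
      using y(1) by (auto simp: inj_on_def monom_eq_iff')
    have B: "finite B" "B \<subseteq> \<Lambda> - {0}" "card B = n"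
      using y by (auto simp: B_def card_image[OF inj] monom_eq_0_iff)
    define P where "P = (\<Prod>\<beta>\<in>B. av (\<iota> \<beta>))"
    have P: "0 < P"
      unfolding P_def using B by (intro prod_pos) auto
    have u_le: "av (u z) \<le> P / im z ^ n" if "z \<in> \<Omega>" "im z \<ge> 1" for z
    proof -
      have "im z ^ n / P \<le> im z * (im z ^ n / P)"
        using that(2) P mult_right_mono[of 1 "im z" "im z ^ n / P"] by auto
      also have "im z ^ n / P = (\<Prod>\<beta>\<in>B. im z / av (\<iota> \<beta>))"
        by (simp add: P_def B(3) prod_dividef)
      also have "im z * \<dots> \<le> av (lattice_exp \<iota> \<Lambda> z)"
        by (rule av_lattice_exp_ge[OF \<Lambda> B(1,2)])
      finally have "im z ^ n / P \<le> av (lattice_exp \<iota> \<Lambda> z)"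
        by (simp add: P_def B(3) prod_dividef)
      moreover have "0 < im z ^ n / P"
        using that P by (intro divide_pos_pos zero_less_power) auto
      ultimately have "1 / av (lattice_exp \<iota> \<Lambda> z) \<le> 1 / (im z ^ n / P)"
        by (intro divide_left_mono mult_pos_pos) auto
      then show ?thesis
        by (simp add: u_def cusp_param_def av_divide)
    qed
    have "av (f z) \<le> (M / av (u z0) * P) / im z ^ n"
      if z: "z \<in> \<Omega>" "im z > Max {1, R, 1 / av (u z0)}" for z
    proof -
      have z': "im z > 1" "im z > R" "im z > 1 / av (u z0)"
        using z(2) by auto
      have "1 / im z \<le> av (u z0)"
        using z'(1,3) u0 by (simp add: field_simps)
      then have small: "av (u z) \<le> av (u z0)"
        using av_cusp_param_le[OF \<Lambda> z(1)] by (simp add: u_def)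
      define \<rho> where "\<rho> = av (u z) / av (u z0)"
      have \<rho>: "0 \<le> \<rho>" "\<rho> \<le> 1"
        using small u0 by (auto simp: \<rho>_def)
      have term_le: "av (a i * u z ^ i) \<le> M * \<rho>" for i
      proof (cases i)
        case 0
        then show ?thesis
          using f(2) M0 \<rho> by simp
      next
        case (Suc j)
        have "av (a i * u z ^ i) = (av (a i) * av (u z0) ^ i) * \<rho> ^ i"
          using u0 by (simp add: av_mult av_power \<rho>_def power_divide)
        also have "\<dots> \<le> M * \<rho> ^ i"
          using M \<rho> by (intro mult_right_mono) auto
        also have "\<dots> \<le> M * \<rho>"
          using \<rho> M0 power_le_one[of \<rho> j] by (intro mult_left_mono) (auto simp: Suc mult_left_le)
        finally show ?thesis .
      qed
      have lim: "(\<lambda>L. av (\<Sum>i<L. a i * u z ^ i)) \<longlonglongrightarrow> av (f z)"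
        using R[OF z(1) z'(2)] unfolding sums_def u_def by (rule tendsto_av)
      have "av (f z) \<le> M * \<rho>"
        by (rule tendsto_upperbound[OF lim])
          (use M0 \<rho> term_le in \<open>auto intro!: always_eventually av_sum_le\<close>)
      also have "\<dots> \<le> M * ((P / im z ^ n) / av (u z0))"
        unfolding \<rho>_def using u_le[OF z(1)] z'(1) M0 u0
        by (intro mult_left_mono divide_right_mono) auto
      also have "\<dots> = (M / av (u z0) * P) / im z ^ n"
        by simp
      finally show ?thesis .
    qed
    moreover have "0 \<le> M / av (u z0) * P" "0 \<le> Max {1, R, 1 / av (u z0)}"
      using M0 u0 P by (auto simp: le_max_iff_disj)
    ultimately show ?thesis
      by blast
  qed
qed

end

section \<open>Ideals of the polynomial ring\<close>

lemma fq_poly_ring_simps [simp]: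
  "carrier fq_poly_ring = UNIV"
  "x \<oplus>\<^bsub>fq_poly_ring\<^esub> y = x + y"
  "x \<otimes>\<^bsub>fq_poly_ring\<^esub> y = x * y"
  "\<zero>\<^bsub>fq_poly_ring\<^esub> = 0"
  "\<one>\<^bsub>fq_poly_ring\<^esub> = 1"
  for x y :: "'a::field poly"
  by (simp_all add: ring_of_type_algebra_def)

lemma cring_fq_poly_ring: "cring (fq_poly_ring :: 'a::field poly ring)"
  by (rule cring_from_type_algebra)

lemma ring_fq_poly_ring: "ring (fq_poly_ring :: 'a::field poly ring)"
  by (rule ring_from_type_algebra)

lemma
  fixes I :: "'a::field poly set"
  assumes "ideal I fq_poly_ring"
  shows ideal_0: "0 \<in> I"
    and ideal_mult: "x \<in> I \<Longrightarrow> r * x \<in> I"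
    and ideal_add: "x \<in> I \<Longrightarrow> y \<in> I \<Longrightarrow> x + y \<in> I"
  using additive_subgroup.zero_closed[OF ideal.axioms(1)[OF assms]]
    ideal.I_l_closed[OF assms, of x r] additive_subgroup.a_closed[OF ideal.axioms(1)[OF assms], of x y]
  by simp_all

lemma ideal_diff:
  fixes I :: "'a::field poly set"
  assumes "ideal I fq_poly_ring" "x \<in> I" "y \<in> I"
  shows "x - y \<in> I"
  using ideal_add[OF assms(1,2) ideal_mult[OF assms(1,3), of "- 1"]] by simp

lemma cgenideal_poly: "cgenideal fq_poly_ring P = range (\<lambda>x :: 'a::field poly. x * P)"
  by (auto simp: cgenideal_def)

lemma ideal_cgenideal: "ideal (cgenideal fq_poly_ring P) fq_poly_ring"
  for P :: "'a::field poly"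
  by (rule cring.cgenideal_ideal[OF cring_fq_poly_ring]) simp

lemma ideal_prod_cgenideal:
  fixes I :: "'a::field poly set"
  assumes "ideal I fq_poly_ring"
  shows "ideal (ideal_prod fq_poly_ring I (cgenideal fq_poly_ring P)) fq_poly_ring"
    and "ideal_prod fq_poly_ring I (cgenideal fq_poly_ring P) \<subseteq> I"
    and "c \<in> I \<Longrightarrow> c * P \<in> ideal_prod fq_poly_ring I (cgenideal fq_poly_ring P)"
proof -
  show "ideal (ideal_prod fq_poly_ring I (cgenideal fq_poly_ring P)) fq_poly_ring"
    by (rule ring.ideal_prod_is_ideal[OF ring_fq_poly_ring assms ideal_cgenideal])
  show "ideal_prod fq_poly_ring I (cgenideal fq_poly_ring P) \<subseteq> I"
    using ring.ideal_prod_inter[OF ring_fq_poly_ring assms ideal_cgenideal[of P]] by blast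
  show "c * P \<in> ideal_prod fq_poly_ring I (cgenideal fq_poly_ring P)" if "c \<in> I"
    using ideal_prod.prod[OF that, of P "cgenideal fq_poly_ring P" fq_poly_ring]
    by (simp add: cgenideal_poly) (metis mult_1 rangeI)
qed

lemma ideal_quotient_by_element:
  fixes I :: "'a::field poly set"
  assumes "ideal I fq_poly_ring"
  shows "ideal {x. P * x \<in> I} fq_poly_ring"
proof (rule idealI[OF ring_fq_poly_ring])
  have inv: "- x \<in> {x. P * x \<in> I}" "inv\<^bsub>add_monoid fq_poly_ring\<^esub> x = - x"
    if "x \<in> {x. P * x \<in> I}" for x
  proof -
    show "- x \<in> {x. P * x \<in> I}"
      using that ideal_mult[OF assms, of "P * x" "- 1"] by simp
    show "inv\<^bsub>add_monoid fq_poly_ring\<^esub> x = - x"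
      by (rule group.inv_equality[OF abelian_group.a_group[OF ring.is_abelian_group[OF ring_fq_poly_ring]]]) auto
  qed
  show "subgroup {x. P * x \<in> I} (add_monoid fq_poly_ring)"
    by unfold_locales
      (use inv ideal_0[OF assms] in \<open>auto simp: distrib_left intro: ideal_add[OF assms]\<close>)
  fix a x
  assume "a \<in> {x. P * x \<in> I}"
  then have "P * (x * a) \<in> I"
    using ideal_mult[OF assms, of "P * a" x] by (simp add: mult.left_commute)
  then show "x \<otimes>\<^bsub>fq_poly_ring\<^esub> a \<in> {x. P * x \<in> I}" "a \<otimes>\<^bsub>fq_poly_ring\<^esub> x \<in> {x. P * x \<in> I}"
    by (simp_all add: mult.commute)
qed

text \<open>If all elements of \<open>I\<close> were multiples of \<open>P\<close>, then \<open>I\<close> would be \<open>P\<close> times the ideal of the quotients.\<close>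

lemma not_ideal_dvd_element:
  fixes I :: "'a::field poly set"
  assumes I: "ideal I fq_poly_ring" and ndvd: "\<not> ideal_dvd (cgenideal fq_poly_ring P) I"
  obtains N where "N \<in> I" "\<not> P dvd N"
proof (rule ccontr)
  assume "\<not> thesis"
  with that have all: "P dvd N" if "N \<in> I" for N
    using \<open>N \<in> I\<close> by blast
  let ?L = "{x. P * x \<in> I}"
  have L: "ideal ?L fq_poly_ring"
    by (rule ideal_quotient_by_element[OF I])
  have "x \<in> ideal_prod fq_poly_ring (cgenideal fq_poly_ring P) ?L" if "x \<in> I" for x
  proof -
    obtain r where "x = P * r"
      using all[OF \<open>x \<in> I\<close>] by (auto elim: dvdE)
    moreover have "P \<in> cgenideal fq_poly_ring P"
      unfolding cgenideal_poly by (metis mult_1 rangeI)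
    ultimately show ?thesis
      using ideal_prod.prod[of P "cgenideal fq_poly_ring P" r ?L fq_poly_ring] that by simp
  qed
  moreover have "x \<in> I" if "x \<in> ideal_prod fq_poly_ring (cgenideal fq_poly_ring P) ?L" for x
    using that
  proof induction
    case (prod i j)
    then show ?case
      using ideal_mult[OF I] by (auto simp: cgenideal_poly mult.assoc)
  qed (auto intro: ideal_add[OF I])
  ultimately have "I = ideal_prod fq_poly_ring (cgenideal fq_poly_ring P) ?L"
    by blast
  with L ndvd show False
    unfolding ideal_dvd_def by blast
qed

section \<open>Lattices of cusps\<close>

lemma ratfun_field_emb_poly: "emb_poly p \<in> ratfun_field"
proof -
  have "emb_poly p = emb_poly p / emb_poly 1"
    by simp
  then show ?thesis
    unfolding ratfun_field_def by (metis (mono_tags, lifting) CollectI one_neq_zero)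
qed

lemma ratfun_field_mult: "x \<in> ratfun_field \<Longrightarrow> y \<in> ratfun_field \<Longrightarrow> x * y \<in> ratfun_field"
  unfolding ratfun_field_def
  by (clarsimp simp flip: emb_poly_mult) (metis mult_eq_0_iff)

lemma ratfun_field_divide:
  assumes "x \<in> ratfun_field" "y \<in> ratfun_field"
  shows "x / y \<in> ratfun_field"
proof -
  obtain a b c d where *: "x = emb_poly a / emb_poly b" "y = emb_poly c / emb_poly d" "b \<noteq> 0" "d \<noteq> 0"
    using assms unfolding ratfun_field_def by blast
  show ?thesis
  proof (cases "c = 0")
    case True
    then show ?thesis
      using * ratfun_field_emb_poly[of 0] by simp
  next
    case False
    have "x / y = emb_poly (a * d) / emb_poly (b * c)"
      using * by (simp add: emb_poly_mult)
    with False * show ?thesis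
      unfolding ratfun_field_def by (metis (mono_tags, lifting) CollectI mult_eq_0_iff)
  qed
qed

lemma ratfun_field_diff:
  assumes "x \<in> ratfun_field" "y \<in> ratfun_field"
  shows "x - y \<in> ratfun_field"
proof -
  obtain a b c d where *: "x = emb_poly a / emb_poly b" "y = emb_poly c / emb_poly d" "b \<noteq> 0" "d \<noteq> 0"
    using assms unfolding ratfun_field_def by blast
  have "x - y = emb_poly (a * d - c * b) / emb_poly (b * d)"
    using * by (simp add: emb_poly_simps diff_frac_eq mult.commute)
  with * show ?thesis
    unfolding ratfun_field_def by (metis (mono_tags, lifting) CollectI mult_eq_0_iff)
qed

lemma ratfun_field_denominator:
  assumes "x \<in> ratfun_field"
  obtains g p where "g \<noteq> 0" "emb_poly g * x = emb_poly p"
  using assms unfolding ratfun_field_def by force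

lemma mat2_nth [simp]:
  "mat2 a b c d $ 1 $ 1 = a" "mat2 a b c d $ 1 $ 2 = b"
  "mat2 a b c d $ 2 $ 1 = c" "mat2 a b c d $ 2 $ 2 = d"
  by (simp_all add: mat2_def)

lemma mat2_eq_iff: "mat2 a b c d = mat2 a' b' c' d' \<longleftrightarrow> a = a' \<and> b = b' \<and> c = c' \<and> d = d'"
  by (auto simp: vec_eq_iff forall_2)

lemma mat2_mult:
  "mat2 a b c d ** mat2 a' b' c' d' =
    mat2 (a * a' + b * c') (a * b' + b * d') (c * a' + d * c') (c * b' + d * d')"
  for a b c d :: "'r::semiring_1"
  by (simp add: vec_eq_iff forall_2 matrix_matrix_mult_def sum_2)

lemma mat2_in_Gamma0_iff:
  "mat2 x y z w \<in> Gamma0 I \<longleftrightarrow> (\<exists>a b c d. x = emb_poly a \<and> y = emb_poly b \<and> z = emb_poly c \<and>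
    w = emb_poly d \<and> is_unit (a * d - b * c) \<and> c \<in> I)"
  unfolding Gamma0_def mat2_eq_iff mem_Collect_eq conj_assoc ..

lemma matrix_inv_invertible:
  assumes "invertible (A :: 'r::semiring_1 ^ 'n ^ 'n)"
  shows "A ** matrix_inv A = mat 1" "matrix_inv A ** A = mat 1"
  using someI_ex[of "\<lambda>B. A ** B = mat 1 \<and> B ** A = mat 1"] assms
  by (simp_all add: matrix_inv_def invertible_def)

text \<open>The entries of \<open>\<nu> E \<nu>\<^sup>-\<^sup>1\<close>, where \<open>E\<close> has a single entry \<open>1\<close> in the upper right corner.\<close>

definition conj_nilpotent :: "'r::semiring_1 ^ 2 ^ 2 \<Rightarrow> 2 \<Rightarrow> 2 \<Rightarrow> 'r" where
  "conj_nilpotent \<nu> i j = \<nu> $ i $ 1 * matrix_inv \<nu> $ 2 $ j"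

text \<open>
  The conjugate of the translation by \<open>x\<close> is \<open>1 + x \<nu> E \<nu>\<^sup>-\<^sup>1\<close>. As \<open>\<nu> E \<nu>\<^sup>-\<^sup>1\<close> is nilpotent, the determinant
  condition is automatic, and membership in the lattice is linear in \<open>x\<close>.
\<close>

lemma mem_cusp_lattice_iff:
  fixes \<nu> :: "'a::field fls ^ 2 ^ 2"
  assumes "invertible \<nu>"
  shows "x \<in> cusp_lattice I \<nu> \<longleftrightarrow> x * conj_nilpotent \<nu> 1 1 \<in> range emb_poly \<and> x * conj_nilpotent \<nu> 1 2 \<in> range emb_poly \<and>
    x * conj_nilpotent \<nu> 2 1 \<in> emb_poly ` I \<and> x * conj_nilpotent \<nu> 2 2 \<in> range emb_poly"
proof -
  let ?\<mu> = "matrix_inv \<nu>"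
  have right: "\<nu> ** ?\<mu> = mat 1" and left: "?\<mu> ** \<nu> = mat 1"
    using assms(1) by (simp_all add: matrix_inv_invertible)
  have r: "\<nu> $ 1 $ 1 * ?\<mu> $ 1 $ 1 + \<nu> $ 1 $ 2 * ?\<mu> $ 2 $ 1 = 1"
    "\<nu> $ 1 $ 1 * ?\<mu> $ 1 $ 2 + \<nu> $ 1 $ 2 * ?\<mu> $ 2 $ 2 = 0"
    "\<nu> $ 2 $ 1 * ?\<mu> $ 1 $ 1 + \<nu> $ 2 $ 2 * ?\<mu> $ 2 $ 1 = 0"
    "\<nu> $ 2 $ 1 * ?\<mu> $ 1 $ 2 + \<nu> $ 2 $ 2 * ?\<mu> $ 2 $ 2 = 1"
    using right by (simp_all add: vec_eq_iff forall_2 matrix_matrix_mult_def sum_2 mat_def)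
  have "?\<mu> $ 2 $ 1 * \<nu> $ 1 $ 1 + ?\<mu> $ 2 $ 2 * \<nu> $ 2 $ 1 = 0"
    using left by (simp add: vec_eq_iff forall_2 matrix_matrix_mult_def sum_2 mat_def)
  then have trace: "conj_nilpotent \<nu> 2 2 = - conj_nilpotent \<nu> 1 1"
    by (simp add: conj_nilpotent_def eq_neg_iff_add_eq_0 algebra_simps)
  have "(\<nu> ** mat2 1 x 0 1 ** ?\<mu>) $ i $ j = \<nu> $ i $ 1 * ?\<mu> $ 1 $ j + \<nu> $ i $ 2 * ?\<mu> $ 2 $ j + x * conj_nilpotent \<nu> i j"
    for i j
    by (simp add: matrix_matrix_mult_def sum_2 conj_nilpotent_def algebra_simps)
  then have conj: "\<nu> ** mat2 1 x 0 1 ** ?\<mu> =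
      mat2 (1 + x * conj_nilpotent \<nu> 1 1) (x * conj_nilpotent \<nu> 1 2) (x * conj_nilpotent \<nu> 2 1) (1 + x * conj_nilpotent \<nu> 2 2)"
    by (simp add: vec_eq_iff forall_2 r)
  have unit: "is_unit (a * d - b * c)"
    if "1 + x * conj_nilpotent \<nu> 1 1 = emb_poly a" "x * conj_nilpotent \<nu> 1 2 = emb_poly b" "x * conj_nilpotent \<nu> 2 1 = emb_poly c"
      "1 + x * conj_nilpotent \<nu> 2 2 = emb_poly d" for a b c d
  proof -
    have nilp: "conj_nilpotent \<nu> 1 1 * conj_nilpotent \<nu> 2 2 = conj_nilpotent \<nu> 1 2 * conj_nilpotent \<nu> 2 1"
      by (simp add: conj_nilpotent_def)
    have expand: "(1 + x * A) * (1 + x * D) - (x * B) * (x * C) = 1 + x * (A + D) + x * x * (A * D - B * C)"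
      for A B C D
      by (simp add: algebra_simps)
    have "(1 + x * conj_nilpotent \<nu> 1 1) * (1 + x * conj_nilpotent \<nu> 2 2) -
        (x * conj_nilpotent \<nu> 1 2) * (x * conj_nilpotent \<nu> 2 1) = 1"
      unfolding expand nilp by (simp add: trace)
    then have "emb_poly (a * d - b * c) = emb_poly 1"
      unfolding that by (simp add: emb_poly_simps del: emb_poly_eq_iff)
    then have "a * d - b * c = 1"
      by (simp only: emb_poly_eq_iff)
    then show ?thesis
      by simp
  qed
  have shift: "1 + v \<in> range emb_poly \<longleftrightarrow> v \<in> range emb_poly" for v :: "'a fls"
  proof
    assume "1 + v \<in> range emb_poly"
    then obtain p where "1 + v = emb_poly p"
      by blast
    then have "v = emb_poly (p - 1)"
      by (simp add: emb_poly_diff algebra_simps)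
    then show "v \<in> range emb_poly"
      by blast
  next
    assume "v \<in> range emb_poly"
    then obtain p where "v = emb_poly p"
      by blast
    then have "1 + v = emb_poly (1 + p)"
      by (simp add: emb_poly_add)
    then show "1 + v \<in> range emb_poly"
      by blast
  qed
  have "x \<in> cusp_lattice I \<nu> \<longleftrightarrow> 1 + x * conj_nilpotent \<nu> 1 1 \<in> range emb_poly \<and> x * conj_nilpotent \<nu> 1 2 \<in> range emb_poly \<and>
      x * conj_nilpotent \<nu> 2 1 \<in> emb_poly ` I \<and> 1 + x * conj_nilpotent \<nu> 2 2 \<in> range emb_poly"
    (is "_ \<longleftrightarrow> ?R")
  proof
    assume "x \<in> cusp_lattice I \<nu>"
    then show ?R
      unfolding cusp_lattice_def mem_Collect_eq conj mat2_in_Gamma0_iff by (elim exE conjE) auto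
  next
    assume ?R
    then obtain a b c d where *: "1 + x * conj_nilpotent \<nu> 1 1 = emb_poly a"
      "x * conj_nilpotent \<nu> 1 2 = emb_poly b" "x * conj_nilpotent \<nu> 2 1 = emb_poly c" "c \<in> I"
      "1 + x * conj_nilpotent \<nu> 2 2 = emb_poly d"
      by (elim conjE imageE)
    with unit[OF *(1,2,3,5)] show "x \<in> cusp_lattice I \<nu>"
      unfolding cusp_lattice_def mem_Collect_eq conj mat2_in_Gamma0_iff by (intro exI conjI)
  qed
  then show ?thesis
    unfolding shift .
qed

lemma cramer_2:
  fixes a b c d m n :: "'r::comm_ring_1"
  assumes "m * a + n * c = 0" "m * b + n * d = 1"
  shows "n * (a * d - c * b) = a" "m * (a * d - c * b) = - c"
proof -
  have "n * (a * d - c * b) = a * (m * b + n * d) - b * (m * a + n * c)"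
    by (simp add: algebra_simps)
  then show "n * (a * d - c * b) = a"
    by (simp add: assms)
  have "m * (a * d - c * b) = d * (m * a + n * c) - c * (m * b + n * d)"
    by (simp add: algebra_simps)
  then show "m * (a * d - c * b) = - c"
    by (simp add: assms)
qed

lemma GL2_K_nilpotent_entries:
  fixes \<nu> :: "'a::field fls ^ 2 ^ 2"
  assumes "\<nu> \<in> GL2_K"
  shows "\<exists>i j. conj_nilpotent \<nu> i j \<noteq> 0" "conj_nilpotent \<nu> i j \<in> ratfun_field"
proof -
  let ?\<mu> = "matrix_inv \<nu>"
  have rat: "\<nu> $ i $ j \<in> ratfun_field" for i j
    using assms(1) by (simp add: GL2_K_def)
  have "?\<mu> ** \<nu> = mat 1"
    using assms(1) by (simp add: GL2_K_def matrix_inv_invertible)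
  then have l: "?\<mu> $ 1 $ 1 * \<nu> $ 1 $ 1 + ?\<mu> $ 1 $ 2 * \<nu> $ 2 $ 1 = 1"
    "?\<mu> $ 2 $ 1 * \<nu> $ 1 $ 1 + ?\<mu> $ 2 $ 2 * \<nu> $ 2 $ 1 = 0"
    "?\<mu> $ 2 $ 1 * \<nu> $ 1 $ 2 + ?\<mu> $ 2 $ 2 * \<nu> $ 2 $ 2 = 1"
    by (simp_all add: vec_eq_iff forall_2 matrix_matrix_mult_def sum_2 mat_def)
  have "\<exists>i. \<nu> $ i $ 1 \<noteq> 0" "\<exists>j. ?\<mu> $ 2 $ j \<noteq> 0"
  proof -
    show "\<exists>i. \<nu> $ i $ 1 \<noteq> 0"
      using l(1) by (rule contrapos_pp) simp
    show "\<exists>j. ?\<mu> $ 2 $ j \<noteq> 0"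
      using l(3) by (rule contrapos_pp) simp
  qed
  then show "\<exists>i j. conj_nilpotent \<nu> i j \<noteq> 0"
    unfolding conj_nilpotent_def by simp
  define D where "D = \<nu> $ 1 $ 1 * \<nu> $ 2 $ 2 - \<nu> $ 2 $ 1 * \<nu> $ 1 $ 2"
  have D: "?\<mu> $ 2 $ 2 * D = \<nu> $ 1 $ 1" "?\<mu> $ 2 $ 1 * D = - \<nu> $ 2 $ 1"
    unfolding D_def using cramer_2[OF l(2,3)] by simp_all
  have "D \<noteq> 0"
    using D l(1) by auto
  then have "?\<mu> $ 2 $ 2 = \<nu> $ 1 $ 1 / D" "?\<mu> $ 2 $ 1 = (0 - \<nu> $ 2 $ 1) / D"
    using D by (simp_all add: eq_divide_eq del: diff_0 minus_divide_left)
  moreover have "D \<in> ratfun_field" "0 \<in> ratfun_field"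
    using ratfun_field_emb_poly[of 0] unfolding D_def
    by (auto intro!: ratfun_field_diff ratfun_field_mult rat)
  ultimately have "?\<mu> $ 2 $ j \<in> ratfun_field" for j
    using exhaust_2[of j] by (auto intro!: ratfun_field_diff ratfun_field_divide rat simp del: diff_0)
  then show "conj_nilpotent \<nu> i j \<in> ratfun_field"
    unfolding conj_nilpotent_def by (intro ratfun_field_mult rat)
qed

lemma cusp_lattice_mono:
  assumes "I' \<subseteq> I"
  shows "cusp_lattice I' \<nu> \<subseteq> cusp_lattice I \<nu>"
  using assms unfolding cusp_lattice_def Gamma0_def by blast

context drinfeld_field
begin

text \<open>Discreteness comes from any one nonzero entry of \<open>\<nu> E \<nu>\<^sup>-\<^sup>1\<close>, which scales the lattice into the polynomials.\<close>

lemma is_lattice_cusp_lattice: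
  assumes \<nu>: "\<nu> \<in> GL2_K" and I: "ideal I fq_poly_ring"
  shows "is_lattice (cusp_lattice I \<nu>)"
proof -
  let ?\<alpha> = "conj_nilpotent \<nu>"
  have "invertible \<nu>"
    using \<nu> by (simp add: GL2_K_def)
  note iff = mem_cusp_lattice_iff[OF this, of _ I]
  obtain i j where ij: "?\<alpha> i j \<noteq> 0"
    using GL2_K_nilpotent_entries(1)[OF \<nu>] by blast
  have entry: "x * ?\<alpha> i j \<in> range emb_poly" if "x \<in> cusp_lattice I \<nu>" for x
    using that exhaust_2[of i] exhaust_2[of j] unfolding iff by auto
  have "finite {x \<in> cusp_lattice I \<nu>. av (\<iota> x) \<le> r}" for r
  proof (rule finite_subset)
    show "{x \<in> cusp_lattice I \<nu>. av (\<iota> x) \<le> r} \<subseteq>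
        (\<lambda>p. emb_poly p / ?\<alpha> i j) ` {p. av (emb p) \<le> r * av (\<iota> (?\<alpha> i j))}"
    proof
      fix x assume x: "x \<in> {x \<in> cusp_lattice I \<nu>. av (\<iota> x) \<le> r}"
      then obtain p where p: "x * ?\<alpha> i j = emb_poly p"
        using entry by blast
      then have "av (emb p) = av (\<iota> x) * av (\<iota> (?\<alpha> i j))"
        by (simp add: iota_simps av_mult flip: p)
      then have "av (emb p) \<le> r * av (\<iota> (?\<alpha> i j))"
        using x by (simp add: mult_right_mono)
      moreover have "x = emb_poly p / ?\<alpha> i j"
        using ij by (simp flip: p)
      ultimately show "x \<in> (\<lambda>p. emb_poly p / ?\<alpha> i j) ` {p. av (emb p) \<le> r * av (\<iota> (?\<alpha> i j))}"
        by blast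
    qed
  qed (simp add: finite_av_emb_le)
  moreover have range_diff: "v - w \<in> emb_poly ` I'"
    if "v \<in> emb_poly ` I'" "w \<in> emb_poly ` I'" "\<And>p r. p \<in> I' \<Longrightarrow> r \<in> I' \<Longrightarrow> p - r \<in> I'" for v w I'
    using that by (auto simp flip: emb_poly_diff)
  have "x - y \<in> cusp_lattice I \<nu>" if "x \<in> cusp_lattice I \<nu>" "y \<in> cusp_lattice I \<nu>" for x y
    using that unfolding iff left_diff_distrib
    by (auto intro!: range_diff ideal_diff[OF I])
  moreover have "0 \<in> emb_poly ` I"
    using ideal_0[OF I] by (intro image_eqI[of _ _ 0]) auto
  then have "0 \<in> cusp_lattice I \<nu>"
    unfolding iff using emb_poly_0 by (metis mult_zero_left rangeI)
  ultimately show ?thesis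
    by (simp add: is_lattice_def)
qed

text \<open>A common denominator of the entries of \<open>\<nu> E \<nu>\<^sup>-\<^sup>1\<close>, times an element of the ideal.\<close>

lemma cusp_lattice_contains_multiples:
  assumes \<nu>: "\<nu> \<in> GL2_K" and I: "ideal I fq_poly_ring" and N: "N \<in> I" "N \<noteq> 0"
  obtains y where "y \<noteq> 0" "\<And>p. emb_poly p * y \<in> cusp_lattice I \<nu>"
proof -
  let ?\<alpha> = "conj_nilpotent \<nu>"
  have "invertible \<nu>"
    using \<nu> by (simp add: GL2_K_def)
  note iff = mem_cusp_lattice_iff[OF this, of _ I]
  have rat: "?\<alpha> i j \<in> ratfun_field" for i j
    by (rule GL2_K_nilpotent_entries(2)[OF \<nu>])
  obtain g11 p11 where 1: "g11 \<noteq> 0" "emb_poly g11 * ?\<alpha> 1 1 = emb_poly p11"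
    using ratfun_field_denominator[OF rat] .
  obtain g12 p12 where 2: "g12 \<noteq> 0" "emb_poly g12 * ?\<alpha> 1 2 = emb_poly p12"
    using ratfun_field_denominator[OF rat] .
  obtain g21 p21 where 3: "g21 \<noteq> 0" "emb_poly g21 * ?\<alpha> 2 1 = emb_poly p21"
    using ratfun_field_denominator[OF rat] .
  obtain g22 p22 where 4: "g22 \<noteq> 0" "emb_poly g22 * ?\<alpha> 2 2 = emb_poly p22"
    using ratfun_field_denominator[OF rat] .
  define y where "y = emb_poly (g11 * g12 * g21 * g22 * N)"
  have "emb_poly p * y \<in> cusp_lattice I \<nu>" for p
  proof -
    have "emb_poly p * y * ?\<alpha> 1 1 = emb_poly (p * g12 * g21 * g22 * N) * (emb_poly g11 * ?\<alpha> 1 1)"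
      "emb_poly p * y * ?\<alpha> 1 2 = emb_poly (p * g11 * g21 * g22 * N) * (emb_poly g12 * ?\<alpha> 1 2)"
      "emb_poly p * y * ?\<alpha> 2 1 = emb_poly (p * g11 * g12 * g22 * N) * (emb_poly g21 * ?\<alpha> 2 1)"
      "emb_poly p * y * ?\<alpha> 2 2 = emb_poly (p * g11 * g12 * g21 * N) * (emb_poly g22 * ?\<alpha> 2 2)"
      by (simp_all add: y_def emb_poly_mult)
    then have "emb_poly p * y * ?\<alpha> 1 1 = emb_poly (p * g12 * g21 * g22 * N * p11)"
      "emb_poly p * y * ?\<alpha> 1 2 = emb_poly (p * g11 * g21 * g22 * N * p12)"
      "emb_poly p * y * ?\<alpha> 2 1 = emb_poly ((p * g11 * g12 * g22 * p21) * N)"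
      "emb_poly p * y * ?\<alpha> 2 2 = emb_poly (p * g11 * g12 * g21 * N * p22)"
      by (simp_all only: 1 2 3 4 emb_poly_mult ac_simps)
    then show ?thesis
      unfolding iff using ideal_mult[OF I N(1)] by (metis imageI rangeI)
  qed
  moreover have "y \<noteq> 0"
    using 1 2 3 4 N by (simp add: y_def)
  ultimately show thesis
    using that by blast
qed

section \<open>Changing the level, and decay at infinity\<close>

text \<open>
  For a smaller ideal the invariance conditions are weaker, but the expansions at the cusps have to
  be rewritten in terms of the parameters of smaller lattices.
\<close>

lemma cusp_forms_antimono:
  assumes I: "ideal I fq_poly_ring" and I': "ideal I' fq_poly_ring" "I' \<subseteq> I"
    and N: "N \<in> I'" "N \<noteq> 0" and \<phi>: "\<phi> \<in> cusp_forms \<iota> k m I"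
  shows "\<phi> \<in> cusp_forms \<iota> k m I'"
proof -
  have "\<exists>b. has_expansion \<iota> (cusp_lattice I' \<nu>) (slash \<iota> k m \<phi> \<nu>) b \<and> b 0 = 0"
    if \<nu>: "\<nu> \<in> GL2_K" for \<nu>
  proof -
    obtain a where a: "has_expansion \<iota> (cusp_lattice I \<nu>) (slash \<iota> k m \<phi> \<nu>) a" "a 0 = 0"
      using \<phi> \<nu> unfolding cusp_forms_def by blast
    obtain y where y: "y \<noteq> 0" "\<And>p. emb_poly p * y \<in> cusp_lattice I' \<nu>"
      using cusp_lattice_contains_multiples[OF \<nu> I'(1) N] by blast
    show ?thesis
      by (rule has_expansion_sublattice[OF is_lattice_cusp_lattice[OF \<nu> I]
            is_lattice_cusp_lattice[OF \<nu> I'(1)] cusp_lattice_mono[OF I'(2)] y a])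
  qed
  moreover have "Gamma0 I' \<subseteq> Gamma0 I"
    using I'(2) unfolding Gamma0_def by blast
  ultimately show ?thesis
    using \<phi> unfolding cusp_forms_def by blast
qed

lemma cusp_form_decay:
  assumes I: "ideal I fq_poly_ring" and N: "N \<in> I" "N \<noteq> 0" and \<phi>: "\<phi> \<in> cusp_forms \<iota> k m I"
  shows "\<exists>C R. 0 \<le> C \<and> 0 \<le> R \<and> (\<forall>z\<in>\<Omega>. im z > R \<longrightarrow> av (\<phi> z) \<le> C / im z ^ n)"
proof -
  have \<nu>: "mat 1 \<in> (GL2_K :: ('a fls ^ 2 ^ 2) set)"
  proof -
    have "invertible (mat 1 :: 'a fls ^ 2 ^ 2)"
      unfolding invertible_def by (rule exI[of _ "mat 1"]) simp
    then show ?thesis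
      using ratfun_field_emb_poly[of 0] ratfun_field_emb_poly[of 1] by (auto simp: GL2_K_def mat_def)
  qed
  obtain a where a: "has_expansion \<iota> (cusp_lattice I (mat 1)) (slash \<iota> k m \<phi> (mat 1)) a" "a 0 = 0"
    using \<phi> \<nu> unfolding cusp_forms_def by blast
  have "slash \<iota> k m \<phi> (mat 1) = \<phi>"
    by (rule ext) (simp add: slash_def moebius_def mat_def iota_simps det_2)
  moreover obtain y where "y \<noteq> 0" "\<And>p. emb_poly p * y \<in> cusp_lattice I (mat 1)"
    using cusp_lattice_contains_multiples[OF \<nu> I N] by blast
  ultimately show ?thesis
    using expansion_decay[OF is_lattice_cusp_lattice[OF \<nu> I]] a by metis
qed

section \<open>The slash operator\<close>

definition supported :: "('c \<Rightarrow> 'c) \<Rightarrow> bool" where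
  "supported f \<longleftrightarrow> (\<forall>z. z \<notin> \<Omega> \<longrightarrow> f z = 0)"

lemma not_in_Omega_iff: "z \<notin> \<Omega> \<longleftrightarrow> (\<exists>x. z = \<iota> x)"
  by (auto simp: upper_half_plane_def)

lemma slash_mat2:
  "slash \<iota> k m f (mat2 a b c d) z =
    f ((\<iota> a * z + \<iota> b) / (\<iota> c * z + \<iota> d)) * \<iota> (a * d - b * c) powi m * (\<iota> c * z + \<iota> d) powi (- k)"
  by (simp add: slash_def moebius_def det_2)

lemma supported_slash:
  assumes "supported f"
  shows "supported (slash \<iota> k m f (mat2 a b c d))"
  unfolding supported_def not_in_Omega_iff
proof (intro allI impI)
  fix z assume "\<exists>x. z = \<iota> x"
  then obtain x where "z = \<iota> x"
    by blast
  then have "(\<iota> a * z + \<iota> b) / (\<iota> c * z + \<iota> d) = \<iota> ((a * x + b) / (c * x + d))"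
    by (simp add: iota_simps)
  then have "f ((\<iota> a * z + \<iota> b) / (\<iota> c * z + \<iota> d)) = 0"
    using assms by (auto simp: supported_def not_in_Omega_iff)
  then show "slash \<iota> k m f (mat2 a b c d) z = 0"
    by (simp add: slash_mat2)
qed

lemma denominator_nonzero:
  assumes "z \<in> \<Omega>" "c \<noteq> 0 \<or> d \<noteq> 0"
  shows "\<iota> c * z + \<iota> d \<noteq> 0"
proof
  assume *: "\<iota> c * z + \<iota> d = 0"
  show False
  proof (cases "c = 0")
    case False
    from * have "\<iota> c * z = \<iota> (- d)"
      by (simp add: iota_simps eq_neg_iff_add_eq_0)
    with False have "z = \<iota> (- d) / \<iota> c"
      by (simp add: eq_divide_eq mult.commute)
    then have "z = \<iota> (- d / c)"
      by (simp only: iota_divide)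
    then show False
      using assms(1) not_in_Omega_iff by blast
  qed (use * assms(2) in auto)
qed

lemma slash_slash:
  assumes f: "supported f" and det: "a' * d' - b' * c' \<noteq> 0"
  shows "slash \<iota> k m (slash \<iota> k m f (mat2 a b c d)) (mat2 a' b' c' d') =
    slash \<iota> k m f (mat2 a b c d ** mat2 a' b' c' d')"
proof (rule ext)
  fix z
  show "slash \<iota> k m (slash \<iota> k m f (mat2 a b c d)) (mat2 a' b' c' d') z =
    slash \<iota> k m f (mat2 a b c d ** mat2 a' b' c' d') z"
  proof (cases "z \<in> \<Omega>")
    case False
    then show ?thesis
      using supported_slash[OF f] supported_slash[OF supported_slash[OF f]]
      by (simp add: mat2_mult supported_def)
  next
    case True
    define J where "J = \<iota> c' * z + \<iota> d'"
    define w where "w = (\<iota> a' * z + \<iota> b') / J"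
    have J: "J \<noteq> 0"
      unfolding J_def using det by (intro denominator_nonzero True) auto
    have num: "\<iota> (a * a' + b * c') * z + \<iota> (a * b' + b * d') = J * (\<iota> a * w + \<iota> b)"
      and den: "\<iota> (c * a' + d * c') * z + \<iota> (c * b' + d * d') = J * (\<iota> c * w + \<iota> d)"
      using J unfolding w_def by (simp_all add: field_simps iota_simps) (simp_all add: J_def algebra_simps)
    have detm: "\<iota> ((a * a' + b * c') * (c * b' + d * d') - (a * b' + b * d') * (c * a' + d * c')) =
        \<iota> (a * d - b * c) * \<iota> (a' * d' - b' * c')"
      unfolding iota_simps(3)[symmetric] by (simp add: algebra_simps)
    show ?thesis
      unfolding mat2_mult slash_mat2 num den detm
      using J by (simp add: w_def J_def power_int_mult_distrib mult.assoc mult.commute mult.left_commute)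
  qed
qed

lemma slash_one: "slash \<iota> k m f (mat2 1 0 0 1) = f"
  by (rule ext) (simp add: slash_mat2 iota_simps)

lemma slash_cmult: "slash \<iota> k m (\<lambda>z. c * f z) \<gamma> z = c * slash \<iota> k m f \<gamma> z"
  by (simp add: slash_def)

lemma slash_add: "slash \<iota> k m (\<lambda>z. f z + g z) \<gamma> z = slash \<iota> k m f \<gamma> z + slash \<iota> k m g \<gamma> z"
  by (simp add: slash_def algebra_simps)

lemma slash_sum: "slash \<iota> k m (\<lambda>z. \<Sum>i\<in>A. f i z) \<gamma> z = (\<Sum>i\<in>A. slash \<iota> k m (f i) \<gamma> z)"
  by (simp add: slash_def sum_distrib_right)

section \<open>Hecke operators\<close>

abbreviation emat :: "'a poly \<Rightarrow> 'a poly \<Rightarrow> 'a poly \<Rightarrow> 'a poly \<Rightarrow> 'a fls ^ 2 ^ 2" where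
  "emat a b c d \<equiv> mat2 (emb_poly a) (emb_poly b) (emb_poly c) (emb_poly d)"

lemma emat_mult:
  "emat a b c d ** emat a' b' c' d' =
    emat (a * a' + b * c') (a * b' + b * d') (c * a' + d * c') (c * b' + d * d')"
  by (simp add: mat2_mult emb_poly_simps)

lemma slash_emat:
  assumes "supported f" "a' * d' - b' * c' \<noteq> 0"
  shows "slash \<iota> k m (slash \<iota> k m f (emat a b c d)) (emat a' b' c' d') =
    slash \<iota> k m f (emat (a * a' + b * c') (a * b' + b * d') (c * a' + d * c') (c * b' + d * d'))"
proof -
  have "emb_poly a' * emb_poly d' - emb_poly b' * emb_poly c' \<noteq> 0"
    using assms(2) by (simp flip: emb_poly_mult emb_poly_diff)
  from slash_slash[OF assms(1) this] show ?thesis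
    by (simp only: emat_mult)
qed

text \<open>
  Invariance under the subgroup of determinant \<open>1\<close> for a principal ideal \<open>N\<close> contained in the level.
  This is weaker than invariance under the full congruence group, but \<open>N\<close> can be chosen prime to \<open>P\<close>.
\<close>

definition invariant :: "int \<Rightarrow> int \<Rightarrow> 'a poly \<Rightarrow> ('c \<Rightarrow> 'c) \<Rightarrow> bool" where
  "invariant k m N f \<longleftrightarrow>
    (\<forall>a b c d. a * d - b * c = 1 \<longrightarrow> N dvd c \<longrightarrow> slash \<iota> k m f (emat a b c d) = f)"

lemma invariant_slash_left:
  assumes f: "supported f" "invariant k m N f"
    and \<gamma>: "a * d - b * c = 1" "N dvd c" and M: "a' * d' - b' * c' \<noteq> 0"
  shows "slash \<iota> k m f (emat (a * a' + b * c') (a * b' + b * d') (c * a' + d * c') (c * b' + d * d')) =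
    slash \<iota> k m f (emat a' b' c' d')"
  using slash_emat[OF f(1) M, of k m a b c d] f(2) \<gamma> by (simp add: invariant_def)

lemma cusp_form_supported: "\<phi> \<in> cusp_forms \<iota> k m I \<Longrightarrow> supported \<phi>"
  by (simp add: cusp_forms_def supported_def)

lemma cusp_form_invariant:
  assumes \<phi>: "\<phi> \<in> cusp_forms \<iota> k m I" and I: "ideal I fq_poly_ring" and N: "N \<in> I"
  shows "invariant k m N \<phi>"
  unfolding invariant_def
proof (intro allI impI)
  fix a b c d assume "a * d - b * c = 1" "N dvd c"
  moreover from this have "c \<in> I"
    using ideal_mult[OF I N] by (metis dvd_def mult.commute)
  ultimately have "emat a b c d \<in> Gamma0 I"
    unfolding mat2_in_Gamma0_iff by (metis dvd_refl)
  with \<phi> show "slash \<iota> k m \<phi> (emat a b c d) = \<phi>"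
    by (simp add: cusp_forms_def)
qed

text \<open>\<open>V\<close> is the term by which \<open>T\<close> exceeds \<open>U\<close>, up to normalisation.\<close>

definition hecke_V :: "int \<Rightarrow> int \<Rightarrow> 'a poly \<Rightarrow> ('c \<Rightarrow> 'c) \<Rightarrow> 'c \<Rightarrow> 'c" where
  "hecke_V k m P f = slash \<iota> k m f (emat P 0 0 1)"

lemma hecke_T_eq: "hecke_T \<iota> k m P f z = emb P powi (k - m) * hecke_V k m P f z + hecke_U \<iota> k m P f z"
  by (simp add: hecke_T_def hecke_U_def hecke_V_def)

lemma hecke_U_cmult: "hecke_U \<iota> k m P (\<lambda>z. c * f z) z = c * hecke_U \<iota> k m P f z"
  by (simp add: hecke_U_def slash_cmult sum_distrib_left mult.left_commute)

lemma hecke_U_add: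
  "hecke_U \<iota> k m P (\<lambda>z. f z + g z) z = hecke_U \<iota> k m P f z + hecke_U \<iota> k m P g z"
  by (simp add: hecke_U_def slash_add sum.distrib distrib_left)

lemma supported_hecke_V: "supported f \<Longrightarrow> supported (hecke_V k m P f)"
  unfolding hecke_V_def by (rule supported_slash)

lemma supported_hecke_U: "supported f \<Longrightarrow> supported (hecke_U \<iota> k m P f)"
  using supported_slash[of f] by (simp add: supported_def hecke_U_def)

lemma supported_hecke_T: "supported f \<Longrightarrow> supported (hecke_T \<iota> k m P f)"
  using supported_hecke_V supported_hecke_U by (simp add: supported_def hecke_T_eq)

text \<open>The constant coefficient is free, so the cardinality is divisible by \<open>q\<close>.\<close>

lemma of_nat_card_degree_less:
  assumes "0 < d"
  shows "of_nat (card {Q :: 'a poly. Polynomial.degree Q < d}) = (0 :: 'c)"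
proof -
  let ?G = "{Q :: 'a poly. Polynomial.degree Q < d}"
  let ?H = "{Q :: 'a poly. Polynomial.degree Q < d \<and> Polynomial.coeff Q 0 = 0}"
  have "bij_betw (\<lambda>(a, Q). [:a:] + Q) (UNIV \<times> ?H) ?G"
  proof (rule bij_betwI[where g = "\<lambda>Q. (Polynomial.coeff Q 0, Q - [:Polynomial.coeff Q 0:])"])
    show "(\<lambda>(a, Q). [:a:] + Q) \<in> UNIV \<times> ?H \<rightarrow> ?G"
      using assms by (auto intro!: degree_add_less)
    show "(\<lambda>Q. (Polynomial.coeff Q 0, Q - [:Polynomial.coeff Q 0:])) \<in> ?G \<rightarrow> UNIV \<times> ?H"
      using assms by (auto intro!: degree_diff_less)
  qed auto
  then have "card ?G = CARD('a) * card ?H"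
    by (simp add: card_cartesian_product flip: bij_betw_same_card)
  moreover have "of_nat CARD('a) = (0 :: 'c)"
  proof -
    have "of_nat CARD('a) = (0 :: 'a)"
    proof -
      have "(\<Sum>x\<in>UNIV. x + 1) = (\<Sum>x\<in>UNIV. x :: 'a)"
        by (rule sum.reindex_bij_witness[of _ "\<lambda>x. x - 1" "\<lambda>x. x + 1"]) auto
      then show ?thesis
        by (simp add: sum.distrib)
    qed
    moreover have "of_nat n = \<iota> (fls_const (of_nat n))" for n
      by (induction n) (simp_all add: iota_simps flip: fls_plus_const)
    ultimately show ?thesis
      by simp
  qed
  ultimately show ?thesis
    by simp
qed

lemma invariant_translation:
  assumes "invariant k m N f"
  shows "f (z + emb Q) = f z"
proof -
  have "slash \<iota> k m f (emat 1 Q 0 1) z = f z"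
    using assms unfolding invariant_def by (metis diff_zero dvd_0_right mult.right_neutral mult_zero_right)
  then show ?thesis
    by (simp add: slash_mat2 iota_simps)
qed

text \<open>
  All \<open>q\<^sup>d\<close> summands of \<open>U (V f)\<close> are the same multiple of \<open>f\<close>, so the sum vanishes in characteristic \<open>p\<close>.
\<close>

lemma hecke_U_hecke_V:
  assumes f: "supported f" "invariant k m N f" and P: "Polynomial.degree P > 0"
  shows "hecke_U \<iota> k m P (hecke_V k m P f) = (\<lambda>_. 0)"
proof (rule ext)
  fix z
  have P0: "emb P \<noteq> 0"
    using P by auto
  have "slash \<iota> k m (hecke_V k m P f) (emat 1 Q 0 P) z =
      f z * \<iota> (emb_poly P * emb_poly P) powi m * emb P powi (- k)" for Q
  proof -
    have "slash \<iota> k m (hecke_V k m P f) (emat 1 Q 0 P) z = slash \<iota> k m f (emat P (P * Q) 0 P) z"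
      unfolding hecke_V_def using P by (subst slash_emat[OF f(1)]) auto
    also have "(emb P * z + emb (P * Q)) / emb P = z + emb Q"
      using P0 by (simp add: emb_poly_simps iota_simps field_simps)
    then have "slash \<iota> k m f (emat P (P * Q) 0 P) z =
        f (z + emb Q) * \<iota> (emb_poly P * emb_poly P) powi m * emb P powi (- k)"
      by (simp add: slash_mat2)
    finally show ?thesis
      by (simp add: invariant_translation[OF f(2)])
  qed
  then show "hecke_U \<iota> k m P (hecke_V k m P f) z = 0"
    using of_nat_card_degree_less[OF P] by (simp add: hecke_U_def)
qed

subsection \<open>The operator T preserves invariance\<close>

text \<open>
  The summands of \<open>T f\<close> are indexed by the points of the projective line over \<open>O / P\<close>: \<open>None\<close> stands
  for \<open>(0 : 1)\<close> and \<open>Some Q\<close> for \<open>(1 : Q)\<close>.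
\<close>

primrec row1 :: "'a poly option \<Rightarrow> 'a poly" where
  "row1 None = 0"
| "row1 (Some Q) = 1"

primrec row2 :: "'a poly option \<Rightarrow> 'a poly" where
  "row2 None = 1"
| "row2 (Some Q) = Q"

definition proj_line :: "'a poly \<Rightarrow> 'a poly option set" where
  "proj_line P = insert None (Some ` {Q. Polynomial.degree Q < Polynomial.degree P})"

text \<open>For \<open>(x, y)\<close> nonzero modulo \<open>P\<close>, this says that \<open>(x : y)\<close> is the point \<open>r\<close>.\<close>

definition same_point :: "'a poly \<Rightarrow> 'a poly \<Rightarrow> 'a poly \<Rightarrow> 'a poly option \<Rightarrow> bool" where
  "same_point P x y r \<longleftrightarrow> P dvd x * row2 r - y * row1 r"

primrec hecke_term :: "int \<Rightarrow> int \<Rightarrow> 'a poly \<Rightarrow> ('c \<Rightarrow> 'c) \<Rightarrow> 'a poly option \<Rightarrow> 'c \<Rightarrow> 'c" where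
  "hecke_term k m P f None = slash \<iota> k m f (emat P 0 0 1)"
| "hecke_term k m P f (Some Q) = slash \<iota> k m f (emat 1 Q 0 P)"

lemma finite_proj_line: "finite (proj_line P)"
  by (simp add: proj_line_def finite_degree_less)

lemma hecke_T_sum:
  "hecke_T \<iota> k m P f z = emb P powi (k - m) * (\<Sum>r\<in>proj_line P. hecke_term k m P f r z)"
  unfolding hecke_T_def proj_line_def
  by (subst sum.insert) (auto simp: finite_degree_less sum.reindex distrib_left)

lemma irreducible_degree_pos: "Factorial_Ring.irreducible P \<Longrightarrow> 0 < Polynomial.degree P"
  for P :: "'a poly"
  by (metis Factorial_Ring.irreducible_def is_unit_iff_degree neq0_conv)

lemma degree_less_dvd_eq_0:
  fixes P :: "'a poly"
  assumes "P dvd Q" "Polynomial.degree Q < Polynomial.degree P"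
  shows "Q = 0"
  using assms dvd_imp_degree_le[of P Q] by (cases "Q = 0") auto

text \<open>Multiplication by \<open>x\<close> is injective on the finite set of residues, hence surjective.\<close>

lemma proj_line_exists:
  assumes P: "Factorial_Ring.irreducible P"
  shows "\<exists>r\<in>proj_line P. same_point P x y r"
proof (cases "P dvd x")
  case True
  then show ?thesis
    by (intro bexI[of _ None]) (auto simp: same_point_def proj_line_def)
next
  case False
  let ?G = "{Q. Polynomial.degree Q < Polynomial.degree P}"
  have prime: "prime_elem P"
    by (rule field_poly_irreducible_imp_prime[OF P])
  have deg: "0 < Polynomial.degree P"
    by (rule irreducible_degree_pos[OF P])
  have mod_G: "Q mod P \<in> ?G" for Q
    using degree_mod_less[of P Q] deg by force
  have "inj_on (\<lambda>Q. Q * x mod P) ?G"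
  proof (rule inj_onI)
    fix Q R assume QR: "Q \<in> ?G" "R \<in> ?G" "Q * x mod P = R * x mod P"
    then have "P dvd (Q - R) * x"
      by (simp add: mod_eq_dvd_iff left_diff_distrib)
    then have "P dvd Q - R"
      using prime_elem_dvd_multD[OF prime] False by blast
    then have "Q - R = 0"
      using QR by (intro degree_less_dvd_eq_0) (auto intro: degree_diff_less)
    then show "Q = R"
      by simp
  qed
  then have "(\<lambda>Q. Q * x mod P) ` ?G = ?G"
    using mod_G by (intro endo_inj_surj finite_degree_less) auto
  then obtain Q where Q: "Q \<in> ?G" "y mod P = Q * x mod P"
    using mod_G[of y] by (metis (no_types, lifting) imageE)
  then have "P dvd x * Q - y"
    by (metis mod_eq_dvd_iff mult.commute)
  with Q(1) show ?thesis
    by (intro bexI[of _ "Some Q"]) (auto simp: same_point_def proj_line_def)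
qed

lemma same_point_trans:
  assumes "same_point P x y s" "same_point P x' y' s"
  shows "P dvd x * y' - y * x'"
proof (cases s)
  case None
  then show ?thesis
    using assms by (auto simp: same_point_def)
next
  case (Some Q)
  have "x * y' - y * x' = x' * (x * Q - y) - x * (x' * Q - y')"
    by (simp add: algebra_simps)
  with assms Some show ?thesis
    by (simp add: same_point_def)
qed

text \<open>The representatives are distinct points modulo \<open>P\<close>, as residues have degree less than that of \<open>P\<close>.\<close>

lemma proj_line_unique:
  assumes "r \<in> proj_line P" "r' \<in> proj_line P" "\<not> is_unit P"
    and "P dvd row1 r * row2 r' - row2 r * row1 r'"
  shows "r = r'"
proof (cases r; cases r')
  fix Q Q' assume r: "r = Some Q" "r' = Some Q'"
  then have "Polynomial.degree (Q' - Q) < Polynomial.degree P" "P dvd Q' - Q"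
    using assms by (auto simp: proj_line_def intro!: degree_diff_less)
  then have "Q' - Q = 0"
    by (intro degree_less_dvd_eq_0)
  with r show ?thesis
    by simp
qed (use assms in \<open>auto simp: dvd_minus_iff\<close>)

text \<open>
  Right multiplication by \<open>\<gamma>\<close> moves the representative of a point to that of the image point, up to
  an element of the group on the left. Two of the four cases divide the lower left entry by \<open>P\<close>; the
  quotient is still divisible by \<open>N\<close> because \<open>N\<close> is prime to \<open>P\<close>.
\<close>

lemma slash_hecke_term:
  assumes f: "supported f" "invariant k m N f" and P: "Factorial_Ring.irreducible P" "\<not> P dvd N"
    and \<gamma>: "a * d - b * c = 1" "N dvd c"
    and r: "same_point P (row1 r * a + row2 r * c) (row1 r * b + row2 r * d) r'"
  shows "slash \<iota> k m (hecke_term k m P f r) (emat a b c d) = hecke_term k m P f r'"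
proof -
  have P0: "P \<noteq> 0"
    using P by auto
  have \<gamma>0: "a * d - b * c \<noteq> 0"
    using \<gamma> by simp
  note left = slash_emat[OF f(1) \<gamma>0, of k m]
  note inv = invariant_slash_left[OF f]
  show ?thesis
  proof (cases r; cases r')
    fix Q Q' assume rr: "r = Some Q" "r' = Some Q'"
    define x where "x = a + Q * c"
    obtain t where t: "x * Q' - (b + Q * d) = P * t"
      using r by (auto simp: rr same_point_def x_def elim: dvdE)
    have bd: "b + Q * d = x * Q' + (- t) * P"
      using t by (simp add: algebra_simps)
    have det: "x * (d - c * Q') - (- t) * (P * c) = 1"
    proof -
      have "x * (d - c * Q') - (- t) * (P * c) = x * d - c * (x * Q' + (- t) * P)"
        by (simp add: algebra_simps)
      also have "\<dots> = 1"
        unfolding bd[symmetric] \<gamma>(1)[symmetric] by (simp add: x_def algebra_simps)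
      finally show ?thesis .
    qed
    have "P * d = P * c * Q' + (d - c * Q') * P"
      by (simp add: algebra_simps)
    then show ?thesis
      using left[of 1 Q 0 P] inv[OF det, of 1 P Q' 0] \<gamma>(2) P0 bd by (simp add: rr x_def)
  next
    fix Q assume rr: "r = Some Q" "r' = None"
    obtain t where t: "a + Q * c = P * t"
      using r by (auto simp: rr same_point_def elim: dvdE)
    have det: "t * (P * d) - (b + Q * d) * c = 1"
    proof -
      have "t * (P * d) - (b + Q * d) * c = (a + Q * c) * d - (b + Q * d) * c"
        by (simp add: t algebra_simps)
      also have "\<dots> = 1"
        unfolding \<gamma>(1)[symmetric] by (simp add: algebra_simps)
      finally show ?thesis .
    qed
    show ?thesis
      using left[of 1 Q 0 P] inv[OF det \<gamma>(2), of P 1 0 0] P0 by (simp add: rr t mult.commute)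
  next
    fix Q' assume rr: "r = None" "r' = Some Q'"
    obtain t where t: "c * Q' - d = P * t"
      using r by (auto simp: rr same_point_def elim: dvdE)
    have d: "d = c * Q' + (- t) * P"
      using t by (simp add: algebra_simps)
    have det: "P * a * (- t) - (b - Q' * a) * c = 1"
    proof -
      have "P * a * (- t) - (b - Q' * a) * c = a * (c * Q' + (- t) * P) - b * c"
        by (simp add: algebra_simps)
      then show ?thesis
        using \<gamma>(1) by (simp only: d[symmetric])
    qed
    have "P * b = P * a * Q' + (b - Q' * a) * P"
      by (simp add: algebra_simps)
    then show ?thesis
      using left[of P 0 0 1] inv[OF det \<gamma>(2), of 1 P Q' 0] P0 d by (simp add: rr)
  next
    assume rr: "r = None" "r' = None"
    obtain t where t: "c = P * t"
      using r by (auto simp: rr same_point_def elim: dvdE)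
    obtain u where u: "P * t = N * u"
      using \<gamma>(2) by (auto simp: t elim: dvdE)
    then have "P dvd u"
      using prime_elem_dvd_multD[OF field_poly_irreducible_imp_prime[OF P(1)], of N u] P(2)
      by (metis dvd_triv_left)
    then obtain v where "u = P * v"
      by (auto elim: dvdE)
    with u P0 have N: "N dvd t"
      by (simp add: mult.left_commute)
    have det: "a * d - P * b * t = 1"
      using \<gamma>(1) by (simp add: t algebra_simps)
    show ?thesis
      using left[of P 0 0 1] inv[OF det N, of P 1 0 0] P0 by (simp add: rr t mult.commute)
  qed
qed

text \<open>Since \<open>\<gamma>\<close> has determinant \<open>1\<close>, it permutes the points of the projective line, and with them the summands.\<close>

lemma invariant_hecke_T:
  assumes f: "supported f" "invariant k m N f" and P: "Factorial_Ring.irreducible P" "\<not> P dvd N"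
  shows "invariant k m N (hecke_T \<iota> k m P f)"
  unfolding invariant_def
proof (intro allI impI)
  fix a b c d assume \<gamma>: "a * d - b * c = 1" "N dvd c"
  define x where "x r = row1 r * a + row2 r * c" for r
  define y where "y r = row1 r * b + row2 r * d" for r
  define \<sigma> where "\<sigma> r = (SOME s. s \<in> proj_line P \<and> same_point P (x r) (y r) s)" for r
  have \<sigma>: "\<sigma> r \<in> proj_line P" "same_point P (x r) (y r) (\<sigma> r)" for r
    using someI_ex[OF proj_line_exists[OF P(1), of "x r" "y r", unfolded Bex_def]]
    by (simp_all add: \<sigma>_def)
  have nu: "\<not> is_unit P"
    using P(1) by (simp add: Factorial_Ring.irreducible_def)
  have "inj_on \<sigma> (proj_line P)"
  proof (rule inj_onI)
    fix r r' assume r: "r \<in> proj_line P" "r' \<in> proj_line P" "\<sigma> r = \<sigma> r'"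
    (* The determinant of two rows is multiplied by that of the matrix. *)
    have "x r * y r' - y r * x r' = (a * d - b * c) * (row1 r * row2 r' - row2 r * row1 r')"
      by (simp add: x_def y_def algebra_simps)
    then have "P dvd row1 r * row2 r' - row2 r * row1 r'"
      using same_point_trans[OF \<sigma>(2) \<sigma>(2)[of r', folded r(3)]] by (simp add: \<gamma>)
    then show "r = r'"
      by (rule proj_line_unique[OF r(1,2) nu])
  qed
  then have bij: "bij_betw \<sigma> (proj_line P) (proj_line P)"
    using \<sigma>(1) endo_inj_surj[OF finite_proj_line, of \<sigma> P] by (auto simp: bij_betw_def)
  show "slash \<iota> k m (hecke_T \<iota> k m P f) (emat a b c d) = hecke_T \<iota> k m P f"
  proof (rule ext)
    fix z
    have "hecke_T \<iota> k m P f =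
        (\<lambda>z. emb P powi (k - m) * (\<Sum>r\<in>proj_line P. hecke_term k m P f r z))"
      by (rule ext) (rule hecke_T_sum)
    then have "slash \<iota> k m (hecke_T \<iota> k m P f) (emat a b c d) z =
        emb P powi (k - m) * (\<Sum>r\<in>proj_line P. slash \<iota> k m (hecke_term k m P f r) (emat a b c d) z)"
      by (simp add: slash_cmult slash_sum)
    also have "\<dots> = emb P powi (k - m) * (\<Sum>r\<in>proj_line P. hecke_term k m P f (\<sigma> r) z)"
      using slash_hecke_term[OF f P \<gamma> \<sigma>(2)[unfolded x_def y_def]] by simp
    also have "\<dots> = hecke_T \<iota> k m P f z"
      unfolding hecke_T_sum sum.reindex_bij_betw[OF bij, of "\<lambda>r. hecke_term k m P f r z"] ..
    finally show "slash \<iota> k m (hecke_T \<iota> k m P f) (emat a b c d) z = hecke_T \<iota> k m P f z" .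
  qed
qed

section \<open>Invariance under a dense group and decay\<close>

text \<open>
  Unlike an expansion in the parameter of a cusp, this property passes from \<open>\<phi>\<close> to \<open>T \<phi>\<close> at once: no
  lattice is involved in it.
\<close>

definition decays :: "('c \<Rightarrow> 'c) \<Rightarrow> bool" where
  "decays f \<longleftrightarrow> (\<forall>n. \<exists>C R. 0 \<le> C \<and> 0 \<le> R \<and> (\<forall>z\<in>\<Omega>. im z > R \<longrightarrow> av (f z) \<le> C / im z ^ n))"

lemma decays_add:
  assumes "decays f" "decays g"
  shows "decays (\<lambda>z. f z + g z)"
  unfolding decays_def
proof
  fix n
  obtain C R where f: "0 \<le> C" "0 \<le> R" "\<And>z. z \<in> \<Omega> \<Longrightarrow> im z > R \<Longrightarrow> av (f z) \<le> C / im z ^ n"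
    using assms(1) unfolding decays_def by meson
  obtain D S where g: "0 \<le> D" "0 \<le> S" "\<And>z. z \<in> \<Omega> \<Longrightarrow> im z > S \<Longrightarrow> av (g z) \<le> D / im z ^ n"
    using assms(2) unfolding decays_def by meson
  have "av (f z + g z) \<le> (C + D) / im z ^ n" if z: "z \<in> \<Omega>" "im z > max R S" for z
  proof -
    have "av (f z + g z) \<le> max (av (f z)) (av (g z))"
      by (rule av_add_le_max)
    also have "\<dots> \<le> av (f z) + av (g z)"
      by (simp add: max_def)
    also have "\<dots> \<le> C / im z ^ n + D / im z ^ n"
      using f(3)[of z] g(3)[of z] z by auto
    finally show ?thesis
      by (simp add: add_divide_distrib)
  qed
  then show "\<exists>C R. 0 \<le> C \<and> 0 \<le> R \<and> (\<forall>z\<in>\<Omega>. im z > R \<longrightarrow> av (f z + g z) \<le> C / im z ^ n)"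
    using f g by (intro exI[of _ "C + D"] exI[of _ "max R S"]) auto
qed

lemma decays_cmult:
  assumes "decays f"
  shows "decays (\<lambda>z. c * f z)"
  unfolding decays_def
proof
  fix n
  obtain C R where f: "0 \<le> C" "0 \<le> R" "\<And>z. z \<in> \<Omega> \<Longrightarrow> im z > R \<Longrightarrow> av (f z) \<le> C / im z ^ n"
    using assms unfolding decays_def by meson
  have "av (c * f z) \<le> (av c * C) / im z ^ n" if "z \<in> \<Omega>" "im z > R" for z
    using mult_left_mono[OF f(3)[OF that], of "av c"] by (simp add: av_mult)
  then show "\<exists>C R. 0 \<le> C \<and> 0 \<le> R \<and> (\<forall>z\<in>\<Omega>. im z > R \<longrightarrow> av (c * f z) \<le> C / im z ^ n)"
    using f by (intro exI[of _ "av c * C"] exI[of _ R]) auto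
qed

lemma decays_sum:
  assumes "finite A" "\<And>i. i \<in> A \<Longrightarrow> decays (f i)"
  shows "decays (\<lambda>z. \<Sum>i\<in>A. f i z)"
  using assms
proof (induction A rule: finite_induct)
  case empty
  have "decays (\<lambda>_. 0)"
    unfolding decays_def by (auto intro!: exI[of _ 0])
  then show ?case
    by simp
qed (simp add: decays_add)

lemma decays_slash:
  assumes f: "decays f" and ad: "a \<noteq> 0" "d \<noteq> 0"
  shows "decays (slash \<iota> k m f (mat2 a b 0 d))"
  unfolding decays_def
proof
  fix n
  obtain C R where f: "0 \<le> C" "0 \<le> R" "\<And>z. z \<in> \<Omega> \<Longrightarrow> im z > R \<Longrightarrow> av (f z) \<le> C / im z ^ n"
    using f unfolding decays_def by meson
  define r where "r = av (\<iota> (a / d))"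
  define s where "s = \<iota> (a * d) powi m * \<iota> d powi (- k)"
  have r: "0 < r"
    using ad by (simp add: r_def)
  have "av (slash \<iota> k m f (mat2 a b 0 d) z) \<le> (C / r ^ n * av s) / im z ^ n"
    if z: "z \<in> \<Omega>" "im z > R / r" for z
  proof -
    define w where "w = \<iota> (a / d) * z + \<iota> (b / d)"
    have "r * im z \<le> im w"
      unfolding w_def r_def using ad by (intro im_affine) auto
    moreover have "R < r * im z"
      using z(2) r by (simp add: field_simps)
    ultimately have w: "R < im w" "0 < r * im z" "r * im z \<le> im w"
      using f(2) by linarith+
    then have "w \<in> \<Omega>"
      using f(2) im_pos_iff[of w] by linarith
    then have "av (f w) \<le> C / im w ^ n"
      using f(3) w(1) by blast
    also have "\<dots> \<le> C / (r * im z) ^ n"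
    proof (rule divide_left_mono)
      show "(r * im z) ^ n \<le> im w ^ n"
        using w by (intro power_mono) linarith+
      show "0 < im w ^ n * (r * im z) ^ n"
        using w by (intro mult_pos_pos[of "im w ^ n"] zero_less_power) linarith+
    qed (use f in auto)
    finally have "av (f w) * av s \<le> C / (r * im z) ^ n * av s"
      by (rule mult_right_mono) simp
    moreover have "slash \<iota> k m f (mat2 a b 0 d) z = f w * s"
      by (simp add: slash_mat2 w_def s_def iota_simps add_divide_distrib mult.assoc)
    ultimately show ?thesis
      by (simp add: av_mult power_mult_distrib)
  qed
  then show "\<exists>C R. 0 \<le> C \<and> 0 \<le> R \<and>
      (\<forall>z\<in>\<Omega>. im z > R \<longrightarrow> av (slash \<iota> k m f (mat2 a b 0 d) z) \<le> C / im z ^ n)"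
    using f r by (intro exI[of _ "C / r ^ n * av s"] exI[of _ "R / r"]) auto
qed

lemma decays_hecke_T:
  assumes "decays f" "P \<noteq> 0"
  shows "decays (hecke_T \<iota> k m P f)"
  using assms unfolding hecke_T_def sum_distrib_left
  by (intro decays_add decays_cmult decays_sum finite_degree_less)
    (simp_all add: decays_slash[where b = 0] decays_slash)

text \<open>
  For \<open>w = (a z + b) / (c z + d)\<close> and \<open>x\<close> in \<open>K\<^sub>\<infinity>\<close>, write \<open>w - x = (A z + B) / (c z + d)\<close>. Then \<open>A d - B c = 1\<close>,
  that is, \<open>A (c z + d) - c (A z + B) = 1\<close>; hence \<open>A (c z + d)\<close> has absolute value at least \<open>1\<close>, or
  \<open>c (A z + B)\<close> has absolute value \<open>1\<close>.
\<close>

lemma im_moebius_ge: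
  assumes det: "a * d - b * c = 1" and z: "z \<in> \<Omega>"
  shows "im z / av (\<iota> c * z + \<iota> d) ^ 2 \<le> im ((\<iota> a * z + \<iota> b) / (\<iota> c * z + \<iota> d))"
proof (rule im_geI)
  fix x
  define J where "J = \<iota> c * z + \<iota> d"
  have J: "J \<noteq> 0"
    unfolding J_def using det by (intro denominator_nonzero z) auto
  define A where "A = a - x * c"
  define B where "B = b - x * d"
  define L where "L = \<iota> A * z + \<iota> B"
  have lin: "av (\<iota> u) * im z \<le> av (\<iota> u * z + \<iota> v)" for u v
  proof (cases "u = 0")
    case False
    then have "\<iota> u * z + \<iota> v = \<iota> u * (z - \<iota> (- v / u))"
      by (simp add: iota_simps field_simps)
    then show ?thesis
      by (simp only: av_mult) (simp add: im_le mult_left_mono)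
  qed simp
  have "A * d - c * B = 1"
    using det by (simp add: A_def B_def algebra_simps)
  then have "\<iota> A * \<iota> d - \<iota> c * \<iota> B = 1"
    by (simp flip: iota_hom(3) iota_diff add: iota_hom(1))
  then have key: "\<iota> A * J - \<iota> c * L = 1"
    by (simp add: J_def L_def algebra_simps)
  have "im z / av J \<le> av L"
  proof (cases "av (\<iota> A * J) < 1")
    case True
    have "av (1 :: 'c) \<le> max (av (\<iota> A * J)) (av (\<iota> c * L))"
      using av_diff_le_max[of "\<iota> A * J" "\<iota> c * L"] by (simp only: key)
    then have "1 \<le> av (\<iota> c) * av L"
      using True by (auto simp: av_mult)
    then have "im z \<le> (av (\<iota> c) * im z) * av L"
      using mult_left_mono[of 1 "av (\<iota> c) * av L" "im z"] by (simp add: infdist_nonneg mult_ac)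
    also have "\<dots> \<le> av J * av L"
      unfolding J_def by (intro mult_right_mono lin) auto
    finally show ?thesis
      using J by (simp add: divide_le_eq mult.commute)
  next
    case False
    then have "1 \<le> av (\<iota> A) * av J"
      by (simp add: av_mult)
    then have "im z \<le> (av (\<iota> A) * im z) * av J"
      using mult_left_mono[of 1 "av (\<iota> A) * av J" "im z"] by (simp add: infdist_nonneg mult_ac)
    also have "\<dots> \<le> av L * av J"
      unfolding L_def by (intro mult_right_mono lin) auto
    finally show ?thesis
      using J by (simp add: divide_le_eq)
  qed
  then have "im z / av J / av J \<le> av L / av J"
    by (rule divide_right_mono) simp
  moreover have "(\<iota> a * z + \<iota> b) / J - \<iota> x = L / J"
    using J by (simp add: L_def A_def B_def iota_simps field_simps) (simp add: J_def algebra_simps)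
  ultimately show "im z / av (\<iota> c * z + \<iota> d) ^ 2 \<le> av ((\<iota> a * z + \<iota> b) / (\<iota> c * z + \<iota> d) - \<iota> x)"
    by (simp add: av_divide power2_eq_square flip: J_def)
qed

text \<open>
  A matrix with a tiny lower row moves \<open>z\<close> far up. The automorphy factor only costs a fixed power of
  the entries of that row, which the decay of \<open>f\<close> overcomes.
\<close>

lemma zero_if_decays_and_invariant:
  assumes f: "decays f" "supported f"
    and inv: "\<And>e. 0 < e \<Longrightarrow> \<exists>a b c d. a * d - b * c = 1 \<and> av (\<iota> c) \<le> e \<and> av (\<iota> d) \<le> e \<and>
      slash \<iota> k m f (mat2 a b c d) = f"
  shows "f = (\<lambda>_. 0)"
proof (rule ext)
  fix z
  show "f z = 0"
  proof (cases "z \<in> \<Omega>")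
    case False
    then show ?thesis
      using f(2) by (simp add: supported_def)
  next
    case z: True
    define t where "t = im z"
    have t: "0 < t"
      using z by (simp add: t_def im_pos_iff)
    (* The exponent of decay: 2 n exceeds k, so that decay beats the automorphy factor. *)
    define n where "n = nat (\<bar>k\<bar> + 1)"
    have n: "2 * int n - k \<ge> 1"
      by (simp add: n_def)
    obtain C R where C: "0 \<le> C" "0 \<le> R" "\<And>z. z \<in> \<Omega> \<Longrightarrow> im z > R \<Longrightarrow> av (f z) \<le> C / im z ^ n"
      using f(1) unfolding decays_def by meson
    have bound: "av (f z) \<le> C / t ^ n * e" if e: "0 < e" "e \<le> 1" "e * (R + 1) \<le> t" for e
    proof -
      (* Entries of size e' keep c z + d below e. *)
      define e' where "e' = e / (1 + av z)"
      have e': "0 < e'" "e' * (1 + av z) = e"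
        using e(1) by (auto simp: e'_def add_pos_nonneg field_simps add_nonneg_eq_0_iff)
      obtain a b c d where g: "a * d - b * c = 1" "av (\<iota> c) \<le> e'" "av (\<iota> d) \<le> e'"
        "slash \<iota> k m f (mat2 a b c d) = f"
        using inv[OF e'(1)] by blast
      define J where "J = \<iota> c * z + \<iota> d"
      define w where "w = (\<iota> a * z + \<iota> b) / J"
      have J0: "0 < av J"
      proof -
        have "c \<noteq> 0 \<or> d \<noteq> 0"
          using g(1) by auto
        from denominator_nonzero[OF z this] show ?thesis
          unfolding J_def by simp
      qed
      have "av J \<le> max (av (\<iota> c * z)) (av (\<iota> d))"
        unfolding J_def by (rule av_add_le_max)
      also have "\<dots> \<le> av (\<iota> c) * av z + av (\<iota> d)"
        by (simp add: av_mult)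
      also have "\<dots> \<le> e' * av z + e'"
        using g by (intro add_mono mult_right_mono) auto
      finally have Je: "av J \<le> e"
        using e' by (simp add: algebra_simps)
      have w_im: "t / av J ^ 2 \<le> im w"
        unfolding t_def w_def J_def by (rule im_moebius_ge[OF g(1) z])
      have "av J ^ 2 \<le> e"
        using Je e J0 power_mono[of "av J" e 2] mult_left_le[of e e]
        by (simp add: power2_eq_square) (meson mult_mono' order_trans zero_le_dist less_imp_le)
      then have "(R + 1) * av J ^ 2 \<le> e * (R + 1)"
        using C(2) by (simp add: mult_left_mono mult.commute)
      then have "R + 1 \<le> t / av J ^ 2"
        using e(3) J0 by (simp add: le_divide_eq)
      then have "R < im w"
        using w_im by linarith
      moreover from this have "w \<in> \<Omega>"
        using C(2) im_pos_iff[of w] by linarith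
      ultimately have "av (f w) \<le> C / im w ^ n"
        using C(3) by blast
      also have "\<dots> \<le> C / (t / av J ^ 2) ^ n"
        using w_im C(1) t J0 \<open>R < im w\<close> C(2)
        by (intro divide_left_mono power_mono mult_pos_pos zero_less_power divide_pos_pos) auto
      also have "\<dots> = C / t ^ n * av J ^ (2 * n)"
        by (simp add: power_divide power_mult)
      finally have fw: "av (f w) \<le> C / t ^ n * av J ^ (2 * n)" .
      have "f z = f w * J powi (- k)"
        using fun_cong[OF g(4), of z] by (simp add: slash_mat2 g(1) iota_simps w_def J_def)
      then have "av (f z) = av (f w) * av J powi (- k)"
        by (simp add: av_mult av_powi)
      also have "\<dots> \<le> C / t ^ n * av J ^ (2 * n) * av J powi (- k)"
        using fw by (intro mult_right_mono) auto
      also have "\<dots> = C / t ^ n * av J powi (2 * int n - k)"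
      proof -
        have "av J ^ (2 * n) * av J powi (- k) = av J powi (int (2 * n)) * av J powi (- k)"
          by (simp only: power_int_of_nat)
        also have "\<dots> = av J powi (2 * int n - k)"
          using J0 by (subst power_int_add[symmetric]) auto
        finally show ?thesis
          by simp
      qed
      also have "\<dots> \<le> C / t ^ n * e"
      proof (rule mult_left_mono)
        have "av J powi (2 * int n - k) \<le> av J powi 1"
          using J0 Je e n by (intro power_int_decreasing) auto
        then show "av J powi (2 * int n - k) \<le> e"
          using Je by simp
      qed (use C t in auto)
      finally show ?thesis .
    qed
    have "av (f z) \<le> 0"
    proof (rule field_le_epsilon)
      fix r :: real assume r: "0 < r"
      define D where "D = C / t ^ n"
      have D: "0 \<le> D"
        using C t by (simp add: D_def)
      define e where "e = min (min 1 (t / (R + 1))) (r / (D + 1))"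
      have e: "0 < e" "e \<le> 1" "e \<le> t / (R + 1)" "e \<le> r / (D + 1)"
        using t C(2) D r by (auto simp: e_def)
      have "e * (R + 1) \<le> t"
        using e(3) C(2) by (simp add: le_divide_eq)
      then have "av (f z) \<le> D * e"
        unfolding D_def by (rule bound[OF e(1,2)])
      also have "\<dots> \<le> (D + 1) * e"
        using e(1) by (simp add: distrib_right)
      also have "\<dots> \<le> r"
        using e(4) D by (simp add: le_divide_eq mult.commute)
      finally show "av (f z) \<le> 0 + r"
        by simp
    qed
    then show ?thesis
      by simp
  qed
qed

section \<open>The kernels of T and of the square of U\<close>

text \<open>
  If \<open>U f = 0\<close>, then \<open>V f\<close> is a multiple of \<open>T f\<close> and hence invariant, and \<open>U (V f) = 0\<close> again. So \<open>V\<close> can be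
  iterated: \<open>f (P\<^sup>n z)\<close> is invariant for all \<open>n\<close>.
\<close>

lemma invariant_hecke_V:
  assumes f: "supported f" "invariant k m N f" "hecke_U \<iota> k m P f = (\<lambda>_. 0)"
    and P: "Factorial_Ring.irreducible P" "\<not> P dvd N"
  shows "invariant k m N (hecke_V k m P f)"
proof -
  have P0: "P \<noteq> 0"
    using P by auto
  have "hecke_V k m P f = (\<lambda>z. emb P powi (m - k) * hecke_T \<iota> k m P f z)"
  proof (rule ext)
    fix z
    have "emb P powi (m - k) * emb P powi (k - m) = 1"
      using P0 by (subst power_int_add[symmetric]) auto
    then show "hecke_V k m P f z = emb P powi (m - k) * hecke_T \<iota> k m P f z"
      by (simp add: hecke_T_eq f(3) flip: mult.assoc)
  qed
  moreover have "invariant k m N (\<lambda>z. c * hecke_T \<iota> k m P f z)" for c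
    using invariant_hecke_T[OF f(1,2) P] by (simp add: invariant_def fun_eq_iff slash_cmult)
  ultimately show ?thesis
    by simp
qed

lemma invariant_slash_power:
  assumes f: "supported f" "invariant k m N f" "hecke_U \<iota> k m P f = (\<lambda>_. 0)"
    and P: "Factorial_Ring.irreducible P" "\<not> P dvd N"
  shows "invariant k m N (slash \<iota> k m f (emat (P ^ n) 0 0 1))"
proof -
  define h where "h n = slash \<iota> k m f (emat (P ^ n) 0 0 1)" for n
  have P0: "P \<noteq> 0"
    using P by auto
  have "supported (h n) \<and> invariant k m N (h n) \<and> hecke_U \<iota> k m P (h n) = (\<lambda>_. 0)"
  proof (induction n)
    case 0
    then show ?case
      using f by (simp add: h_def slash_one)
  next
    case (Suc n)
    have "h (Suc n) = hecke_V k m P (h n)"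
      unfolding h_def hecke_V_def using P0 by (subst slash_emat[OF f(1)]) (auto simp: mult.commute)
    then show ?case
      using Suc supported_hecke_V[of "h n" k m P] invariant_hecke_V[OF _ _ _ P, of "h n" k m]
        hecke_U_hecke_V[OF _ _ irreducible_degree_pos[OF P(1)], of "h n" k m N]
      by simp
  qed
  then show ?thesis
    by (simp add: h_def)
qed

text \<open>
  Conjugating by the powers of \<open>diag (P, 1)\<close>, the function \<open>f\<close> is invariant under the lower triangular
  matrix with entry \<open>N / P\<^sup>n\<close>. Multiplying by the translation by \<open>- (P\<^sup>n div N)\<close> makes the lower row
  \<open>(N, P\<^sup>n mod N) / P\<^sup>n\<close>, which tends to \<open>0\<close>.
\<close>

lemma zero_if_hecke_U_zero:
  assumes f: "supported f" "invariant k m N f" "decays f" "hecke_U \<iota> k m P f = (\<lambda>_. 0)"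
    and P: "Factorial_Ring.irreducible P" "\<not> P dvd N"
  shows "f = (\<lambda>_. 0)"
proof (rule zero_if_decays_and_invariant[OF f(3,1)])
  fix e :: real assume e: "0 < e"
  have P0: "P \<noteq> 0" and N0: "N \<noteq> 0"
    using P by auto
  have "(1 :: real) < av (emb P)"
    using irreducible_degree_pos[OF P(1)] card_ge_2 by (simp add: av_emb[OF P0] one_less_power)
  then obtain n where n: "av (emb N) / e < av (emb P) ^ n"
    using real_arch_pow by blast
  define p where "p = emb_poly P ^ n"
  have p0: "p \<noteq> 0"
    using P0 by (simp add: p_def)
  define y where "y = - (P ^ n div N)"
  define c where "c = emb_poly N / p"
  define d where "d = emb_poly (P ^ n mod N) / p"
  have av_p: "av (\<iota> p) = av (emb P) ^ n"
    by (simp add: p_def iota_power av_power)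
  have small: "av (emb Q) / av (\<iota> p) \<le> e" if "av (emb Q) \<le> av (emb N)" for Q
  proof -
    have "av (emb N) < e * av (\<iota> p)"
      using n e by (simp add: av_p divide_less_eq mult.commute)
    then show ?thesis
      using that p0 by (simp add: divide_le_eq)
  qed
  have mod_le: "av (emb (P ^ n mod N)) \<le> av (emb N)"
  proof (cases "P ^ n mod N = 0")
    case False
    then have "Polynomial.degree (P ^ n mod N) \<le> Polynomial.degree N"
      using degree_mod_less[OF N0, of "P ^ n"] by auto
    with False N0 card_ge_2 show ?thesis
      by (simp add: av_emb power_increasing)
  qed simp
  have d_eq: "c * emb_poly y + 1 = d"
  proof -
    have "P ^ n mod N = P ^ n + N * y"
      by (simp add: y_def minus_mult_div_eq_mod)
    then have "emb_poly (P ^ n mod N) = p + emb_poly N * emb_poly y"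
      by (simp add: emb_poly_simps p_def)
    then show ?thesis
      using p0 by (simp add: c_def d_def field_simps)
  qed
  have lower: "slash \<iota> k m f (mat2 1 0 c 1) = f"
  proof -
    let ?h = "slash \<iota> k m f (emat (P ^ n) 0 0 1)"
    have "slash \<iota> k m ?h (emat 1 0 N 1) = ?h"
      using invariant_slash_power[OF f(1,2,4) P, of n, unfolded invariant_def, rule_format, of 1 1 0 N]
      by simp
    then have h: "slash \<iota> k m ?h (mat2 1 0 (emb_poly N) 1) = ?h"
      by simp
    have pinv: "inverse p * 1 - 0 * 0 \<noteq> 0"
      using p0 by simp
    have "slash \<iota> k m (slash \<iota> k m ?h (mat2 1 0 (emb_poly N) 1)) (mat2 (inverse p) 0 0 1) =
        slash \<iota> k m ?h (mat2 (inverse p) 0 0 1)"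
      by (simp only: h)
    moreover have "slash \<iota> k m ?h (mat2 (inverse p) 0 0 1) = f"
      using slash_slash[OF f(1) pinv, of k m "emb_poly (P ^ n)" 0 0 1] p0
      by (simp add: mat2_mult p_def emb_poly_power slash_one)
    moreover have "slash \<iota> k m ?h (mat2 1 0 (emb_poly N) 1) = slash \<iota> k m f (mat2 p 0 (emb_poly N) 1)"
      using slash_emat[OF f(1), of 1 1 0 N k m "P ^ n" 0 0 1] by (simp add: p_def emb_poly_power)
    moreover have "slash \<iota> k m (slash \<iota> k m f (mat2 p 0 (emb_poly N) 1)) (mat2 (inverse p) 0 0 1) =
        slash \<iota> k m f (mat2 1 0 c 1)"
      using slash_slash[OF f(1) pinv, of k m p 0 "emb_poly N" 1] p0
      by (simp add: mat2_mult c_def divide_inverse)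
    ultimately show ?thesis
      by simp
  qed
  have "slash \<iota> k m (slash \<iota> k m f (mat2 1 0 c 1)) (emat 1 y 0 1) = f"
    using f(2)[unfolded invariant_def, rule_format, of 1 1 y 0] by (simp add: lower)
  moreover have "slash \<iota> k m (slash \<iota> k m f (mat2 1 0 c 1)) (emat 1 y 0 1) =
      slash \<iota> k m f (mat2 1 (emb_poly y) c d)"
    using slash_slash[OF f(1), of "emb_poly 1" "emb_poly 1" "emb_poly y" "emb_poly 0" k m 1 0 c 1]
    by (simp add: mat2_mult d_eq)
  ultimately have "slash \<iota> k m f (mat2 1 (emb_poly y) c d) = f"
    by simp
  moreover have "1 * d - emb_poly y * c = 1"
    by (simp add: mult.commute flip: d_eq)
  moreover have "av (\<iota> c) \<le> e" "av (\<iota> d) \<le> e"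
    using small[of N] small[OF mod_le] by (simp_all add: c_def d_def iota_divide av_divide)
  ultimately show "\<exists>a b c d. a * d - b * c = 1 \<and> av (\<iota> c) \<le> e \<and> av (\<iota> d) \<le> e \<and>
      slash \<iota> k m f (mat2 a b c d) = f"
    by blast
qed

text \<open>
  By \<open>U V = 0\<close>, the operators \<open>U T\<close> and \<open>U U\<close> agree on \<open>\<phi>\<close>. So \<open>T \<phi> = 0\<close> implies \<open>U (U \<phi>) = 0\<close>, and conversely
  \<open>U (U \<phi>) = 0\<close> says that \<open>T \<phi>\<close> is in the kernel of \<open>U\<close>, which contains no invariant function that decays.
\<close>

lemma hecke_T_zero_iff:
  assumes \<phi>: "supported \<phi>" "invariant k m N \<phi>" "decays \<phi>"
    and P: "Factorial_Ring.irreducible P" "\<not> P dvd N"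
  shows "hecke_T \<iota> k m P \<phi> = (\<lambda>_. 0) \<longleftrightarrow> hecke_U \<iota> k m P (hecke_U \<iota> k m P \<phi>) = (\<lambda>_. 0)"
proof -
  let ?T = "hecke_T \<iota> k m P" and ?U = "hecke_U \<iota> k m P"
  have P0: "P \<noteq> 0"
    using P by auto
  have UT: "?U (?T \<phi>) = ?U (?U \<phi>)"
  proof (rule ext)
    fix z
    have "?T \<phi> = (\<lambda>z. emb P powi (k - m) * hecke_V k m P \<phi> z + ?U \<phi> z)"
      by (rule ext) (rule hecke_T_eq)
    then have "?U (?T \<phi>) z = emb P powi (k - m) * ?U (hecke_V k m P \<phi>) z + ?U (?U \<phi>) z"
      by (simp only: hecke_U_add hecke_U_cmult)
    then show "?U (?T \<phi>) z = ?U (?U \<phi>) z"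
      by (simp add: hecke_U_hecke_V[OF \<phi>(1,2) irreducible_degree_pos[OF P(1)]])
  qed
  show ?thesis
  proof
    assume "?T \<phi> = (\<lambda>_. 0)"
    then have "?U (?U \<phi>) = ?U (\<lambda>_. 0)"
      by (simp flip: UT)
    then show "?U (?U \<phi>) = (\<lambda>_. 0)"
      by (simp add: fun_eq_iff hecke_U_def slash_def)
  next
    assume "?U (?U \<phi>) = (\<lambda>_. 0)"
    then have "?U (?T \<phi>) = (\<lambda>_. 0)"
      by (simp add: UT)
    then show "?T \<phi> = (\<lambda>_. 0)"
      by (rule zero_if_hecke_U_zero[OF supported_hecke_T[OF \<phi>(1)] invariant_hecke_T[OF \<phi>(1,2) P]
            decays_hecke_T[OF \<phi>(3) P0] _ P])
  qed
qed

end

text \<open>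
  An element \<open>N\<close> of the level that is prime to \<open>P\<close> serves two purposes: the function is invariant for
  the principal level \<open>N\<close>, and \<open>N P\<close> shows that the larger level \<open>I (P)\<close> is not the zero ideal.
\<close>

theorem proposition2p5:
  fixes \<iota> :: "'a::{finite,field} fls \<Rightarrow> 'c::{field,complete_space}"
    and I :: "'a poly set"
    and P :: "'a poly"
    and k m :: int
    and \<phi> :: "'c \<Rightarrow> 'c"
  assumes "completed_alg_closure \<iota>"
    and "ideal I fq_poly_ring"
    and "Polynomial.lead_coeff P = 1"
    and "Factorial_Ring.irreducible P"
    and "\<not> ideal_dvd (cgenideal fq_poly_ring P) I"
    and "k \<ge> 0"
    and "\<phi> \<in> cusp_forms \<iota> k m I"
  shows "\<phi> \<in> op_kernel (cusp_forms \<iota> k m I) (hecke_T \<iota> k m P) \<longleftrightarrow>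
    degeneracy_1 \<phi> \<in> op_kernel (cusp_forms \<iota> k m (ideal_prod fq_poly_ring I (cgenideal fq_poly_ring P)))
      (hecke_U \<iota> k m P ^^ 2)"
proof -
  interpret drinfeld_field \<iota>
    by unfold_locales (rule assms(1))
  obtain N where N: "N \<in> I" "\<not> P dvd N"
    using not_ideal_dvd_element[OF assms(2,5)] .
  then have N0: "N \<noteq> 0" "N * P \<noteq> 0"
    using assms(4) by auto
  have "decays \<phi>"
    unfolding decays_def using cusp_form_decay[OF assms(2) N(1) N0(1) assms(7)] by blast
  then have "hecke_T \<iota> k m P \<phi> = (\<lambda>_. 0) \<longleftrightarrow> hecke_U \<iota> k m P (hecke_U \<iota> k m P \<phi>) = (\<lambda>_. 0)"
    by (rule hecke_T_zero_iff[OF cusp_form_supported[OF assms(7)]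
          cusp_form_invariant[OF assms(7,2) N(1)] _ assms(4) N(2)])
  moreover have "\<phi> \<in> cusp_forms \<iota> k m (ideal_prod fq_poly_ring I (cgenideal fq_poly_ring P))"
    by (rule cusp_forms_antimono[OF assms(2) ideal_prod_cgenideal(1,2)[OF assms(2)]
          ideal_prod_cgenideal(3)[OF assms(2) N(1)] N0(2) assms(7)])
  ultimately show ?thesis
    using assms(7) by (simp add: op_kernel_def degeneracy_1_def numeral_2_eq_2)
qed

end
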